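(* (Green's formula) Let $k$ be a finite field with $q$ elements and let $\mathcal{A}$ be a finitary (skeletally small) hereditary abelian $k$-category. Let $M,N,M',N'$ be objects of $\mathcal{A}$. Then $$a_M a_N a_{M'} a_{N'}\sum_{[L]} g_{MN}^{L}\, g_{M'N'}^{L}\,\frac{1}{a_L} =\sum_{[A],[A'],[B],[B']}\frac{|\mathrm{Ext}^1_{\mathcal{A}}(A,B')|}{|\mathrm{Hom}_{\mathcal{A}}(A,B')|}\; g_{AA'}^{M}\, g_{BB'}^{N}\, g_{AB}^{M'}\, g_{A'B'}^{N'}\; a_A a_{A'} a_B a_{B'},$$ where the sums run over isomorphism classes of objects of $\mathcal{A}$.
   Context: $\mathcal{A}$ finitary means that $\mathrm{Hom}_{\mathcal{A}}(X,Z)$ and $\mathrm{Ext}^1_{\mathcal{A}}(X,Z)$ are finite sets for all objects $X,Z$; hereditary means that $\mathrm{Ext}^i_{\mathcal{A}}$ vanishes for all $i\ge 2$. For a finite set $S$, $|S|$ denotes its cardinality. For an object $X$ of $\mathcal{A}$, $[X]$ denotes its isomorphism class, $\mathrm{Aut}\,X$ its automorphism group, and $a_X:=|\mathrm{Aut}\,X|$. For $X,Z,L\in\mathcal{A}$, let $W_{XZ}^{L}$ be the set of pairs $(\varphi,\psi)$ of morphisms such that $0\to Z\xrightarrow{\varphi}L\xrightarrow{\psi}X\to 0$ is exact in $\mathcal{A}$. The group $\mathrm{Aut}\,X\times\mathrm{Aut}\,Z$ acts freely on $W_{XZ}^{L}$ by $(f,g)\cdot(\varphi,\psi)=(\varphi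 g^{-1},f\psi)$. The Hall number $g_{XZ}^{L}$ is the number of orbits, i.e. $g_{XZ}^{L}=\dfrac{|W_{XZ}^{L}|}{a_X a_Z}$. (So in $g_{XZ}^{L}$ the first lower index $X$ is the quotient and the second lower index $Z$ is the subobject.) *)

theory Defs
  imports
    "HOL-Algebra.Group_Action"
    "HOL-Algebra.Module"
    "HOL-Analysis.Infinite_Sum"
begin

text \<open>
  The field \<open>cat_comp\<close> takes no object arguments. This is no restriction: after tagging every
  morphism with its domain and codomain the Hom-sets are disjoint. Disjointness is not required.
\<close>

record ('o, 'k, 'm) linear_category =
  Obj :: "'o set"
  Hom :: "'o \<Rightarrow> 'o \<Rightarrow> ('k, 'm) module"
  cat_comp :: "'m \<Rightarrow> 'm \<Rightarrow> 'm"  (infixl \<open>\<cdot>\<index>\<close> 70)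
  ident :: "'o \<Rightarrow> 'm"

text \<open>
  \<open>g \<cdot> f\<close> is ``first \<open>f\<close>, then \<open>g\<close>''. Of the module record \<open>Hom C X Y\<close> only the additive
  structure and the scalar multiplication are meaningful; its fields \<open>mult\<close> and \<open>one\<close> are unused.
\<close>

locale linear_category = Ring.field K
  for K :: "('k, 'z) ring_scheme" (structure)
  and C :: "('o, 'k, 'm) linear_category" +
  assumes hom_module:
      "\<lbrakk>X \<in> Obj C; Y \<in> Obj C\<rbrakk> \<Longrightarrow> Module.module K (Hom C X Y)"
    and comp_closed:
      "\<lbrakk>X \<in> Obj C; Y \<in> Obj C; Z \<in> Obj C; f \<in> carrier (Hom C X Y); g \<in> carrier (Hom C Y Z)\<rbrakk>
        \<Longrightarrow> g \<cdot>\<^bsub>C\<^esub> f \<in> carrier (Hom C X Z)"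
    and comp_assoc:
      "\<lbrakk>W \<in> Obj C; X \<in> Obj C; Y \<in> Obj C; Z \<in> Obj C;
        f \<in> carrier (Hom C W X); g \<in> carrier (Hom C X Y); h \<in> carrier (Hom C Y Z)\<rbrakk>
        \<Longrightarrow> (h \<cdot>\<^bsub>C\<^esub> g) \<cdot>\<^bsub>C\<^esub> f = h \<cdot>\<^bsub>C\<^esub> (g \<cdot>\<^bsub>C\<^esub> f)"
    and ident_closed:
      "X \<in> Obj C \<Longrightarrow> ident C X \<in> carrier (Hom C X X)"
    and ident_right:
      "\<lbrakk>X \<in> Obj C; Y \<in> Obj C; f \<in> carrier (Hom C X Y)\<rbrakk> \<Longrightarrow> f \<cdot>\<^bsub>C\<^esub> ident C X = f"
    and ident_left:
      "\<lbrakk>X \<in> Obj C; Y \<in> Obj C; f \<in> carrier (Hom C X Y)\<rbrakk> \<Longrightarrow> ident C Y \<cdot>\<^bsub>C\<^esub> f = f"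
    and comp_add_left:
      "\<lbrakk>X \<in> Obj C; Y \<in> Obj C; Z \<in> Obj C; f \<in> carrier (Hom C X Y);
        g \<in> carrier (Hom C Y Z); h \<in> carrier (Hom C Y Z)\<rbrakk>
        \<Longrightarrow> (g \<oplus>\<^bsub>Hom C Y Z\<^esub> h) \<cdot>\<^bsub>C\<^esub> f = g \<cdot>\<^bsub>C\<^esub> f \<oplus>\<^bsub>Hom C X Z\<^esub> h \<cdot>\<^bsub>C\<^esub> f"
    and comp_add_right:
      "\<lbrakk>X \<in> Obj C; Y \<in> Obj C; Z \<in> Obj C; f \<in> carrier (Hom C X Y); g \<in> carrier (Hom C X Y);
        h \<in> carrier (Hom C Y Z)\<rbrakk>
        \<Longrightarrow> h \<cdot>\<^bsub>C\<^esub> (f \<oplus>\<^bsub>Hom C X Y\<^esub> g) = h \<cdot>\<^bsub>C\<^esub> f \<oplus>\<^bsub>Hom C X Z\<^esub> h \<cdot>\<^bsub>C\<^esub> g"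
    and comp_smult_left:
      "\<lbrakk>X \<in> Obj C; Y \<in> Obj C; Z \<in> Obj C; f \<in> carrier (Hom C X Y); g \<in> carrier (Hom C Y Z);
        a \<in> carrier K\<rbrakk>
        \<Longrightarrow> (a \<odot>\<^bsub>Hom C Y Z\<^esub> g) \<cdot>\<^bsub>C\<^esub> f = a \<odot>\<^bsub>Hom C X Z\<^esub> (g \<cdot>\<^bsub>C\<^esub> f)"
    and comp_smult_right:
      "\<lbrakk>X \<in> Obj C; Y \<in> Obj C; Z \<in> Obj C; f \<in> carrier (Hom C X Y); g \<in> carrier (Hom C Y Z);
        a \<in> carrier K\<rbrakk>
        \<Longrightarrow> g \<cdot>\<^bsub>C\<^esub> (a \<odot>\<^bsub>Hom C X Y\<^esub> f) = a \<odot>\<^bsub>Hom C X Z\<^esub> (g \<cdot>\<^bsub>C\<^esub> f)"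

definition is_zero_object :: "('o, 'k, 'm) linear_category \<Rightarrow> 'o \<Rightarrow> bool" where
  "is_zero_object C U \<longleftrightarrow> U \<in> Obj C \<and>
     (\<forall>X\<in>Obj C. (\<exists>!f. f \<in> carrier (Hom C U X)) \<and> (\<exists>!f. f \<in> carrier (Hom C X U)))"

definition is_biproduct ::
  "('o, 'k, 'm) linear_category \<Rightarrow> 'o \<Rightarrow> 'o \<Rightarrow> 'o \<Rightarrow> 'm \<Rightarrow> 'm \<Rightarrow> 'm \<Rightarrow> 'm \<Rightarrow> bool" where
  "is_biproduct C X Y P i\<^sub>1 i\<^sub>2 p\<^sub>1 p\<^sub>2 \<longleftrightarrow> P \<in> Obj C \<and>
     i\<^sub>1 \<in> carrier (Hom C X P) \<and> i\<^sub>2 \<in> carrier (Hom C Y P) \<and>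
     p\<^sub>1 \<in> carrier (Hom C P X) \<and> p\<^sub>2 \<in> carrier (Hom C P Y) \<and>
     p\<^sub>1 \<cdot>\<^bsub>C\<^esub> i\<^sub>1 = ident C X \<and> p\<^sub>2 \<cdot>\<^bsub>C\<^esub> i\<^sub>2 = ident C Y \<and>
     p\<^sub>1 \<cdot>\<^bsub>C\<^esub> i\<^sub>2 = \<zero>\<^bsub>Hom C Y X\<^esub> \<and> p\<^sub>2 \<cdot>\<^bsub>C\<^esub> i\<^sub>1 = \<zero>\<^bsub>Hom C X Y\<^esub> \<and>
     i\<^sub>1 \<cdot>\<^bsub>C\<^esub> p\<^sub>1 \<oplus>\<^bsub>Hom C P P\<^esub> i\<^sub>2 \<cdot>\<^bsub>C\<^esub> p\<^sub>2 = ident C P"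

definition is_mono :: "('o, 'k, 'm) linear_category \<Rightarrow> 'o \<Rightarrow> 'o \<Rightarrow> 'm \<Rightarrow> bool" where
  "is_mono C X Y f \<longleftrightarrow> f \<in> carrier (Hom C X Y) \<and>
     (\<forall>W\<in>Obj C. \<forall>u\<in>carrier (Hom C W X). \<forall>v\<in>carrier (Hom C W X).
        f \<cdot>\<^bsub>C\<^esub> u = f \<cdot>\<^bsub>C\<^esub> v \<longrightarrow> u = v)"

definition is_epi :: "('o, 'k, 'm) linear_category \<Rightarrow> 'o \<Rightarrow> 'o \<Rightarrow> 'm \<Rightarrow> bool" where
  "is_epi C X Y f \<longleftrightarrow> f \<in> carrier (Hom C X Y) \<and>
     (\<forall>W\<in>Obj C. \<forall>u\<in>carrier (Hom C Y W). \<forall>v\<in>carrier (Hom C Y W).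
        u \<cdot>\<^bsub>C\<^esub> f = v \<cdot>\<^bsub>C\<^esub> f \<longrightarrow> u = v)"

text \<open>\<open>is_kernel C X Y f N n\<close>: the morphism \<open>n : N \<rightarrow> X\<close> is a kernel of \<open>f : X \<rightarrow> Y\<close>.\<close>

definition is_kernel ::
  "('o, 'k, 'm) linear_category \<Rightarrow> 'o \<Rightarrow> 'o \<Rightarrow> 'm \<Rightarrow> 'o \<Rightarrow> 'm \<Rightarrow> bool" where
  "is_kernel C X Y f N n \<longleftrightarrow> f \<in> carrier (Hom C X Y) \<and>
     N \<in> Obj C \<and> n \<in> carrier (Hom C N X) \<and> f \<cdot>\<^bsub>C\<^esub> n = \<zero>\<^bsub>Hom C N Y\<^esub> \<and>
     (\<forall>W\<in>Obj C. \<forall>u\<in>carrier (Hom C W X). f \<cdot>\<^bsub>C\<^esub> u = \<zero>\<^bsub>Hom C W Y\<^esub> \<longrightarrow>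
        (\<exists>!v. v \<in> carrier (Hom C W N) \<and> n \<cdot>\<^bsub>C\<^esub> v = u))"

text \<open>\<open>is_cokernel C X Y f Q q\<close>: the morphism \<open>q : Y \<rightarrow> Q\<close> is a cokernel of \<open>f : X \<rightarrow> Y\<close>.\<close>

definition is_cokernel ::
  "('o, 'k, 'm) linear_category \<Rightarrow> 'o \<Rightarrow> 'o \<Rightarrow> 'm \<Rightarrow> 'o \<Rightarrow> 'm \<Rightarrow> bool" where
  "is_cokernel C X Y f Q q \<longleftrightarrow> f \<in> carrier (Hom C X Y) \<and>
     Q \<in> Obj C \<and> q \<in> carrier (Hom C Y Q) \<and> q \<cdot>\<^bsub>C\<^esub> f = \<zero>\<^bsub>Hom C X Q\<^esub> \<and>
     (\<forall>W\<in>Obj C. \<forall>u\<in>carrier (Hom C Y W). u \<cdot>\<^bsub>C\<^esub> f = \<zero>\<^bsub>Hom C X W\<^esub> \<longrightarrow>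
        (\<exists>!v. v \<in> carrier (Hom C Q W) \<and> v \<cdot>\<^bsub>C\<^esub> q = u))"

locale abelian_linear_category = linear_category +
  assumes zero_object: "\<exists>U. is_zero_object C U"
    and biproducts:
      "\<lbrakk>X \<in> Obj C; Y \<in> Obj C\<rbrakk> \<Longrightarrow> \<exists>P i\<^sub>1 i\<^sub>2 p\<^sub>1 p\<^sub>2. is_biproduct C X Y P i\<^sub>1 i\<^sub>2 p\<^sub>1 p\<^sub>2"
    and kernels:
      "\<lbrakk>X \<in> Obj C; Y \<in> Obj C; f \<in> carrier (Hom C X Y)\<rbrakk> \<Longrightarrow> \<exists>N n. is_kernel C X Y f N n"
    and cokernels:
      "\<lbrakk>X \<in> Obj C; Y \<in> Obj C; f \<in> carrier (Hom C X Y)\<rbrakk> \<Longrightarrow> \<exists>Q q. is_cokernel C X Y f Q q"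
    and mono_is_kernel:
      "\<lbrakk>X \<in> Obj C; Y \<in> Obj C; is_mono C X Y f\<rbrakk> \<Longrightarrow> \<exists>Z\<in>Obj C. \<exists>g. is_kernel C Y Z g X f"
    and epi_is_cokernel:
      "\<lbrakk>X \<in> Obj C; Y \<in> Obj C; is_epi C X Y f\<rbrakk> \<Longrightarrow> \<exists>W\<in>Obj C. \<exists>g. is_cokernel C W X g Y f"

text \<open>The image of \<open>f : X \<rightarrow> Y\<close> is the kernel of its cokernel.\<close>

definition is_image ::
  "('o, 'k, 'm) linear_category \<Rightarrow> 'o \<Rightarrow> 'o \<Rightarrow> 'm \<Rightarrow> 'o \<Rightarrow> 'm \<Rightarrow> bool" where
  "is_image C X Y f I i \<longleftrightarrow> (\<exists>Q q. is_cokernel C X Y f Q q \<and> is_kernel C Y Q q I i)"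

definition exact_at ::
  "('o, 'k, 'm) linear_category \<Rightarrow> 'o \<Rightarrow> 'o \<Rightarrow> 'o \<Rightarrow> 'm \<Rightarrow> 'm \<Rightarrow> bool" where
  "exact_at C X Y Z f g \<longleftrightarrow> (\<exists>I i. is_image C X Y f I i \<and> is_kernel C Y Z g I i)"

text \<open>\<open>fs ! i\<close> goes from \<open>Xs ! i\<close> to \<open>Xs ! (i + 1)\<close>.\<close>

definition exact_sequence :: "('o, 'k, 'm) linear_category \<Rightarrow> 'o list \<Rightarrow> 'm list \<Rightarrow> bool" where
  "exact_sequence C Xs fs \<longleftrightarrow> set Xs \<subseteq> Obj C \<and> length Xs = length fs + 1 \<and>
     (\<forall>i<length fs. fs ! i \<in> carrier (Hom C (Xs ! i) (Xs ! (i + 1)))) \<and>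
     (\<forall>i. i + 1 < length fs \<longrightarrow>
        exact_at C (Xs ! i) (Xs ! (i + 1)) (Xs ! (i + 2)) (fs ! i) (fs ! (i + 1)))"

text \<open>
  Yoneda's description of Ext for \<open>n \<ge> 1\<close>, which needs neither projectives nor injectives.
  An element of \<open>extensions C n X Z\<close> is an exact sequence
  \<open>0 \<rightarrow> Z \<rightarrow> E\<^sub>1 \<rightarrow> \<dots> \<rightarrow> E\<^sub>n \<rightarrow> X \<rightarrow> 0\<close>, given by its \<open>n\<close> middle terms and its \<open>n + 1\<close> morphisms.
\<close>

definition extensions ::
  "('o, 'k, 'm) linear_category \<Rightarrow> nat \<Rightarrow> 'o \<Rightarrow> 'o \<Rightarrow> ('o list \<times> 'm list) set" where
  "extensions C n X Z = {(Es, fs). length Es = n \<and>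
     (\<exists>U. is_zero_object C U \<and>
        exact_sequence C (U # Z # Es @ [X, U]) (\<zero>\<^bsub>Hom C U Z\<^esub> # fs @ [\<zero>\<^bsub>Hom C X U\<^esub>]))}"

text \<open>Pairs of extensions related by a morphism that is the identity on \<open>Z\<close> and on \<open>X\<close>.\<close>

definition extension_morphisms ::
  "('o, 'k, 'm) linear_category \<Rightarrow> nat \<Rightarrow> 'o \<Rightarrow> 'o \<Rightarrow>
    (('o list \<times> 'm list) \<times> ('o list \<times> 'm list)) set" where
  "extension_morphisms C n X Z = {((Es, fs), (Es', fs')).
     (Es, fs) \<in> extensions C n X Z \<and> (Es', fs') \<in> extensions C n X Z \<and>
     (\<exists>hs. length hs = n + 2 \<and> hs ! 0 = ident C Z \<and> hs ! (n + 1) = ident C X \<and>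
        (\<forall>i<n + 2. hs ! i \<in> carrier (Hom C ((Z # Es @ [X]) ! i) ((Z # Es' @ [X]) ! i))) \<and>
        (\<forall>i<n + 1. hs ! (i + 1) \<cdot>\<^bsub>C\<^esub> fs ! i = fs' ! i \<cdot>\<^bsub>C\<^esub> hs ! i))}"

text \<open>
  \<open>Ext\<^sup>n(X, Z)\<close> is the quotient by the equivalence relation generated by these morphisms.
  Only the underlying set is needed: being the zero group means having exactly one element.
\<close>

definition Ext ::
  "('o, 'k, 'm) linear_category \<Rightarrow> nat \<Rightarrow> 'o \<Rightarrow> 'o \<Rightarrow> ('o list \<times> 'm list) set set" where
  "Ext C n X Z = extensions C n X Z //
     (extension_morphisms C n X Z \<union> (extension_morphisms C n X Z)\<inverse>)\<^sup>*"

definition finitary :: "('o, 'k, 'm) linear_category \<Rightarrow> bool" where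
  "finitary C \<longleftrightarrow>
     (\<forall>X\<in>Obj C. \<forall>Z\<in>Obj C. finite (carrier (Hom C X Z)) \<and> finite (Ext C 1 X Z))"

definition hereditary :: "('o, 'k, 'm) linear_category \<Rightarrow> bool" where
  "hereditary C \<longleftrightarrow> (\<forall>i\<ge>2. \<forall>X\<in>Obj C. \<forall>Z\<in>Obj C. is_singleton (Ext C i X Z))"

definition Aut :: "('o, 'k, 'm) linear_category \<Rightarrow> 'o \<Rightarrow> 'm monoid" where
  "Aut C X = units_of \<lparr>carrier = carrier (Hom C X X), monoid.mult = cat_comp C, one = ident C X\<rparr>"

definition aut_card :: "('o, 'k, 'm) linear_category \<Rightarrow> 'o \<Rightarrow> nat" where
  "aut_card C X = order (Aut C X)"

text \<open>\<open>hall_pairs C X Z L\<close> is the set of short exact sequences \<open>0 \<rightarrow> Z \<rightarrow> L \<rightarrow> X \<rightarrow> 0\<close>.\<close>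

definition hall_pairs :: "('o, 'k, 'm) linear_category \<Rightarrow> 'o \<Rightarrow> 'o \<Rightarrow> 'o \<Rightarrow> ('m \<times> 'm) set" where
  "hall_pairs C X Z L = {(\<phi>, \<psi>). \<exists>U. is_zero_object C U \<and>
     exact_sequence C [U, Z, L, X, U] [\<zero>\<^bsub>Hom C U Z\<^esub>, \<phi>, \<psi>, \<zero>\<^bsub>Hom C X U\<^esub>]}"

definition hall_action ::
  "('o, 'k, 'm) linear_category \<Rightarrow> 'o \<Rightarrow> 'o \<Rightarrow> 'o \<Rightarrow> 'm \<times> 'm \<Rightarrow> 'm \<times> 'm \<Rightarrow> 'm \<times> 'm" where
  "hall_action C X Z L =
     (\<lambda>(f, g). \<lambda>(\<phi>, \<psi>)\<in>hall_pairs C X Z L. (\<phi> \<cdot>\<^bsub>C\<^esub> (inv\<^bsub>Aut C Z\<^esub> g), f \<cdot>\<^bsub>C\<^esub> \<psi>))"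

definition hall_number :: "('o, 'k, 'm) linear_category \<Rightarrow> 'o \<Rightarrow> 'o \<Rightarrow> 'o \<Rightarrow> nat" where
  "hall_number C X Z L = card (orbits (Aut C X \<times>\<times> Aut C Z) (hall_pairs C X Z L) (hall_action C X Z L))"

definition iso_rel :: "('o, 'k, 'm) linear_category \<Rightarrow> ('o \<times> 'o) set" where
  "iso_rel C = {(X, Y). X \<in> Obj C \<and> Y \<in> Obj C \<and>
     (\<exists>f\<in>carrier (Hom C X Y). \<exists>g\<in>carrier (Hom C Y X).
        g \<cdot>\<^bsub>C\<^esub> f = ident C X \<and> f \<cdot>\<^bsub>C\<^esub> g = ident C Y)}"

text \<open>
  Sums over isomorphism classes are written as sums over one chosen representative of each class;
  all summands in question only depend on the isomorphism classes.
\<close>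

definition iso_reps :: "('o, 'k, 'm) linear_category \<Rightarrow> 'o set" where
  "iso_reps C = (\<lambda>c. SOME X. X \<in> c) ` (Obj C // iso_rel C)"

end

theory Submission
  imports Defs
begin

text \<open>
  Both sides count, with weight \<open>1/|Aut|\<close>, the diagrams with exact rows and columns that have \<open>L\<close> in
  the centre, the corners \<open>A, A', B, B'\<close> and the edges \<open>M, N, M', N'\<close>.  A pair of short exact
      sequences
  through \<open>L\<close> (a \<^emph>\<open>cross\<close>) determines its four corners up to unique isomorphism, so it extends to
  exactly \<open>a\<^sub>A a\<^sub>A\<^sub>' a\<^sub>B a\<^sub>B\<^sub>'\<close> diagrams with prescribed corners.  Conversely, fix the four outer
      short exact
  sequences (a \<^emph>\<open>frame\<close>), let \<open>S\<close> be the pushout of \<open>N \<leftarrow> B' \<rightarrow> N'\<close> and \<open>T\<close> the pullback of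
  \<open>M \<rightarrow> A \<leftarrow> M'\<close>.  The crosses filling the frame are the factorisations \<open>S \<rightarrow> L \<rightarrow> T\<close> of the canonical
      map
  that split the exact sequence \<open>0 \<rightarrow> B' \<rightarrow> S \<rightarrow> T \<rightarrow> A \<rightarrow> 0\<close> into two short ones.  They exist because
      the
  class of this sequence in \<open>Ext\<^sup>2(A, B')\<close> vanishes; their isomorphism classes form a torsor under
  \<open>Ext\<^sup>1(A, B')\<close>; and the automorphisms of each of them are the maps \<open>1 + h\<close> with \<open>h\<close> coming from
  \<open>Hom(A, B')\<close>.  Hence the weighted number of fillings is \<open>|Ext\<^sup>1(A, B')| / |Hom(A, B')|\<close>.

  Morphisms are tagged with source and target, so that composition and addition become total
  operations satisfying associativity and distributivity without side conditions.
\<close>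

section \<open>Abelian categories in terms of arrows\<close>

text \<open>The torsor under Ext^1 is used only as a bijection of sets: neither the group law of
  Ext^1 nor its action on completions is constructed. Relative to a base completion, the relation
  \<open>baer\<close> between extensions and completions is total on both sides and respects the two
  equivalences in both directions, and this already yields a bijection of quotients. Vanishing of
  Ext^2 enters through one invariant: having a completion passes along every morphism of two-fold
  extensions, forward by a pushout and backward by a pullback. The trivial extension has a
  completion, so a zigzag brings one to every exact sequence. The constants arise as follows. A set
  of short exact sequences with fixed terms has a_X a_Z g elements. Each corner is an end term of
  two of the four sides of a frame, so the number of frames contains the square of every corner
  factor; the frames over one cross form a torsor under the four corner groups, which divides one
  power away. Diagram chases use generalised elements: a preimage is allowed to exist only after
  composing with an epimorphism.\<close>

locale preadditive =
  fixes Ob :: "'o set" and arr :: "'a \<Rightarrow> bool" and src tgt :: "'a \<Rightarrow> 'o"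
    and comp :: "'a \<Rightarrow> 'a \<Rightarrow> 'a" (infixl \<open>\<star>\<close> 70)
    and add :: "'a \<Rightarrow> 'a \<Rightarrow> 'a" (infixl \<open>\<boxplus>\<close> 65)
    and neg :: "'a \<Rightarrow> 'a" and zer :: "'o \<Rightarrow> 'o \<Rightarrow> 'a" and idn :: "'o \<Rightarrow> 'a"
  assumes src_Ob [simp]: "arr f \<Longrightarrow> src f \<in> Ob"
    and tgt_Ob [simp]: "arr f \<Longrightarrow> tgt f \<in> Ob"
    and arr_comp [simp]: "arr (g \<star> f) \<longleftrightarrow> arr g \<and> arr f \<and> tgt f = src g"
    and src_comp [simp]: "\<lbrakk>arr g; arr f; tgt f = src g\<rbrakk> \<Longrightarrow> src (g \<star> f) = src f"
    and tgt_comp [simp]: "\<lbrakk>arr g; arr f; tgt f = src g\<rbrakk> \<Longrightarrow> tgt (g \<star> f) = tgt g"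
    and comp_assoc: "(h \<star> g) \<star> f = h \<star> (g \<star> f)"
    and arr_add [simp]: "arr (f \<boxplus> g) \<longleftrightarrow> arr f \<and> arr g \<and> src f = src g \<and> tgt f = tgt g"
    and src_add [simp]: "\<lbrakk>arr f; arr g; src f = src g; tgt f = tgt g\<rbrakk> \<Longrightarrow> src (f \<boxplus> g) = src g"
    and tgt_add [simp]: "\<lbrakk>arr f; arr g; src f = src g; tgt f = tgt g\<rbrakk> \<Longrightarrow> tgt (f \<boxplus> g) = tgt g"
    and add_assoc: "(f \<boxplus> g) \<boxplus> h = f \<boxplus> (g \<boxplus> h)"
    and add_commute: "f \<boxplus> g = g \<boxplus> f"
    and arr_zer [simp]: "\<lbrakk>X \<in> Ob; Y \<in> Ob\<rbrakk> \<Longrightarrow> arr (zer X Y)"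
    and src_zer [simp]: "\<lbrakk>X \<in> Ob; Y \<in> Ob\<rbrakk> \<Longrightarrow> src (zer X Y) = X"
    and tgt_zer [simp]: "\<lbrakk>X \<in> Ob; Y \<in> Ob\<rbrakk> \<Longrightarrow> tgt (zer X Y) = Y"
    and add_zer: "arr f \<Longrightarrow> f \<boxplus> zer (src f) (tgt f) = f"
    and arr_neg [simp]: "arr (neg f) \<longleftrightarrow> arr f"
    and src_neg [simp]: "arr f \<Longrightarrow> src (neg f) = src f"
    and tgt_neg [simp]: "arr f \<Longrightarrow> tgt (neg f) = tgt f"
    and add_neg: "arr f \<Longrightarrow> f \<boxplus> neg f = zer (src f) (tgt f)"
    and comp_add: "h \<star> (f \<boxplus> g) = h \<star> f \<boxplus> h \<star> g"
    and add_comp: "(g \<boxplus> h) \<star> f = g \<star> f \<boxplus> h \<star> f"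
    and comp_neg: "h \<star> neg f = neg (h \<star> f)"
    and neg_comp: "neg h \<star> f = neg (h \<star> f)"
    and arr_idn [simp]: "X \<in> Ob \<Longrightarrow> arr (idn X)"
    and src_idn [simp]: "X \<in> Ob \<Longrightarrow> src (idn X) = X"
    and tgt_idn [simp]: "X \<in> Ob \<Longrightarrow> tgt (idn X) = X"
    and comp_idn: "\<lbrakk>arr f; src f = X\<rbrakk> \<Longrightarrow> f \<star> idn X = f"
    and idn_comp: "\<lbrakk>arr f; tgt f = X\<rbrakk> \<Longrightarrow> idn X \<star> f = f"
begin

definition sub :: "'a \<Rightarrow> 'a \<Rightarrow> 'a" (infixl \<open>\<boxminus>\<close> 65) where "f \<boxminus> g = f \<boxplus> neg g"

text \<open>Arrows carry their source and target, so a single predicate \<open>isz\<close> singles out all zero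
  morphisms, and \<open>isz (f \<star> u)\<close> includes that \<open>f\<close> and \<open>u\<close> are composable.\<close>

definition isz :: "'a \<Rightarrow> bool" where "isz u \<longleftrightarrow> arr u \<and> u = zer (src u) (tgt u)"
definition mono :: "'a \<Rightarrow> bool" where "mono f \<longleftrightarrow> arr f \<and> (\<forall>u. isz (f \<star> u) \<longrightarrow> isz u)"
definition epi :: "'a \<Rightarrow> bool" where "epi f \<longleftrightarrow> arr f \<and> (\<forall>u. isz (u \<star> f) \<longrightarrow> isz u)"
definition ker :: "'a \<Rightarrow> 'a \<Rightarrow> bool" where
  "ker k f \<longleftrightarrow> isz (f \<star> k) \<and> (\<forall>u. isz (f \<star> u) \<longrightarrow> (\<exists>!v. k \<star> v = u))"
definition cok :: "'a \<Rightarrow> 'a \<Rightarrow> bool" where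
  "cok q f \<longleftrightarrow> isz (q \<star> f) \<and> (\<forall>u. isz (u \<star> f) \<longrightarrow> (\<exists>!v. v \<star> q = u))"
definition ses :: "'a \<Rightarrow> 'a \<Rightarrow> bool" where "ses f g \<longleftrightarrow> ker f g \<and> cok g f"

definition pb :: "'a \<Rightarrow> 'a \<Rightarrow> 'a \<Rightarrow> 'a \<Rightarrow> bool" where
  "pb p q f g \<longleftrightarrow> arr (f \<star> p) \<and> f \<star> p = g \<star> q \<and>
     (\<forall>u v. arr (f \<star> u) \<and> f \<star> u = g \<star> v \<longrightarrow> (\<exists>!w. p \<star> w = u \<and> q \<star> w = v))"
definition po :: "'a \<Rightarrow> 'a \<Rightarrow> 'a \<Rightarrow> 'a \<Rightarrow> bool" where
  "po p q f g \<longleftrightarrow> arr (p \<star> f) \<and> p \<star> f = q \<star> g \<and>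
     (\<forall>u v. arr (u \<star> f) \<and> u \<star> f = v \<star> g \<longrightarrow> (\<exists>!w. w \<star> p = u \<and> w \<star> q = v))"

text \<open>The axioms are symmetric under reversal of arrows, so every theorem about monos, kernels
  and pullbacks yields one about epis, cokernels and pushouts without a second proof.\<close>

lemma dual_preadditive:
  "preadditive Ob arr tgt src (\<lambda>g f. f \<star> g) add neg (\<lambda>X Y. zer Y X) idn"
  by unfold_locales
    (auto simp: comp_assoc add_assoc add_zer add_neg comp_add add_comp comp_neg neg_comp
      comp_idn idn_comp intro: add_commute)

lemma add_left_commute: "f \<boxplus> (g \<boxplus> h) = g \<boxplus> (f \<boxplus> h)"
  by (metis add_assoc add_commute)

lemmas add_ac = add_assoc add_commute add_left_commute

text \<open>Definedness of the sum has to be assumed: in the tagged model all ill-typed sums have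
  the same value, so they do not cancel.\<close>

lemma add_cancel: "\<lbrakk>arr f; f \<boxplus> g = f \<boxplus> h; arr (f \<boxplus> g)\<rbrakk> \<Longrightarrow> g = h"
proof -
  assume a: "arr f" "f \<boxplus> g = f \<boxplus> h" "arr (f \<boxplus> g)"
  have h: "arr (f \<boxplus> h)" using a by metis
  have "neg f \<boxplus> (f \<boxplus> g) = neg f \<boxplus> (f \<boxplus> h)" using a by simp
  then have "(f \<boxplus> neg f) \<boxplus> g = (f \<boxplus> neg f) \<boxplus> h" by (simp add: add_ac)
  then show ?thesis using a(1,3) h by (simp add: add_neg) (metis add_commute add_zer)
qed

lemma isz_arr: "isz u \<Longrightarrow> arr u" by (simp add: isz_def)

lemma isz_zer [simp]: "\<lbrakk>X \<in> Ob; Y \<in> Ob\<rbrakk> \<Longrightarrow> isz (zer X Y)" by (simp add: isz_def)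

lemma isz_eq: "\<lbrakk>isz u; isz v; src u = src v; tgt u = tgt v\<rbrakk> \<Longrightarrow> u = v"
  by (metis isz_def)

text \<open>A description of zero morphisms that mentions no source or target. By distributivity it
  passes through composition on either side, which gives the two absorption rules that
  follow.\<close>

lemma isz_iff_idem: "isz u \<longleftrightarrow> arr u \<and> u \<boxplus> u = u"
proof
  assume "isz u" then show "arr u \<and> u \<boxplus> u = u" by (metis isz_def add_zer)
next
  assume a: "arr u \<and> u \<boxplus> u = u"
  then have "u \<boxplus> u = u \<boxplus> zer (src u) (tgt u)" by (simp add: add_zer)
  then show "isz u" using a add_cancel[of u u "zer (src u) (tgt u)"] by (auto simp: isz_def)
qed

lemma isz_comp_left: "\<lbrakk>isz f; arr (f \<star> g)\<rbrakk> \<Longrightarrow> isz (f \<star> g)"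
  by (metis isz_iff_idem add_comp)
lemma isz_comp_right: "\<lbrakk>isz g; arr (f \<star> g)\<rbrakk> \<Longrightarrow> isz (f \<star> g)"
  by (metis isz_iff_idem comp_add)

lemma add_isz: "\<lbrakk>isz g; arr (f \<boxplus> g)\<rbrakk> \<Longrightarrow> f \<boxplus> g = f"
  by (metis isz_def arr_add add_zer)
lemma isz_add: "\<lbrakk>isz g; arr (g \<boxplus> f)\<rbrakk> \<Longrightarrow> g \<boxplus> f = f"
  by (metis arr_add add_isz add_commute)
lemma isz_neg [simp]: "isz (neg f) \<longleftrightarrow> isz f"
proof -
  have *: "isz f \<Longrightarrow> isz (neg f)" for f
    by (metis add_neg arr_add arr_neg isz_add isz_arr isz_zer src_Ob src_neg tgt_Ob tgt_neg)
  have "arr f \<Longrightarrow> neg (neg f) = f"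
    using add_cancel[of "neg f" "neg (neg f)" f] by (simp add: add_neg add_commute)
  then show ?thesis using * by (metis arr_neg isz_arr)
qed

lemma arr_sub [simp]: "arr (f \<boxminus> g) \<longleftrightarrow> arr f \<and> arr g \<and> src f = src g \<and> tgt f = tgt g"
  by (auto simp: sub_def)
lemma src_sub [simp]: "\<lbrakk>arr f; arr g; src f = src g; tgt f = tgt g\<rbrakk> \<Longrightarrow> src (f \<boxminus> g) = src g"
  by (auto simp: sub_def)
lemma tgt_sub [simp]: "\<lbrakk>arr f; arr g; src f = src g; tgt f = tgt g\<rbrakk> \<Longrightarrow> tgt (f \<boxminus> g) = tgt g"
  by (auto simp: sub_def)
lemma comp_sub: "h \<star> (f \<boxminus> g) = h \<star> f \<boxminus> h \<star> g" by (simp add: sub_def comp_add comp_neg)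
lemma sub_comp: "(f \<boxminus> g) \<star> h = f \<star> h \<boxminus> g \<star> h" by (simp add: sub_def add_comp neg_comp)

text \<open>Converts an equation into the vanishing of a difference, to which kernels and cokernels
  apply. The typing is part of the equivalence and needs no separate bookkeeping.\<close>

lemma isz_sub_iff: "isz (f \<boxminus> g) \<longleftrightarrow> arr f \<and> f = g"
proof
  assume z: "isz (f \<boxminus> g)"
  then have a: "arr f" "arr g" "src f = src g" "tgt f = tgt g" using isz_arr[OF z] by auto
  have "g \<boxplus> (f \<boxminus> g) = f"
    using a by (metis sub_def add_left_commute add_neg add_zer add_commute)
  then show "arr f \<and> f = g" using add_isz[OF z, of g] a by auto
qed (auto simp: sub_def add_neg)

lemma sub_add_cancel: "\<lbrakk>arr (f \<boxminus> g)\<rbrakk> \<Longrightarrow> (f \<boxminus> g) \<boxplus> g = f"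
  by (metis add_assoc add_commute add_neg add_zer arr_sub sub_def)

lemma sub_isz: "\<lbrakk>isz g; arr (f \<boxminus> g)\<rbrakk> \<Longrightarrow> f \<boxminus> g = f"
  by (simp add: sub_def add_isz)

lemma isz_sub: "\<lbrakk>isz f; arr (f \<boxminus> g)\<rbrakk> \<Longrightarrow> f \<boxminus> g = neg g"
  by (simp add: sub_def isz_add)

lemma add_isz_iff: "isz (f \<boxplus> g) \<Longrightarrow> isz g \<longleftrightarrow> isz f"
  by (metis add_isz isz_add isz_arr)

lemma monoD:
  assumes "mono f" "arr (f \<star> u)" "f \<star> u = f \<star> v"
  shows "u = v"
proof -
  have "isz (f \<star> (u \<boxminus> v))" using assms(2,3) by (simp only: comp_sub isz_sub_iff simp_thms)
  then have "isz (u \<boxminus> v)" using assms(1) by (simp only: mono_def)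
  then show ?thesis by (simp only: isz_sub_iff)
qed

lemma mono_isz: "mono f \<Longrightarrow> isz (f \<star> u) \<Longrightarrow> isz u" by (simp add: mono_def)
lemma mono_arr: "mono f \<Longrightarrow> arr f" by (simp add: mono_def)
lemma epi_isz: "epi f \<Longrightarrow> isz (u \<star> f) \<Longrightarrow> isz u" by (simp add: epi_def)
lemma epi_arr: "epi f \<Longrightarrow> arr f" by (simp add: epi_def)

lemma mono_comp: "\<lbrakk>mono f; mono g; arr (f \<star> g)\<rbrakk> \<Longrightarrow> mono (f \<star> g)"
  unfolding mono_def comp_assoc by blast

lemma mono_comp_right:
  assumes "mono (f \<star> g)" shows "mono g"
proof -
  have a: "arr f" "arr g" "tgt g = src f" using mono_arr[OF assms] by auto
  have "isz u" if u: "isz (g \<star> u)" for u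
  proof -
    have "isz ((f \<star> g) \<star> u)"
      unfolding comp_assoc by (rule isz_comp_right[OF u]) (use a isz_arr[OF u] in auto)
    then show ?thesis by (rule mono_isz[OF assms])
  qed
  then show ?thesis using a(2) unfolding mono_def by blast
qed

lemma ker_isz: "ker k f \<Longrightarrow> isz (f \<star> k)"
  unfolding ker_def by blast

text \<open>If \<open>k \<star> u\<close> is zero, then \<open>u\<close> and the zero morphism with
  the same ends both lift it, and uniqueness in the universal property identifies them.\<close>

lemma ker_mono: "ker k f \<Longrightarrow> mono k"
proof -
  assume k: "ker k f"
  have ar: "arr k" "arr f" "tgt k = src f"
    using isz_arr[OF ker_isz[OF k]] by auto
  show "mono k" unfolding mono_def
  proof (intro conjI allI impI)
    fix u assume u: "isz (k \<star> u)"
    have au: "arr u" "tgt u = src k" using isz_arr[OF u] by auto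
    let ?z = "zer (src u) (src k)"
    have z: "isz ?z" using ar au by simp
    have kz: "k \<star> ?z = k \<star> u"
      by (rule isz_eq) (use ar au u in \<open>auto intro: isz_comp_right z\<close>)
    have "isz (f \<star> (k \<star> u))" by (rule isz_comp_right) (use ar au u in auto)
    then have "\<exists>!v. k \<star> v = k \<star> u" using k unfolding ker_def by blast
    then have "?z = u" using kz by blast
    then show "isz u" using z by simp
  qed (use ar in auto)
qed

lemma ker_lift: "ker k f \<Longrightarrow> isz (f \<star> u) \<Longrightarrow> \<exists>v. k \<star> v = u"
  unfolding ker_def by blast

lemma kerI: "\<lbrakk>mono k; isz (f \<star> k); \<And>u. isz (f \<star> u) \<Longrightarrow> \<exists>v. k \<star> v = u\<rbrakk> \<Longrightarrow> ker k f"
  unfolding ker_def using monoD isz_arr arr_comp by metis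

lemma pb_lift: "\<lbrakk>pb p q f g; arr (f \<star> u); f \<star> u = g \<star> v\<rbrakk> \<Longrightarrow> \<exists>w. p \<star> w = u \<and> q \<star> w = v"
  unfolding pb_def by blast

lemma pb_sym: "pb p q f g \<Longrightarrow> pb q p g f"
  unfolding pb_def by (metis arr_comp)

end

text \<open>The biproduct object is not named: the equations force all sources and targets, because
  identities and zero morphisms are arrows. The object itself is \<open>src p1\<close>.\<close>

locale abelian_cat = preadditive +
  assumes biproduct_ex: "\<lbrakk>X \<in> Ob; Y \<in> Ob\<rbrakk> \<Longrightarrow> \<exists>i1 i2 p1 p2. p1 \<star> i1 = idn X \<and> p2 \<star> i2 = idn Y \<and>
       isz (p1 \<star> i2) \<and> isz (p2 \<star> i1) \<and> i1 \<star> p1 \<boxplus> i2 \<star> p2 = idn (src p1)"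
    and ker_ex: "arr f \<Longrightarrow> \<exists>k. ker k f"
    and cok_ex: "arr f \<Longrightarrow> \<exists>q. cok q f"
    and mono_ker: "mono f \<Longrightarrow> \<exists>g. ker f g"
    and epi_cok: "epi f \<Longrightarrow> \<exists>g. cok f g"
begin

lemma dual: "abelian_cat Ob arr tgt src (\<lambda>g f. f \<star> g) add neg (\<lambda>X Y. zer Y X) idn"
proof -
  interpret op: preadditive Ob arr tgt src "\<lambda>g f. f \<star> g" add neg "\<lambda>X Y. zer Y X" idn
    by (rule dual_preadditive)
  have z: "op.isz = isz" by (rule ext) (auto simp: op.isz_def isz_def)
  have *: "op.mono = epi" "op.epi = mono" "op.ker = cok" "op.cok = ker"
    by (intro ext; simp add: z op.mono_def op.epi_def op.ker_def op.cok_def mono_def epi_def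
        ker_def cok_def)+
  show ?thesis
  proof (unfold_locales, unfold * z)
    fix X Y assume XY: "X \<in> Ob" "Y \<in> Ob"
    from biproduct_ex[OF XY] obtain i1 i2 p1 p2 where b: "p1 \<star> i1 = idn X" "p2 \<star> i2 = idn Y"
       "isz (p1 \<star> i2)" "isz (p2 \<star> i1)" "i1 \<star> p1 \<boxplus> i2 \<star> p2 = idn (src p1)" by blast
    \<comment> \<open>Reversal turns \<open>src p1\<close> into \<open>tgt i1\<close> in the last
      equation, so both have to be recognised as the biproduct object.\<close>
    have "arr (p1 \<star> i1)" using b XY by simp
    then have "tgt i1 = src p1" by simp
    then show "\<exists>i1 i2 p1 p2. i1 \<star> p1 = idn X \<and> i2 \<star> p2 = idn Y \<and> isz (i2 \<star> p1) \<and> isz (i1 \<star> p2) \<and>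
        p1 \<star> i1 \<boxplus> p2 \<star> i2 = idn (tgt p1)" using b by metis
  qed (auto intro: ker_ex cok_ex mono_ker epi_cok)
qed

end

section \<open>Pullbacks, covers and the five lemma\<close>

context preadditive
begin

text \<open>This and the next equations translate the notions of the opposite category back. A
  theorem instantiated at \<open>dual\<close> and unfolded with \<open>dual_defs\<close> is its dual
  in the original vocabulary.\<close>

lemma dual_isz: "preadditive.isz arr tgt src (\<lambda>X Y. zer Y X) = isz"
  by (rule ext) (auto simp: preadditive.isz_def[OF dual_preadditive] isz_def)

lemma dual_mono: "preadditive.mono arr tgt src (\<lambda>g f. f \<star> g) (\<lambda>X Y. zer Y X) = epi"
  by (rule ext) (simp add: preadditive.mono_def[OF dual_preadditive] epi_def dual_isz)

lemma dual_epi: "preadditive.epi arr tgt src (\<lambda>g f. f \<star> g) (\<lambda>X Y. zer Y X) = mono"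
  by (rule ext) (simp add: preadditive.epi_def[OF dual_preadditive] mono_def dual_isz)

lemma dual_ker: "preadditive.ker arr tgt src (\<lambda>g f. f \<star> g) (\<lambda>X Y. zer Y X) = cok"
  by (intro ext) (simp add: preadditive.ker_def[OF dual_preadditive] cok_def dual_isz)

lemma dual_cok: "preadditive.cok arr tgt src (\<lambda>g f. f \<star> g) (\<lambda>X Y. zer Y X) = ker"
  by (intro ext) (simp add: preadditive.cok_def[OF dual_preadditive] ker_def dual_isz)

lemma dual_ses: "preadditive.ses arr tgt src (\<lambda>g f. f \<star> g) (\<lambda>X Y. zer Y X) = (\<lambda>f g. ses g f)"
  by (intro ext) (auto simp: preadditive.ses_def[OF dual_preadditive] ses_def dual_ker dual_cok)

lemma dual_pb: "preadditive.pb arr (\<lambda>g f. f \<star> g) = po"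
  by (intro ext) (simp add: preadditive.pb_def[OF dual_preadditive] po_def)

lemma dual_po: "preadditive.po arr (\<lambda>g f. f \<star> g) = pb"
  by (intro ext) (simp add: preadditive.po_def[OF dual_preadditive] pb_def)

lemmas dual_defs = dual_isz dual_mono dual_epi dual_ker dual_cok dual_ses dual_pb dual_po

interpretation op: preadditive Ob arr tgt src "\<lambda>g f. f \<star> g" add neg "\<lambda>X Y. zer Y X" idn
  rewrites "preadditive.isz arr tgt src (\<lambda>X Y. zer Y X) = isz"
    and "preadditive.mono arr tgt src (\<lambda>g f. f \<star> g) (\<lambda>X Y. zer Y X) = epi"
    and "preadditive.epi arr tgt src (\<lambda>g f. f \<star> g) (\<lambda>X Y. zer Y X) = mono"
    and "preadditive.ker arr tgt src (\<lambda>g f. f \<star> g) (\<lambda>X Y. zer Y X) = cok"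
    and "preadditive.pb arr (\<lambda>g f. f \<star> g) = po"
  by (rule dual_preadditive dual_defs)+

lemmas epiD = op.monoD
  and epi_comp = op.mono_comp
  and epi_comp_left = op.mono_comp_right
  and cok_isz = op.ker_isz
  and cok_epi = op.ker_mono
  and cok_lift = op.ker_lift
  and cokI = op.kerI
  and po_lift = op.pb_lift
  and po_sym = op.pb_sym

lemma ses_mono: "ses f g \<Longrightarrow> mono f" and ses_epi: "ses f g \<Longrightarrow> epi g"
  and ses_isz: "ses f g \<Longrightarrow> isz (g \<star> f)"
  and ses_lift: "\<lbrakk>ses f g; isz (g \<star> u)\<rbrakk> \<Longrightarrow> \<exists>v. f \<star> v = u"
  and ses_colift: "\<lbrakk>ses f g; isz (v \<star> f)\<rbrakk> \<Longrightarrow> \<exists>u. u \<star> g = v"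
  unfolding ses_def using ker_mono cok_epi ker_isz ker_lift cok_lift by blast+

lemma ses_arr: "ses f g \<Longrightarrow> arr f \<and> arr g \<and> tgt f = src g"
  using ses_isz[THEN isz_arr] by auto

text \<open>An arrow determines its source and target, so an equation of composites carries all
  typing information from one side to the other. Most typing facts in the diagram chases are
  obtained this way.\<close>

lemma comp_eq_arr:
  assumes "f \<star> u = g \<star> v" "arr (f \<star> u)"
  shows "arr f \<and> arr u \<and> tgt u = src f \<and> arr g \<and> arr v \<and> tgt v = src g \<and> src u = src v \<and> tgt f =
      tgt g"
proof -
  have "arr (g \<star> v)" using assms by metis
  moreover have "src (f \<star> u) = src u" "tgt (f \<star> u) = tgt f" using assms(2) by auto
  moreover have "src (g \<star> v) = src v" "tgt (g \<star> v) = tgt g" using calculation by auto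
  ultimately show ?thesis using assms(2) unfolding assms(1) using assms(1,2) arr_comp by metis
qed

lemma pb_eq: "\<lbrakk>pb p q f g; arr (p \<star> u); p \<star> u = p \<star> v; q \<star> u = q \<star> v\<rbrakk> \<Longrightarrow> u = v"
proof -
  assume a: "pb p q f g" "arr (p \<star> u)" "p \<star> u = p \<star> v" "q \<star> u = q \<star> v"
  have fp: "arr (f \<star> p)" "f \<star> p = g \<star> q" using a(1) unfolding pb_def by blast+
  have "arr (f \<star> (p \<star> u))" using fp(1) a(2) by auto
  moreover have "f \<star> (p \<star> u) = g \<star> (q \<star> u)" by (metis fp(2) comp_assoc)
  ultimately have "\<exists>!w. p \<star> w = p \<star> u \<and> q \<star> w = q \<star> u" using a(1) unfolding pb_def by blast
  then show "u = v" using a(3,4) by (metis (no_types))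
qed

lemma pb_arr: "pb p q f g \<Longrightarrow> arr p \<and> arr q \<and> arr f \<and> arr g \<and> src p = src q \<and> tgt p = src f
  \<and> tgt q = src g \<and> tgt f = tgt g"
proof -
  assume "pb p q f g"
  then have a: "arr (f \<star> p)" "f \<star> p = g \<star> q" unfolding pb_def by blast+
  have b: "arr (g \<star> q)" using a by metis
  have "src (f \<star> p) = src p" "tgt (f \<star> p) = tgt f" using a(1) by auto
  moreover have "src (g \<star> q) = src q" "tgt (g \<star> q) = tgt g" using b by auto
  moreover have "arr p" "arr f" "tgt p = src f" using a(1) by auto
  ultimately show ?thesis using a(2) b by simp
qed

lemma pb_comm: "pb p q f g \<Longrightarrow> f \<star> p = g \<star> q" unfolding pb_def by blast

lemma pb_isz: "\<lbrakk>pb p q f g; isz (p \<star> u); isz (q \<star> u)\<rbrakk> \<Longrightarrow> isz u"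
proof -
  assume a: "pb p q f g" "isz (p \<star> u)" "isz (q \<star> u)"
  have t: "arr u" "tgt u = src p" using isz_arr[OF a(2)] by auto
  have pa: "arr p" "arr q" "src p = src q" using pb_arr[OF a(1)] by auto
  let ?z = "zer (src u) (tgt u)"
  have z: "isz ?z" using t pa by simp
  have "u = ?z"
  proof (rule pb_eq[OF a(1) isz_arr[OF a(2)]])
    show "p \<star> u = p \<star> ?z"
      by (rule isz_eq[OF a(2) isz_comp_right[OF z]]) (use t pa in auto)
    show "q \<star> u = q \<star> ?z"
      by (rule isz_eq[OF a(3) isz_comp_right[OF z]]) (use t pa in auto)
  qed
  then show "isz u" using z by simp
qed

end

section \<open>Kernels, fibre products, covers and images in an abelian category\<close>

context abelian_cat
begin

text \<open>The mono \<open>m\<close> is the kernel of some \<open>g\<close>, and \<open>g\<close>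
  factors through the cokernel \<open>q\<close>. Hence whatever \<open>q\<close> kills is killed by
  \<open>g\<close> and lifts through \<open>m\<close>.\<close>

lemma mono_cok_ker:
  assumes "mono m" "cok q m" shows "ker m q"
proof -
  obtain g where g: "ker m g" using mono_ker[OF assms(1)] by blast
  obtain v where v: "v \<star> q = g" using cok_lift[OF assms(2) ker_isz[OF g]] by blast
  show ?thesis
  proof (rule kerI[OF assms(1) cok_isz[OF assms(2)]])
    fix u assume u: "isz (q \<star> u)"
    have "arr (g \<star> m)" using ker_isz[OF g] isz_arr by blast
    then have "arr v" "arr q" "src v = tgt q" using v by auto
    then have "isz (v \<star> (q \<star> u))" by (intro isz_comp_right[OF u]) (use isz_arr[OF u] in auto)
    then have "isz (g \<star> u)" using v by (metis comp_assoc)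
    then show "\<exists>v. m \<star> v = u" by (rule ker_lift[OF g])
  qed
qed

lemmas epi_ker_cok = abelian_cat.mono_cok_ker[OF dual, unfolded dual_defs]

lemma mono_ses: "mono m \<Longrightarrow> cok q m \<Longrightarrow> ses m q"
  by (simp add: ses_def mono_cok_ker)

lemmas epi_ses = abelian_cat.mono_ses[OF dual, unfolded dual_defs]

lemma mono_ses_ex: "mono m \<Longrightarrow> \<exists>q. ses m q"
  using mono_ses cok_ex mono_arr by blast

lemmas epi_ses_ex = abelian_cat.mono_ses_ex[OF dual, unfolded dual_defs]

text \<open>The mono \<open>f\<close> is the kernel of some \<open>g\<close>; since \<open>f\<close>
  is epi, \<open>g\<close> vanishes, and the identity lifts through \<open>f\<close>. A right
  inverse of a mono is two-sided.\<close>

lemma mono_epi_iso: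
  assumes "mono f" "epi f" shows "\<exists>g. g \<star> f = idn (src f) \<and> f \<star> g = idn (tgt f)"
proof -
  have f: "arr f" using mono_arr[OF assms(1)] .
  obtain g where g: "ker f g" using mono_ker[OF assms(1)] by blast
  have "isz g" by (rule epi_isz[OF assms(2) ker_isz[OF g]])
  moreover have "arr g" "src g = tgt f" using isz_arr[OF ker_isz[OF g]] by auto
  ultimately have "isz (g \<star> idn (tgt f))" using f by (auto intro: isz_comp_left)
  then obtain v where v: "f \<star> v = idn (tgt f)" using ker_lift[OF g] by blast
  have "arr (f \<star> v)" using f v by simp
  then have av: "arr v" "tgt v = src f" by auto
  have "src (f \<star> v) = tgt f" using v f by simp
  then have sv: "src v = tgt f" using av f by simp
  have "v \<star> f = idn (src f)"
  proof (rule monoD[OF assms(1)])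
    show "f \<star> (v \<star> f) = f \<star> idn (src f)"
      using v f by (simp add: comp_assoc[symmetric] comp_idn idn_comp)
  qed (use av sv f in auto)
  then show ?thesis using v by blast
qed

lemma biproduct:
  assumes "X \<in> Ob" "Y \<in> Ob"
  obtains i1 i2 p1 p2 P where "arr i1" "arr i2" "arr p1" "arr p2" "src i1 = X" "src i2 = Y" "tgt
      i1 = P"
    "tgt i2 = P" "src p1 = P" "src p2 = P" "tgt p1 = X" "tgt p2 = Y" "P \<in> Ob"
    "p1 \<star> i1 = idn X" "p2 \<star> i2 = idn Y" "isz (p1 \<star> i2)" "isz (p2 \<star> i1)"
    "i1 \<star> p1 \<boxplus> i2 \<star> p2 = idn P"
proof -
  obtain i1 i2 p1 p2 where b: "p1 \<star> i1 = idn X" "p2 \<star> i2 = idn Y" "isz (p1 \<star> i2)" "isz (p2 \<star> i1)"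
    "i1 \<star> p1 \<boxplus> i2 \<star> p2 = idn (src p1)" using biproduct_ex[OF assms] by blast
  have 1: "arr (p1 \<star> i1)" "arr (p2 \<star> i2)" using b(1,2) assms by auto
  then have a: "arr p1" "arr p2" "arr i1" "arr i2" "tgt i1 = src p1" "tgt i2 = src p2" by auto
  have "src (p1 \<star> i1) = X" "tgt (p1 \<star> i1) = X" "src (p2 \<star> i2) = Y" "tgt (p2 \<star> i2) = Y"
    using b(1,2) assms by auto
  then have c: "src i1 = X" "tgt p1 = X" "src i2 = Y" "tgt p2 = Y" using a by auto
  have d: "tgt i2 = src p1" using isz_arr[OF b(3)] by auto
  show thesis by (rule that[of i1 i2 p1 p2 "src p1"]) (use a b c d in auto)
qed

text \<open>The stability of epis is proved for the explicit pullback built here, where the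
  biproduct is at hand; \<open>pb_epi\<close> then carries it to every pullback.\<close>

lemma pb_ex_epi:
  assumes "arr f" "arr g" "tgt f = tgt g"
  shows "\<exists>p q. pb p q f g \<and> (epi f \<longrightarrow> epi q)"
proof -
  obtain i1 i2 p1 p2 P where b: "arr i1" "arr i2" "arr p1" "arr p2" "src i1 = src f" "src i2 = src
      g"
    "tgt i1 = P" "tgt i2 = P" "src p1 = P" "src p2 = P" "tgt p1 = src f" "tgt p2 = src g" "P \<in> Ob"
    "p1 \<star> i1 = idn (src f)" "p2 \<star> i2 = idn (src g)" "isz (p1 \<star> i2)" "isz (p2 \<star> i1)"
    "i1 \<star> p1 \<boxplus> i2 \<star> p2 = idn P"
    by (rule biproduct[of "src f" "src g"]) (use assms in auto)
  \<comment> \<open>The pullback is the kernel of the difference of the two maps from the biproduct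
    to the common target.\<close>
  define d where "d = f \<star> p1 \<boxminus> g \<star> p2"
  have d: "arr d" "src d = P" "tgt d = tgt f" using b assms by (auto simp: d_def)
  obtain k where k: "ker k d" using ker_ex d by blast
  have ka: "arr k" "tgt k = P" using isz_arr[OF ker_isz[OF k]] d by auto
  have "isz (f \<star> (p1 \<star> k) \<boxminus> g \<star> (p2 \<star> k))"
    using ker_isz[OF k] by (simp add: d_def sub_comp comp_assoc)
  then have comm: "f \<star> (p1 \<star> k) = g \<star> (p2 \<star> k)" by (simp add: isz_sub_iff)
  have dec: "x = i1 \<star> (p1 \<star> x) \<boxplus> i2 \<star> (p2 \<star> x)" if "arr x" "tgt x = P" for x
    using that b by (simp add: comp_assoc[symmetric] add_comp[symmetric] idn_comp)
  have pi1: "p1 \<star> (i1 \<star> u) = u" "isz (p2 \<star> (i1 \<star> u))" if "arr u" "tgt u = src f" for u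
    using that b by (auto simp: comp_assoc[symmetric] idn_comp intro!: isz_comp_left)
  have pi2: "p2 \<star> (i2 \<star> u) = u" "isz (p1 \<star> (i2 \<star> u))" if "arr u" "tgt u = src g" for u
    using that b by (auto simp: comp_assoc[symmetric] idn_comp intro!: isz_comp_left)
  have "pb (p1 \<star> k) (p2 \<star> k) f g"
    unfolding pb_def
  proof (intro conjI allI impI)
    fix u v assume uv: "arr (f \<star> u) \<and> f \<star> u = g \<star> v"
    then have u: "arr u" "tgt u = src f" and v: "arr v" "tgt v = src g" and suv: "src u = src v"
      using comp_eq_arr by blast+
    let ?x = "i1 \<star> u \<boxplus> i2 \<star> v"
    have x1: "p1 \<star> ?x = u" unfolding comp_add pi1(1)[OF u]
      by (rule add_isz[OF pi2(2)[OF v]]) (use u v suv b in auto)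
    have x2: "p2 \<star> ?x = v" unfolding comp_add pi2(1)[OF v]
      by (rule isz_add[OF pi1(2)[OF u]]) (use u v suv b in auto)
    have "isz (d \<star> ?x)"
      unfolding d_def sub_comp comp_assoc x1 x2 isz_sub_iff using uv by blast
    then obtain w where w: "k \<star> w = ?x" using ker_lift[OF k] by blast
    show "\<exists>!w. (p1 \<star> k) \<star> w = u \<and> (p2 \<star> k) \<star> w = v"
    proof (rule ex1I[of _ w])
      show "(p1 \<star> k) \<star> w = u \<and> (p2 \<star> k) \<star> w = v" using w x1 x2 by (simp add: comp_assoc)
      fix w' assume w': "(p1 \<star> k) \<star> w' = u \<and> (p2 \<star> k) \<star> w' = v"
      then have "arr ((p1 \<star> k) \<star> w')" using u by blast
      then have aw: "arr w'" "tgt w' = src k" using ka b by auto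
      have "k \<star> w' = ?x" using dec[of "k \<star> w'"] w' aw ka by (simp add: comp_assoc)
      then have "k \<star> w' = k \<star> w" using w by simp
      then show "w' = w" by (rule monoD[OF ker_mono[OF k], rotated]) (use aw ka in auto)
    qed
  qed (use comm d ka b assms in auto)
  moreover have "epi (p2 \<star> k)" if f: "epi f"
  proof -
    \<comment> \<open>As \<open>d\<close> restricts to \<open>f\<close> along \<open>i1\<close>, it
      is epi and so the cokernel of \<open>k\<close>. A map \<open>u\<close> with
      \<open>u \<star> (p2 \<star> k)\<close> zero then gives
      \<open>u \<star> p2 = v \<star> d\<close>, and restricting to \<open>i1\<close> shows
      \<open>v \<star> f\<close> zero, hence \<open>v\<close> and \<open>u\<close> zero.\<close>
    have di1: "d \<star> i1 = f"
    proof -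
      have "isz ((g \<star> p2) \<star> i1)" unfolding comp_assoc by (rule isz_comp_right[OF b(17)]) (use
          assms b in auto)
      then have "d \<star> i1 = (f \<star> p1) \<star> i1" unfolding d_def sub_comp by (intro sub_isz) (use assms b
          in auto)
      then show ?thesis using b assms by (simp add: comp_assoc comp_idn)
    qed
    have "epi (d \<star> i1)" using f di1 by simp
    then have "epi d" by (rule epi_comp_left)
    then have c: "cok d k" using epi_ker_cok[OF _ k] by blast
    have "isz u" if u: "isz (u \<star> (p2 \<star> k))" for u
    proof -
      have au: "arr u" "src u = src g" using isz_arr[OF u] b by auto
      have "isz ((u \<star> p2) \<star> k)" using u by (simp add: comp_assoc)
      then obtain v where v: "v \<star> d = u \<star> p2" using cok_lift[OF c] by blast
      have "isz ((u \<star> p2) \<star> i1)" unfolding comp_assoc by (rule isz_comp_right[OF b(17)]) (use au b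
          in auto)
      then have "isz (v \<star> f)" unfolding v[symmetric] comp_assoc di1 .
      then have "isz v" by (rule epi_isz[OF f])
      moreover have "arr (v \<star> d)" using v au b by simp
      ultimately have "isz (u \<star> p2)" using isz_comp_left v by metis
      then have "isz ((u \<star> p2) \<star> i2)" by (rule isz_comp_left) (use au b in auto)
      then show ?thesis using au b by (simp add: comp_assoc comp_idn)
    qed
    then show ?thesis using ka b unfolding epi_def by auto
  qed
  ultimately show ?thesis by blast
qed

lemma pb_ex: "\<lbrakk>arr f; arr g; tgt f = tgt g\<rbrakk> \<Longrightarrow> \<exists>p q. pb p q f g"
  using pb_ex_epi by blast

text \<open>Comparison with the explicit pullback: its epi leg factors as
  \<open>q \<star> w\<close>, which forces \<open>q\<close> to be epi.\<close>

lemma pb_epi: "\<lbrakk>pb p q f g; epi f\<rbrakk> \<Longrightarrow> epi q"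
proof -
  assume a: "pb p q f g" "epi f"
  have "arr f" "arr g" "tgt f = tgt g" using pb_arr[OF a(1)] by auto
  then obtain p' q' where b: "pb p' q' f g" "epi q'" using pb_ex_epi a(2) by blast
  have "arr (f \<star> p')" "f \<star> p' = g \<star> q'" using b(1) unfolding pb_def by blast+
  then obtain w where "q \<star> w = q'" using pb_lift[OF a(1)] by blast
  then show "epi q" using b(2) epi_comp_left by metis
qed

lemmas po_arr = preadditive.pb_arr[OF dual_preadditive, unfolded dual_defs]
  and po_comm = preadditive.pb_comm[OF dual_preadditive, unfolded dual_defs]
  and po_isz = preadditive.pb_isz[OF dual_preadditive, unfolded dual_defs]
  and po_eq = preadditive.pb_eq[OF dual_preadditive, unfolded dual_defs]
  and po_ex = abelian_cat.pb_ex[OF dual, unfolded dual_defs]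
  and po_mono = abelian_cat.pb_epi[OF dual, unfolded dual_defs]

text \<open>An epimorphism \<open>c\<close> is used as a cover: elements of the target exist after restriction to \<open>c\<close>.\<close>

lemma epi_lift:
  assumes "epi f" "arr y" "tgt y = tgt f"
  shows "\<exists>c x. epi c \<and> arr (y \<star> c) \<and> f \<star> x = y \<star> c"
proof -
  obtain p q where p: "pb p q f y" using pb_ex assms epi_arr by metis
  then show ?thesis using pb_epi[OF p assms(1)] pb_comm[OF p] pb_arr[OF p] by (metis arr_comp)
qed

text \<open>Membership in a subobject can be tested after a cover: the cokernel of \<open>m\<close>
  kills \<open>x \<star> c\<close>, and \<open>c\<close> can be cancelled.\<close>

lemma mono_descent:
  assumes "mono m" "epi c" "arr (x \<star> c)" "m \<star> z = x \<star> c"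
  shows "\<exists>z'. m \<star> z' = x"
proof -
  obtain q where q: "ses m q" using mono_ses_ex assms by blast
  have a: "arr z" "arr m" "tgt z = src m" "arr q" "src q = tgt m"
    using assms(3,4) ses_arr[OF q] by (metis arr_comp)+
  have "arr ((q \<star> m) \<star> z)" using a by simp
  then have "isz (q \<star> (x \<star> c))" unfolding assms(4)[symmetric] comp_assoc[symmetric]
    by (intro isz_comp_left[OF ses_isz[OF q]])
  then have "isz (q \<star> x)" using epi_isz[OF assms(2)] by (simp add: comp_assoc)
  then show ?thesis by (rule ses_lift[OF q])
qed

text \<open>Exactness in the middle may be checked on generalised elements after a cover, because
  \<open>mono_descent\<close> removes the cover again.\<close>

lemma sesI:
  assumes "mono f" "epi g" "isz (g \<star> f)"
    and "\<And>x. isz (g \<star> x) \<Longrightarrow> \<exists>c z. epi c \<and> arr (x \<star> c) \<and> f \<star> z = x \<star> c"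
  shows "ses f g"
proof -
  have "ker f g"
  proof (rule kerI[OF assms(1,3)])
    fix u assume "isz (g \<star> u)"
    then show "\<exists>v. f \<star> v = u" using assms(4) mono_descent[OF assms(1)] by metis
  qed
  then show ?thesis using epi_ses[OF assms(2)] by blast
qed

text \<open>Local lifts glue. On the kernel of the cover \<open>c\<close>, both
  \<open>p \<star> x\<close> and \<open>q \<star> x\<close> vanish, so the joint condition makes
  \<open>x\<close> vanish there, and \<open>x\<close> factors through \<open>c\<close>.\<close>

lemma pbI:
  assumes "arr (f \<star> p)" "f \<star> p = g \<star> q"
    and joint: "\<And>u. isz (p \<star> u) \<Longrightarrow> isz (q \<star> u) \<Longrightarrow> isz u"
    and local: "\<And>u v. arr (f \<star> u) \<Longrightarrow> f \<star> u = g \<star> v \<Longrightarrow>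
      \<exists>c x. epi c \<and> arr (u \<star> c) \<and> p \<star> x = u \<star> c \<and> q \<star> x = v \<star> c"
  shows "pb p q f g"
  unfolding pb_def
proof (intro conjI allI impI assms(1,2))
  fix u v assume uv: "arr (f \<star> u) \<and> f \<star> u = g \<star> v"
  then obtain c x where c: "epi c" "arr (u \<star> c)" "p \<star> x = u \<star> c" "q \<star> x = v \<star> c"
    using local by blast
  obtain k where k: "ses k c" using epi_ses_ex c(1) by blast
  have gv: "arr (g \<star> v)" using uv by metis
  have suv: "src u = src v" using comp_eq_arr uv by blast
  have vc: "arr (v \<star> c)" using c(2) gv suv by simp
  have px: "arr p" "arr x" "arr q" "tgt x = src p" "tgt x = src q"
    using c(2,3,4) vc by (metis arr_comp)+
  have ck: "arr c" "arr k" "tgt k = src c" using ses_arr[OF k] by auto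
  have "isz (u \<star> (c \<star> k))" by (rule isz_comp_right[OF ses_isz[OF k]]) (use c(2) ck in auto)
  then have 1: "isz (p \<star> (x \<star> k))" using c(3) by (metis comp_assoc)
  have "isz (v \<star> (c \<star> k))" by (rule isz_comp_right[OF ses_isz[OF k]]) (use vc ck in auto)
  then have 2: "isz (q \<star> (x \<star> k))" using c(4) by (metis comp_assoc)
  obtain w where w: "w \<star> c = x" using ses_colift[OF k joint[OF 1 2]] by blast
  have wa: "arr w" "src w = tgt c" "tgt w = src p" using w px by auto
  have au: "arr u" "arr v" "src u = tgt c" "src v = tgt c" using c(2) vc by auto
  have e1: "p \<star> w = u" by (rule epiD[OF c(1)]) (use w c(3) wa px ck au in \<open>auto simp: comp_assoc\<close>)
  have e2: "q \<star> w = v" by (rule epiD[OF c(1)]) (use w c(4) wa px ck au in \<open>auto simp: comp_assoc\<close>)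
  show "\<exists>!w. p \<star> w = u \<and> q \<star> w = v"
  proof (rule ex1I[of _ w])
    fix w' assume w': "p \<star> w' = u \<and> q \<star> w' = v"
    have "arr (p \<star> w')" "arr (q \<star> w')" using w' uv gv by auto
    then have "isz (p \<star> (w' \<boxminus> w))" "isz (q \<star> (w' \<boxminus> w))"
      unfolding comp_sub isz_sub_iff using w' e1 e2 by auto
    then show "w' = w" using joint isz_sub_iff by blast
  qed (use e1 e2 in blast)
qed

text \<open>The map from the biproduct to the pushout is epi, since a morphism that kills both legs
  is zero. Locally, every element of the pushout is therefore a sum of elements of the two
  legs.\<close>

lemma po_cover:
  assumes "po p q f g" "arr y" "tgt y = tgt p"
  shows "\<exists>c u v. epi c \<and> arr (y \<star> c) \<and> y \<star> c = p \<star> u \<boxplus> q \<star> v"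
proof -
  have a: "arr p" "arr q" "tgt p = tgt q" using po_arr[OF assms(1)] by auto
  obtain i1 i2 p1 p2 P where b: "arr i1" "arr i2" "arr p1" "arr p2" "src i1 = src p" "src i2 = src
      q"
    "tgt i1 = P" "tgt i2 = P" "src p1 = P" "src p2 = P" "tgt p1 = src p" "tgt p2 = src q" "P \<in> Ob"
    "p1 \<star> i1 = idn (src p)" "p2 \<star> i2 = idn (src q)" "isz (p1 \<star> i2)" "isz (p2 \<star> i1)"
    "i1 \<star> p1 \<boxplus> i2 \<star> p2 = idn P"
    by (rule biproduct[of "src p" "src q"]) (use a in auto)
  let ?h = "p \<star> p1 \<boxplus> q \<star> p2"
  have h: "arr ?h" "tgt ?h = tgt p" using a b by auto
  have "isz ((q \<star> p2) \<star> i1)" unfolding comp_assoc by (rule isz_comp_right[OF b(17)]) (use a b in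
      auto)
  then have "?h \<star> i1 = (p \<star> p1) \<star> i1" unfolding add_comp by (rule add_isz) (use a b in auto)
  then have h1: "?h \<star> i1 = p" using a b by (simp add: comp_assoc comp_idn)
  have "isz ((p \<star> p1) \<star> i2)" unfolding comp_assoc by (rule isz_comp_right[OF b(16)]) (use a b in
      auto)
  then have "?h \<star> i2 = (q \<star> p2) \<star> i2" unfolding add_comp by (rule isz_add) (use a b in auto)
  then have h2: "?h \<star> i2 = q" using a b by (simp add: comp_assoc comp_idn)
  have "isz u" if u: "isz (u \<star> ?h)" for u
  proof (rule po_isz[OF assms(1)])
    have au: "arr u" "src u = tgt p" using isz_arr[OF u] h by auto
    have "isz ((u \<star> ?h) \<star> i1)" by (rule isz_comp_left[OF u]) (use au a b in auto)
    then show "isz (u \<star> p)" unfolding comp_assoc h1 .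
    have "isz ((u \<star> ?h) \<star> i2)" by (rule isz_comp_left[OF u]) (use au a b in auto)
    then show "isz (u \<star> q)" unfolding comp_assoc h2 .
  qed
  then have "epi ?h" using h(1) unfolding epi_def by blast
  then obtain c x where c: "epi c" "arr (y \<star> c)" "?h \<star> x = y \<star> c" using epi_lift assms h by metis
  have "y \<star> c = p \<star> (p1 \<star> x) \<boxplus> q \<star> (p2 \<star> x)" using c(3) by (simp add: add_comp comp_assoc)
  then show ?thesis using c by blast
qed

text \<open>Here \<open>m\<close> is the kernel of the cokernel \<open>q\<close> of
  \<open>f\<close>. If \<open>u \<star> e\<close> is zero, then \<open>f\<close> lies in the
  subobject \<open>m \<star> k\<close> with \<open>k\<close> the kernel of \<open>u\<close>. That
  subobject is the kernel of some \<open>g\<close>, which kills \<open>f\<close>, factors through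
  \<open>q\<close> and so kills \<open>m\<close>. Thus \<open>m\<close> lies in
  \<open>m \<star> k\<close>, so \<open>k\<close> has a right inverse and \<open>u\<close> is
  zero.\<close>

lemma factor_ex:
  assumes "arr f" shows "\<exists>m e. mono m \<and> epi e \<and> m \<star> e = f"
proof -
  obtain q where q: "cok q f" using cok_ex assms by blast
  have aq: "arr q" "src q = tgt f" using isz_arr[OF cok_isz[OF q]] by auto
  obtain m where m: "ker m q" using ker_ex aq by blast
  obtain e where e: "m \<star> e = f" using ker_lift[OF m cok_isz[OF q]] by blast
  have "arr (m \<star> e)" using e assms by simp
  then have a: "arr m" "arr e" "tgt e = src m" by auto
  have "isz u" if u: "isz (u \<star> e)" for u
  proof -
    have au: "arr u" "src u = tgt e" using isz_arr[OF u] by auto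
    obtain k where k: "ker k u" using ker_ex au by blast
    have ak: "arr k" "tgt k = src u" using isz_arr[OF ker_isz[OF k]] by auto
    obtain e' where e': "k \<star> e' = e" using ker_lift[OF k u] by blast
    have "mono (m \<star> k)" by (rule mono_comp[OF ker_mono[OF m] ker_mono[OF k]]) (use a ak au in auto)
    then obtain g where g: "ker (m \<star> k) g" using mono_ker by blast
    have ag: "arr g" "src g = tgt m" using isz_arr[OF ker_isz[OF g]] by auto
    have ae': "arr e'" "tgt e' = src k" using a(2) e' by auto
    have "isz ((g \<star> (m \<star> k)) \<star> e')" by (rule isz_comp_left[OF ker_isz[OF g]]) (use ag ak ae' a au
        in auto)
    then have "isz (g \<star> f)" using e e' by (simp add: comp_assoc)
    then obtain v where v: "v \<star> q = g" using cok_lift[OF q] by blast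
    have av: "arr v" "src v = tgt q" using v ag by auto
    have "isz (v \<star> (q \<star> m))" by (rule isz_comp_right[OF ker_isz[OF m]]) (use av isz_arr[OF
        ker_isz[OF m]] in auto)
    then have "isz (g \<star> m)" using v by (metis comp_assoc)
    then obtain w where w: "(m \<star> k) \<star> w = m" using ker_lift[OF g] by blast
    have "arr ((m \<star> k) \<star> w)" using w a by simp
    then have aw: "arr w" "tgt w = src k" using a ak au by auto
    have kw: "k \<star> w = idn (src m)"
      by (rule monoD[OF ker_mono[OF m]]) (use w a ak aw au in \<open>auto simp: comp_assoc comp_idn\<close>)
    have "isz ((u \<star> k) \<star> w)" by (rule isz_comp_left[OF ker_isz[OF k]]) (use au ak aw in auto)
    then show ?thesis unfolding comp_assoc kw using au a by (simp add: comp_idn)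
  qed
  then have "epi e" using a(2) unfolding epi_def by blast
  then show ?thesis using e ker_mono[OF m] by blast
qed

text \<open>The short five lemma with identities at both ends. An element killed by \<open>f\<close>
  is killed by \<open>p\<close>, so it comes from the left end, where \<open>i'\<close> is
  injective. Duality supplies the other half.\<close>

lemma five_lemma_mono:
  assumes "ses i p" "ses i' p'" "f \<star> i = i'" "p' \<star> f = p"
  shows "mono f"
proof -
  have a: "arr i" "arr p" "tgt i = src p" "arr i'" "arr p'" "tgt i' = src p'"
    using ses_arr assms(1,2) by auto
  have "arr (p' \<star> f)" "src (p' \<star> f) = src p" using a(2) assms(4) by simp_all
  then have af: "arr f" "src f = src p" "tgt f = src p'" by auto
  have "isz u" if u: "isz (f \<star> u)" for u
  proof -
    have au: "arr u" "tgt u = src f" using isz_arr[OF u] by auto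
    have "isz (p' \<star> (f \<star> u))" by (rule isz_comp_right[OF u]) (use au af a in auto)
    then have "isz (p \<star> u)" unfolding comp_assoc[symmetric] assms(4) .
    then obtain v where v: "i \<star> v = u" using ses_lift[OF assms(1)] by blast
    have av: "arr v" "tgt v = src i" using v au by auto
    have "isz (i' \<star> v)" using u unfolding v[symmetric] comp_assoc[symmetric] assms(3) .
    then have "isz v" by (rule mono_isz[OF ses_mono[OF assms(2)]])
    then have "isz (i \<star> v)" by (rule isz_comp_right) (use av a in auto)
    then show ?thesis unfolding v .
  qed
  then show ?thesis using af(1) unfolding mono_def by blast
qed

lemmas five_lemma_epi = abelian_cat.five_lemma_mono[OF dual, unfolded dual_defs]

end

section \<open>Completions of two-fold extensions\<close>

context preadditive
begin

text \<open>Composites are normalised to nest on the right; this form lets an equation for two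
  factors rewrite inside a longer composite.\<close>

lemma reassoc: "a \<star> b = c \<Longrightarrow> a \<star> (b \<star> x) = c \<star> x"
  by (metis comp_assoc)

lemma mono_idn: "X \<in> Ob \<Longrightarrow> mono (idn X)"
proof -
  assume X: "X \<in> Ob"
  have "isz u" if u: "isz (idn X \<star> u)" for u
    using X u isz_arr[OF u] by (simp add: idn_comp)
  then show ?thesis using X unfolding mono_def by simp
qed

lemmas epi_idn = preadditive.mono_idn[OF dual_preadditive, unfolded dual_defs]

lemma sub_sub_cancel: "arr (x \<boxminus> y) \<Longrightarrow> x \<boxminus> (x \<boxminus> y) = y"
proof -
  assume a: "arr (x \<boxminus> y)"
  then have "(x \<boxminus> (x \<boxminus> y)) \<boxplus> (x \<boxminus> y) = y \<boxplus> (x \<boxminus> y)"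
    using sub_add_cancel[of x y] sub_add_cancel[of x "x \<boxminus> y"] by (simp add: add_commute)
  then have "(x \<boxminus> y) \<boxplus> (x \<boxminus> (x \<boxminus> y)) = (x \<boxminus> y) \<boxplus> y" by (simp add: add_commute)
  then show ?thesis by (rule add_cancel[OF a]) (use a in auto)
qed

end

context abelian_cat
begin

text \<open>Each of the two exact sequences of a completion follows from the other: elements killed
  by \<open>t\<close> are killed by \<open>p \<star> t\<close>, hence come from S, where
  \<open>\<sigma>\<close> has kernel \<open>j\<close>. The converse is the dual statement.\<close>

lemma compl_of_left:
  assumes "ker j \<sigma>" "cok p \<sigma>" "t \<star> s = \<sigma>" "ses s (p \<star> t)"
  shows "ses (s \<star> j) t"
proof -
  have "arr (t \<star> s)" "arr (p \<star> \<sigma>)" "arr (\<sigma> \<star> j)"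
    using assms(3) ker_isz[OF assms(1)] cok_isz[OF assms(2)] isz_arr[of "p \<star> \<sigma>"] isz_arr[of "\<sigma> \<star> j"]
    by auto
  moreover have "src (t \<star> s) = src s" "tgt (t \<star> s) = tgt t" using calculation(1) by auto
  ultimately have ty: "arr t" "arr s" "tgt s = src t" "arr p" "src p = tgt t" "arr \<sigma>" "arr j" "tgt
      j = src s"
    using assms(3) by auto
  have "epi t"
    unfolding epi_def
  proof (intro conjI allI impI ty)
    fix u assume u: "isz (u \<star> t)"
    have au: "arr u" "src u = tgt t" using isz_arr[OF u] by auto
    have "isz ((u \<star> t) \<star> s)" by (rule isz_comp_left[OF u]) (use au ty in auto)
    then have "isz (u \<star> \<sigma>)" using assms(3) by (simp add: comp_assoc)
    then obtain v where v: "v \<star> p = u" using cok_lift[OF assms(2)] by blast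
    have av: "arr v" "src v = tgt p" using v au by auto
    have "isz (v \<star> (p \<star> t))" using u v by (simp add: comp_assoc[symmetric])
    then have "isz v" by (rule epi_isz[OF ses_epi[OF assms(4)]])
    then have "isz (v \<star> p)" by (rule isz_comp_left) (use av ty in auto)
    then show "isz u" unfolding v .
  qed
  moreover have "ker (s \<star> j) t"
  proof (rule kerI)
    show "mono (s \<star> j)"
      by (rule mono_comp[OF ses_mono[OF assms(4)] ker_mono[OF assms(1)]]) (use ty in auto)
    show "isz (t \<star> (s \<star> j))" using ker_isz[OF assms(1)] assms(3) by (simp add:
        comp_assoc[symmetric])
    fix u assume u: "isz (t \<star> u)"
    have "isz (p \<star> (t \<star> u))" by (rule isz_comp_right[OF u]) (use ty isz_arr[OF u] in auto)
    then obtain w where w: "s \<star> w = u" using ses_lift[OF assms(4)] by (auto simp: comp_assoc)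
    have "isz (\<sigma> \<star> w)" using u w assms(3) by (metis comp_assoc)
    then obtain z where "j \<star> z = w" using ker_lift[OF assms(1)] by blast
    then show "\<exists>v. (s \<star> j) \<star> v = u" using w by (metis comp_assoc)
  qed
  ultimately show ?thesis by (rule epi_ses)
qed

text \<open>The new middle object is the pushout of the old one along \<open>h1\<close>; its
  quotient by the image of \<open>s'\<close> is still the right end, and \<open>h2\<close> provides
  \<open>t'\<close>. So completions move forward along morphisms that fix both ends, and dually
  (\<open>compl_pull\<close>) backward. This makes solvability constant on Yoneda classes.\<close>

lemma compl_push:
  assumes "ker j \<sigma>" "cok p \<sigma>" "ker j' \<sigma>'" "cok p' \<sigma>'"
    and "h1 \<star> j = j'" "h2 \<star> \<sigma> = \<sigma>' \<star> h1" "p' \<star> h2 = p" "t \<star> s = \<sigma>" "ses s (p \<star> t)"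
  shows "\<exists>s' t'. t' \<star> s' = \<sigma>' \<and> ses s' (p' \<star> t')"
proof -
  have 1: "arr (t \<star> s)" "arr (p \<star> \<sigma>)" "arr (\<sigma>' \<star> j')" "arr (p' \<star> \<sigma>')" "arr (p' \<star> h2)" "arr (h1 \<star> j)"
    using assms(5,7,8) isz_arr[OF ker_isz[OF assms(1)]] isz_arr[OF cok_isz[OF assms(2)]]
       isz_arr[OF ker_isz[OF assms(3)]] isz_arr[OF cok_isz[OF assms(4)]] by auto
  have 2: "arr \<sigma>" "src p = tgt \<sigma>" "arr h1" "arr p'" "arr h2" "arr p" "arr t" "arr s" "arr \<sigma>'"
     "tgt s = src t" "tgt h2 = src p'" "src p' = tgt \<sigma>'" using 1 by auto
  have "src (t \<star> s) = src s" "tgt (t \<star> s) = tgt t" "src (p' \<star> h2) = src h2" using 1 by auto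
  then have 3: "src \<sigma> = src s" "tgt \<sigma> = tgt t" "src h2 = tgt \<sigma>" using assms(7,8) 2 by auto
  have "arr (h2 \<star> \<sigma>)" using 2 3 by auto
  then have 4: "src \<sigma> = src h1" "tgt h1 = src \<sigma>'" using comp_eq_arr[OF assms(6)] by blast+
  obtain g s' where po: "po g s' s h1" using po_ex[of s h1] 2 3 4 by auto
  have ty: "arr g" "arr s'" "src g = tgt s" "src s' = tgt h1" "tgt s' = tgt g" using po_arr[OF po]
      by auto
  have "arr ((h2 \<star> t) \<star> s)" "(h2 \<star> t) \<star> s = \<sigma>' \<star> h1"
    using 2 3 by simp (use assms(6,8) in \<open>simp add: comp_assoc\<close>)
  then obtain t' where t': "t' \<star> g = h2 \<star> t" "t' \<star> s' = \<sigma>'" using po_lift[OF po] by blast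
  have "arr (t' \<star> s')" using t' 2 by simp
  then have at': "arr t'" "src t' = tgt g" using ty by auto
  have "tgt (t' \<star> s') = tgt t'" using at' ty by simp
  then have tt': "tgt t' = src p'" using t' 2 by simp
  have ptg: "(p' \<star> t') \<star> g = p \<star> t" using t'(1) assms(7) by (metis comp_assoc)
  have e: "epi (p' \<star> t')" by (rule epi_comp_left[of _ g]) (simp add: ptg ses_epi[OF assms(9)])
  have ms: "mono s'" by (rule po_mono[OF po ses_mono[OF assms(9)]])
  have z: "isz ((p' \<star> t') \<star> s')" using t' cok_isz[OF assms(4)] by (simp add: comp_assoc)
  \<comment> \<open>After composition with \<open>g\<close>, a map that kills \<open>s'\<close>
    kills \<open>s\<close> and factors through \<open>p \<star> t\<close>, which equals
    \<open>p' \<star> t' \<star> g\<close>. Joint epimorphy of the legs \<open>g\<close> and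
    \<open>s'\<close> transfers this factorisation to \<open>u\<close>.\<close>
  have "cok (p' \<star> t') s'"
  proof (rule cokI[OF e z])
    fix u assume u: "isz (u \<star> s')"
    have au: "arr u" "src u = tgt s'" using isz_arr[OF u] by auto
    have "isz (u \<star> s' \<star> h1)" by (rule isz_comp_left[OF u]) (use au ty 2 in auto)
    then have "isz ((u \<star> g) \<star> s)" using po_comm[OF po] by (simp add: comp_assoc)
    then obtain v where v: "v \<star> (p \<star> t) = u \<star> g" using ses_colift[OF assms(9)] by blast
    have "arr (v \<star> (p \<star> t))" using v au ty by simp
    then have av: "arr v" "src v = tgt p" "tgt v = tgt u" using comp_eq_arr[OF v] 2 3 by auto
    have pp: "tgt p = tgt p'"
      using comp_eq_arr[of p' h2 p "idn (src p)"] assms(7) 1(5) 2(6) by (simp add: comp_idn)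
    have "v \<star> (p' \<star> t') = u"
    proof (rule po_eq[OF po])
      show "(v \<star> (p' \<star> t')) \<star> g = u \<star> g" using v ptg by (simp add: comp_assoc)
      have "isz (v \<star> ((p' \<star> t') \<star> s'))"
        by (rule isz_comp_right[OF z]) (use av pp 2 at' ty tt' in auto)
      then show "(v \<star> (p' \<star> t')) \<star> s' = u \<star> s'"
        unfolding comp_assoc[of v] by (rule isz_eq[OF _ u]) (use v ptg av pp 2 at' ty tt' au in
            auto)
    qed (use v ptg av pp 2 at' ty tt' au in auto)
    then show "\<exists>v. v \<star> (p' \<star> t') = u" by blast
  qed
  then show ?thesis using t' mono_ses[OF ms] by blast
qed

text \<open>The starting point of the zigzag argument: the trivial two-fold extension, with
  identities at the ends and zero in the middle, is completed by the biproduct.\<close>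

lemma compl_split:
  assumes "X \<in> Ob" "Y \<in> Ob"
  shows "ker (idn Y) (zer Y X) \<and> cok (idn X) (zer Y X) \<and> (\<exists>s t. t \<star> s = zer Y X \<and> ses s (idn X \<star>
      t))"
proof (intro conjI)
  have k: "ker (idn Y) (zer Y X)" if "X \<in> Ob" "Y \<in> Ob" for X Y
  proof (rule kerI)
    show "mono (idn Y)" using that by (intro mono_idn)
    show "isz (zer Y X \<star> idn Y)" by (rule isz_comp_left) (use that in auto)
    fix u assume "isz (zer Y X \<star> u)"
    then show "\<exists>v. idn Y \<star> v = u" using that by (intro exI[of _ u]) (auto simp: idn_comp dest!:
        isz_arr)
  qed
  show "ker (idn Y) (zer Y X)" using k assms .
  show "cok (idn X) (zer Y X)"
  proof (rule cokI)
    show "epi (idn X)" using assms by (intro epi_idn)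
    show "isz (idn X \<star> zer Y X)" by (rule isz_comp_right) (use assms in auto)
    fix u assume "isz (u \<star> zer Y X)"
    then show "\<exists>v. v \<star> idn X = u" using assms by (intro exI[of _ u]) (auto simp: comp_idn dest!:
        isz_arr)
  qed
  obtain i1 i2 p1 p2 P where b: "arr i1" "arr i2" "arr p1" "arr p2" "src i1 = Y" "src i2 = X" "tgt
      i1 = P"
    "tgt i2 = P" "src p1 = P" "src p2 = P" "tgt p1 = Y" "tgt p2 = X" "P \<in> Ob"
    "p1 \<star> i1 = idn Y" "p2 \<star> i2 = idn X" "isz (p1 \<star> i2)" "isz (p2 \<star> i1)"
    "i1 \<star> p1 \<boxplus> i2 \<star> p2 = idn P" by (rule biproduct[OF assms(2,1)])
  have "mono i1" unfolding mono_def
  proof (intro conjI allI impI b)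
    fix u assume u: "isz (i1 \<star> u)"
    have "isz (p1 \<star> (i1 \<star> u))" by (rule isz_comp_right[OF u]) (use b isz_arr[OF u] in auto)
    then show "isz u" using b isz_arr[OF u] by (simp add: comp_assoc[symmetric] idn_comp)
  qed
  moreover have "epi p2" unfolding epi_def
  proof (intro conjI allI impI b)
    fix u assume u: "isz (u \<star> p2)"
    have "isz ((u \<star> p2) \<star> i2)" by (rule isz_comp_left[OF u]) (use b isz_arr[OF u] in auto)
    then show "isz u" using b isz_arr[OF u] by (simp add: comp_assoc comp_idn)
  qed
  moreover have "ker i1 p2"
  proof (rule kerI[OF \<open>mono i1\<close> b(17)])
    fix u assume u: "isz (p2 \<star> u)"
    have au: "arr u" "tgt u = P" using isz_arr[OF u] b by auto
    have "isz (i2 \<star> (p2 \<star> u))" by (rule isz_comp_right[OF u]) (use b au in auto)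
    then have "i1 \<star> (p1 \<star> u) \<boxplus> i2 \<star> (p2 \<star> u) = i1 \<star> (p1 \<star> u)"
      by (rule add_isz) (use b au in auto)
    moreover have "i1 \<star> (p1 \<star> u) \<boxplus> i2 \<star> (p2 \<star> u) = u"
      using b au by (simp add: comp_assoc[symmetric] add_comp[symmetric] idn_comp)
    ultimately show "\<exists>v. i1 \<star> v = u" by metis
  qed
  ultimately have "ses i1 p2" by (intro epi_ses)
  moreover have "p2 \<star> i1 = zer Y X" by (rule isz_eq[OF b(17)]) (use b assms in auto)
  moreover have "idn X \<star> p2 = p2" using b by (simp add: idn_comp)
  ultimately show "\<exists>s t. t \<star> s = zer Y X \<and> ses s (idn X \<star> t)" by metis
qed

lemmas compl_of_right = abelian_cat.compl_of_left[OF dual, unfolded dual_defs]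
lemmas compl_pull = abelian_cat.compl_push[OF dual, unfolded dual_defs]

end

section \<open>Completions of a fixed exact sequence Z -> S -> T -> X and their comparison with
  extensions of X by Z\<close>

locale two_extension = abelian_cat +
  fixes Z S T X j \<sigma> p
  assumes ker_j: "ker j \<sigma>" and cok_p: "cok p \<sigma>"
    and src_j [simp]: "src j = Z" and tgt_j [simp]: "tgt j = S"
    and src_p [simp]: "src p = T" and tgt_p [simp]: "tgt p = X"
begin

definition compl :: "'b \<Rightarrow> 'b \<Rightarrow> bool" where
  "compl s t \<longleftrightarrow> t \<star> s = \<sigma> \<and> ses s (p \<star> t) \<and> ses (s \<star> j) t"

definition ext :: "'b \<Rightarrow> 'b \<Rightarrow> bool" where
  "ext i q \<longleftrightarrow> ses i q \<and> src i = Z \<and> tgt q = X"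

text \<open>\<open>baer s0 t0 i q s t\<close>: the completion \<open>(s, t)\<close> is the translate of \<open>(s0, t0)\<close> by the
  extension \<open>(i, q)\<close>. The apex \<open>e, l0, l\<close> is at the same time the fibre product of the extension
  with the first completion over \<open>X\<close> and the fibre product of the two completions over \<open>T\<close>.\<close>

definition baer :: "'b \<Rightarrow> 'b \<Rightarrow> 'b \<Rightarrow> 'b \<Rightarrow> 'b \<Rightarrow> 'b \<Rightarrow> bool" where
  "baer s0 t0 i q s t \<longleftrightarrow> (\<exists>e l0 l i1 i2. e \<star> i1 = i \<and> isz (l0 \<star> i1) \<and> l \<star> i1 = s \<star> j \<and>
     isz (e \<star> i2) \<and> l0 \<star> i2 = s0 \<and> l \<star> i2 = s \<and> t \<star> l = t0 \<star> l0 \<and> q \<star> e = p \<star> (t \<star> l) \<and>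
     pb e l0 q (p \<star> t0) \<and> pb l0 l t0 t \<and> cok e i2 \<and> cok l (i2 \<star> j \<boxminus> i1))"

lemma arr_j [simp]: "arr j" and arr_p [simp]: "arr p" and arr_\<sigma> [simp]: "arr \<sigma>"
  and src_\<sigma> [simp]: "src \<sigma> = S" and tgt_\<sigma> [simp]: "tgt \<sigma> = T"
  using isz_arr[OF ker_isz[OF ker_j]] isz_arr[OF cok_isz[OF cok_p]] by auto

lemma Ob_simps [simp]: "Z \<in> Ob" "S \<in> Ob" "T \<in> Ob" "X \<in> Ob"
  using src_Ob[OF arr_j] tgt_Ob[OF arr_j] src_Ob[OF arr_p] tgt_Ob[OF arr_p] by auto

lemma p\<sigma>: "isz (p \<star> \<sigma>)"
  by (rule cok_isz[OF cok_p])

lemma complI: "\<lbrakk>t \<star> s = \<sigma>; ses s (p \<star> t)\<rbrakk> \<Longrightarrow> compl s t"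
  unfolding compl_def using compl_of_left[OF ker_j cok_p] by blast

lemma compl_arr:
  assumes "compl s t"
  shows "arr s" "arr t" "src s = S" "src t = tgt s" "tgt t = T"
proof -
  have e: "t \<star> s = \<sigma>" using assms by (simp add: compl_def)
  then have "arr (t \<star> s)" by simp
  then have a: "arr s" "arr t" "tgt s = src t" by auto
  have "src (t \<star> s) = S" "tgt (t \<star> s) = T" using e by auto
  then show "arr s" "arr t" "src s = S" "src t = tgt s" "tgt t = T" using a by auto
qed

lemma ext_arr:
  assumes "ext i q" shows "arr i" "arr q" "src i = Z" "src q = tgt i" "tgt q = X"
  using assms ses_arr[of i q] unfolding ext_def by auto

text \<open>A Baer sum: P is the fibre product of the extension E and the completion L0 over X, and
  the new completion L is the quotient of P by an antidiagonal copy of Z. In P, the map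
  \<open>i1\<close> is the copy of Z from E, and \<open>i2\<close> is the copy of S from L0.\<close>

lemma ext_translate:
  assumes c0: "compl s0 t0" and x: "ext i q"
  shows "\<exists>s t. compl s t \<and> baer s0 t0 i q s t"
proof -
  define L0 where "L0 = tgt s0"
  define E where "E = tgt i"
  have t0: "arr s0" "arr t0" "src s0 = S" "src t0 = L0" "tgt t0 = T" "tgt s0 = L0"
    using compl_arr[OF c0] by (auto simp: L0_def)
  have tx: "arr i" "arr q" "src i = Z" "src q = E" "tgt q = X" "tgt i = E"
    using ext_arr[OF x] by (auto simp: E_def)
  have Ob [simp]: "L0 \<in> Ob" "E \<in> Ob" using tgt_Ob[OF t0(1)] tgt_Ob[OF tx(1)] t0 tx by auto
  have ts0: "t0 \<star> s0 = \<sigma>" and ses0: "ses s0 (p \<star> t0)" "ses (s0 \<star> j) t0" using c0 by (auto simp: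
      compl_def)
  have sesx: "ses i q" using x by (simp add: ext_def)
  obtain e l0 where pbe: "pb e l0 q (p \<star> t0)" using pb_ex[of q "p \<star> t0"] t0 tx by auto
  define P where "P = src e"
  have te: "arr e" "arr l0" "src e = P" "src l0 = P" "tgt e = E" "tgt l0 = L0"
    using pb_arr[OF pbe] t0 tx by (auto simp: P_def)
  have pbc: "q \<star> e = p \<star> (t0 \<star> l0)" using pb_comm[OF pbe] by (simp add: comp_assoc)
  have eq1: "q \<star> i = (p \<star> t0) \<star> zer Z L0"
    by (rule isz_eq[OF ses_isz[OF sesx] isz_comp_right[of "zer Z L0"]]) (use t0 tx in auto)
  obtain i1 where i1: "e \<star> i1 = i" "l0 \<star> i1 = zer Z L0"
    using pb_lift[OF pbe _ eq1] tx by auto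
  have eq2: "q \<star> zer S E = (p \<star> t0) \<star> s0"
    by (rule isz_eq[OF isz_comp_right[of "zer S E"] ses_isz[OF ses0(1)]]) (use t0 tx in auto)
  obtain i2 where i2: "e \<star> i2 = zer S E" "l0 \<star> i2 = s0"
    using pb_lift[OF pbe _ eq2] tx by auto
  have ei2: "isz (e \<star> i2)" and l0i1: "isz (l0 \<star> i1)" using i1 i2 by auto
  have "arr (e \<star> i1)" "src (e \<star> i1) = Z" "arr (l0 \<star> i2)" "src (l0 \<star> i2) = S" using i1 i2 t0 tx by
      auto
  then have ti: "arr i1" "src i1 = Z" "tgt i1 = P" "arr i2" "src i2 = S" "tgt i2 = P" using te by
      auto
  \<comment> \<open>Dividing by this difference identifies the two copies of Z in P, so that
    \<open>l \<star> i1\<close> becomes \<open>s \<star> j\<close>.\<close>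
  define d where "d = i2 \<star> j \<boxminus> i1"
  have td: "arr d" "src d = Z" "tgt d = P" using ti by (auto simp: d_def)
  have l0d: "l0 \<star> d = s0 \<star> j"
    unfolding d_def comp_sub reassoc[OF i2(2)] by (rule sub_isz[OF l0i1]) (use te ti t0 in auto)
  have ei2u: "isz (e \<star> (i2 \<star> u))" if "arr u" "tgt u = S" for u
    unfolding comp_assoc[symmetric] by (rule isz_comp_left[OF ei2]) (use te ti that in auto)
  have l0i1u: "isz (l0 \<star> (i1 \<star> u))" if "arr u" "tgt u = Z" for u
    unfolding comp_assoc[symmetric] by (rule isz_comp_left[OF l0i1]) (use te ti that in auto)
  have ed: "e \<star> d = neg i"
    unfolding d_def comp_sub i1 by (rule isz_sub) (use ei2u[of j] te ti tx in auto)
  have md: "mono d" unfolding mono_def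
  proof (intro conjI allI impI td)
    fix u assume u: "isz (d \<star> u)"
    have "isz (e \<star> (d \<star> u))" by (rule isz_comp_right[OF u]) (use te td isz_arr[OF u] in auto)
    then have "isz (i \<star> u)" by (simp add: reassoc[OF ed] neg_comp)
    then show "isz u" by (rule mono_isz[OF ses_mono[OF sesx]])
  qed
  obtain l where l: "cok l d" using cok_ex td by blast
  have sesl: "ses d l" by (rule mono_ses[OF md l])
  define L where "L = tgt l"
  have tl: "arr l" "src l = P" "tgt l = L" using ses_arr[OF sesl] td by (auto simp: L_def)
  have Lob [simp]: "L \<in> Ob" using tgt_Ob[OF tl(1)] tl by auto
  define s where "s = l \<star> i2"
  have ts: "arr s" "src s = S" "tgt s = L" using tl ti by (auto simp: s_def)
  have li1: "l \<star> i1 = s \<star> j"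
    using ses_isz[OF sesl] unfolding d_def comp_sub isz_sub_iff by (simp add: s_def comp_assoc)
  have li2: "l \<star> i2 = s" by (simp add: s_def)
  have "isz (t0 \<star> l0 \<star> d)" using l0d ses_isz[OF ses0(2)] by (simp add: comp_assoc)
  then obtain t where t: "t \<star> l = t0 \<star> l0" using ses_colift[OF sesl] by blast
  have "arr (t \<star> l)" "tgt (t \<star> l) = T" using t t0 te by auto
  then have tt: "arr t" "src t = L" "tgt t = T" using tl by auto
  have ts\<sigma>: "t \<star> s = \<sigma>"
    using ts0 by (simp add: s_def comp_assoc[symmetric] t) (simp add: comp_assoc i2)
  have epil0: "epi l0" by (rule pb_epi[OF pbe ses_epi[OF sesx]])
  \<comment> \<open>The kernel of P -> X is spanned by the copies of S and Z: the component in L0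
    comes from S, and after subtracting it the rest lies over zero in L0, hence comes from
    \<open>i\<close>.\<close>
  have dec: "\<exists>w z. arr w \<and> tgt w = S \<and> src w = src x \<and> arr z \<and> tgt z = Z \<and> src z = src x \<and> x = i2
      \<star> w \<boxplus> i1 \<star> z"
    if x: "arr x" "tgt x = P" "isz ((p \<star> t0) \<star> (l0 \<star> x))" for x
  proof -
    obtain w where w: "s0 \<star> w = l0 \<star> x" using ses_lift[OF ses0(1) x(3)] by blast
    have aw: "arr w" "tgt w = S" "src w = src x"
      using comp_eq_arr[OF w[symmetric]] x te t0 by auto
    define x' where "x' = x \<boxminus> i2 \<star> w"
    have x': "arr x'" "src x' = src x" "tgt x' = P" using x aw ti by (auto simp: x'_def)
    have "l0 \<star> x' = l0 \<star> x \<boxminus> s0 \<star> w" by (simp add: x'_def comp_sub reassoc[OF i2(2)])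
    then have l0x: "isz (l0 \<star> x')" using w x te by (simp add: isz_sub_iff)
    have "isz (p \<star> (t0 \<star> (l0 \<star> x')))" unfolding comp_assoc[symmetric, of p]
      by (rule isz_comp_right[OF l0x]) (use t0 te x' in auto)
    then have "isz (q \<star> (e \<star> x'))" by (simp add: reassoc[OF pbc] comp_assoc)
    then obtain z where z: "i \<star> z = e \<star> x'" using ses_lift[OF sesx] by blast
    have az: "arr z" "tgt z = Z" "src z = src x"
      using comp_eq_arr[OF z[symmetric]] x' te tx by auto
    have "x' = i1 \<star> z"
    proof (rule pb_eq[OF pbe])
      show "e \<star> x' = e \<star> (i1 \<star> z)" using z by (simp add: reassoc[OF i1(1)])
      show "l0 \<star> x' = l0 \<star> (i1 \<star> z)"
        by (rule isz_eq[OF l0x l0i1u]) (use az te x' ti in auto)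
    qed (use te x' in auto)
    moreover have "x = x' \<boxplus> i2 \<star> w" unfolding x'_def by (rule sub_add_cancel[symmetric]) (use x aw
        ti in auto)
    ultimately show ?thesis using aw az add_commute by metis
  qed
  \<comment> \<open>If \<open>l\<close> kills \<open>i2 \<star> u\<close>, then
    \<open>i2 \<star> u = d \<star> z\<close>. Applying \<open>e\<close>, which kills
    \<open>i2\<close> and turns \<open>d\<close> into \<open>neg i\<close>, shows that
    \<open>z\<close> is zero.\<close>
  have "mono s" unfolding mono_def
  proof (intro conjI allI impI ts)
    fix u assume u: "isz (s \<star> u)"
    have au: "arr u" "tgt u = S" using isz_arr[OF u] ts by auto
    have "isz (l \<star> (i2 \<star> u))" using u by (simp add: reassoc[OF li2])
    then obtain z where z: "d \<star> z = i2 \<star> u" using ses_lift[OF sesl] by blast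
    have "isz (e \<star> (d \<star> z))" unfolding z by (rule ei2u[OF au])
    then have "isz (i \<star> z)" by (simp add: reassoc[OF ed] neg_comp)
    then have "isz z" by (rule mono_isz[OF ses_mono[OF sesx]])
    then have "isz (i2 \<star> u)" unfolding z[symmetric]
      by (rule isz_comp_right) (use z au ti in simp)
    then have "isz (l0 \<star> (i2 \<star> u))" by (rule isz_comp_right) (use au ti te in auto)
    then show "isz u" unfolding reassoc[OF i2(2)] by (rule mono_isz[OF ses_mono[OF ses0(1)]])
  qed
  have ptl: "(p \<star> t) \<star> l = (p \<star> t0) \<star> l0" using t by (simp add: comp_assoc)
  have "ses s (p \<star> t)"
  proof (rule sesI[OF \<open>mono s\<close>])
    have "epi ((p \<star> t) \<star> l)" unfolding ptl
      by (rule epi_comp[OF epil0 ses_epi[OF ses0(1)]]) (use te t0 in auto)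
    then show "epi (p \<star> t)" by (rule epi_comp_left)
    show "isz ((p \<star> t) \<star> s)" using ts\<sigma> p\<sigma> by (simp add: comp_assoc)
    fix y assume y: "isz ((p \<star> t) \<star> y)"
    have ay: "arr y" "tgt y = L" using isz_arr[OF y] tt by auto
    obtain c x where c: "epi c" "arr (y \<star> c)" "l \<star> x = y \<star> c"
      using epi_lift[OF cok_epi[OF l] ay(1)] ay tl by auto
    have tc: "arr c" "tgt c = src y" using c(2) by auto
    have ax: "arr x" "tgt x = P" using comp_eq_arr[OF c(3)] c(2,3) tl by (metis arr_comp)+
    have "isz ((p \<star> t) \<star> y \<star> c)" by (rule isz_comp_left[OF y]) (use tt ay tc in auto)
    then have "isz ((p \<star> t0) \<star> (l0 \<star> x))"
      using c(3) ptl by (metis comp_assoc)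
    then obtain w z where wz: "arr w" "tgt w = S" "src w = src x" "arr z" "tgt z = Z" "src z = src
        x"
      "x = i2 \<star> w \<boxplus> i1 \<star> z" using dec ax by blast
    have "s \<star> (w \<boxplus> j \<star> z) = y \<star> c"
      unfolding c(3)[symmetric] using wz(7) by (simp add: comp_add reassoc[OF li2] reassoc[OF li1]
          comp_assoc)
    then show "\<exists>c z. epi c \<and> arr (y \<star> c) \<and> s \<star> z = y \<star> c" using c by blast
  qed
  then have cst: "compl s t" by (rule complI[OF ts\<sigma>])
  \<comment> \<open>A lift \<open>x\<close> of \<open>v\<close> along the epi \<open>l\<close> can
    miss \<open>u\<close> by an element of the kernel of \<open>t0\<close>, which is a copy of Z.
    Subtracting \<open>d \<star> z\<close> corrects the first component and leaves
    \<open>l \<star> x\<close> unchanged.\<close>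
  have "pb l0 l t0 t"
  proof (rule pbI)
    show "arr (t0 \<star> l0)" "t0 \<star> l0 = t \<star> l" using t0 te t by auto
    fix u assume u: "isz (l0 \<star> u)" "isz (l \<star> u)"
    obtain z where z: "d \<star> z = u" using ses_lift[OF sesl u(2)] by blast
    have au: "arr u" "tgt u = P" using isz_arr[OF u(2)] tl by auto
    have "isz ((s0 \<star> j) \<star> z)" using u(1) unfolding z[symmetric] by (simp only: reassoc[OF l0d])
    then have "isz z" by (rule mono_isz[OF ses_mono[OF ses0(2)]])
    then show "isz u" unfolding z[symmetric] by (rule isz_comp_right) (use z au in simp)
  next
    fix u v assume uv: "arr (t0 \<star> u)" "t0 \<star> u = t \<star> v"
    have auv: "arr u" "arr v" "src u = src v" "tgt u = L0" "tgt v = L"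
      using comp_eq_arr[OF uv(2,1)] t0 tt by auto
    obtain c x where c: "epi c" "arr (v \<star> c)" "l \<star> x = v \<star> c"
      using epi_lift[OF cok_epi[OF l] auv(2)] auv tl by auto
    have ax: "arr x" "tgt x = P" "src x = src c" "arr c" "tgt c = src v"
      using comp_eq_arr[OF c(3)[symmetric] c(2)] tl by auto
    have "t0 \<star> (l0 \<star> x) = t0 \<star> (u \<star> c)"
      using t c(3) uv(2) by (metis comp_assoc)
    then have "isz (t0 \<star> (l0 \<star> x \<boxminus> u \<star> c))" using ax te t0 auv unfolding comp_sub isz_sub_iff by
        auto
    then obtain z where z: "(s0 \<star> j) \<star> z = l0 \<star> x \<boxminus> u \<star> c" using ses_lift[OF ses0(2)] by blast
    have "arr ((s0 \<star> j) \<star> z)" "src ((s0 \<star> j) \<star> z) = src c" using z ax te auv by auto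
    then have az: "arr z" "tgt z = Z" "src z = src c" using t0 by auto
    have "isz (l \<star> (d \<star> z))" unfolding comp_assoc[symmetric]
      by (rule isz_comp_left[OF ses_isz[OF sesl]]) (use td tl az in auto)
    then have "l \<star> (x \<boxminus> d \<star> z) = v \<star> c"
      unfolding comp_sub c(3)[symmetric] by (rule sub_isz) (use td tl ax az in auto)
    moreover have "l0 \<star> (x \<boxminus> d \<star> z) = u \<star> c"
      unfolding comp_sub reassoc[OF l0d] z by (rule sub_sub_cancel) (use ax te auv in auto)
    ultimately show "\<exists>c x. epi c \<and> arr (u \<star> c) \<and> l0 \<star> x = u \<star> c \<and> l \<star> x = v \<star> c"
      using c(1) auv ax by (metis arr_comp)
  qed
  moreover have "cok e i2"
  proof -
    have "epi e" by (rule pb_epi[OF pb_sym[OF pbe] ses_epi[OF ses0(1)]])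
    moreover have "ker i2 e"
    proof (rule kerI)
      show "mono i2" by (rule mono_comp_right[of l0]) (simp add: i2 ses_mono[OF ses0(1)])
      show "isz (e \<star> i2)" by fact
      fix u assume u: "isz (e \<star> u)"
      have au: "arr u" "tgt u = P" using isz_arr[OF u] te by auto
      have "isz (q \<star> (e \<star> u))" by (rule isz_comp_right[OF u]) (use au te tx in auto)
      then have "isz ((p \<star> t0) \<star> (l0 \<star> u))" by (simp add: reassoc[OF pbc] comp_assoc)
      then obtain w where w: "s0 \<star> w = l0 \<star> u" using ses_lift[OF ses0(1)] by blast
      have aw: "arr w" "tgt w = S" "src w = src u" using comp_eq_arr[OF w[symmetric]] au te t0 by
          auto
      have "i2 \<star> w = u"
      proof (rule pb_eq[OF pbe])
        show "e \<star> (i2 \<star> w) = e \<star> u" by (rule isz_eq[OF ei2u u]) (use au aw te ti in auto)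
        show "l0 \<star> (i2 \<star> w) = l0 \<star> u" using w by (simp add: reassoc[OF i2(2)])
      qed (use aw te ti in auto)
      then show "\<exists>v. i2 \<star> v = u" by blast
    qed
    ultimately show ?thesis using epi_ses unfolding ses_def by blast
  qed
  ultimately have "baer s0 t0 i q s t"
    unfolding baer_def using i1(1) l0i1 li1 ei2 i2(2) li2 t pbc pbe l by (metis d_def)
  then show ?thesis using cst by blast
qed

text \<open>The construction inverse to translation: P is now the fibre product of the two
  completions over T, and E is its quotient by the diagonal copy \<open>i2\<close> of S. The copy
  \<open>i1\<close> of Z sits in the kernel of \<open>l0\<close>.\<close>

lemma compl_difference:
  assumes c0: "compl s0 t0" and c: "compl s t"
  shows "\<exists>i q. ext i q \<and> baer s0 t0 i q s t"
proof -
  define L0 where "L0 = tgt s0"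
  define L where "L = tgt s"
  have t0: "arr s0" "arr t0" "src s0 = S" "src t0 = L0" "tgt t0 = T" "tgt s0 = L0"
    using compl_arr[OF c0] by (auto simp: L0_def)
  have ts: "arr s" "arr t" "src s = S" "src t = L" "tgt t = T" "tgt s = L"
    using compl_arr[OF c] by (auto simp: L_def)
  have Ob [simp]: "L0 \<in> Ob" "L \<in> Ob" using tgt_Ob[OF t0(1)] tgt_Ob[OF ts(1)] t0 ts by auto
  have ts0: "t0 \<star> s0 = \<sigma>" and ses0: "ses s0 (p \<star> t0)" "ses (s0 \<star> j) t0" using c0 by (auto simp:
      compl_def)
  have ts\<sigma>: "t \<star> s = \<sigma>" and ses1: "ses s (p \<star> t)" "ses (s \<star> j) t" using c by (auto simp: compl_def)
  obtain l0 l where pbl: "pb l0 l t0 t" using pb_ex[of t0 t] t0 ts by auto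
  define P where "P = src l"
  have tl: "arr l" "arr l0" "src l = P" "src l0 = P" "tgt l = L" "tgt l0 = L0"
    using pb_arr[OF pbl] t0 ts by (auto simp: P_def)
  have pbc: "t \<star> l = t0 \<star> l0" using pb_comm[OF pbl] by simp
  have eq1: "t0 \<star> zer Z L0 = t \<star> (s \<star> j)"
    by (rule isz_eq[OF isz_comp_right[of "zer Z L0"] ses_isz[OF ses1(2)]]) (use t0 ts in auto)
  obtain i1 where i1: "l0 \<star> i1 = zer Z L0" "l \<star> i1 = s \<star> j"
    using pb_lift[OF pbl _ eq1] t0 by auto
  obtain i2 where i2: "l0 \<star> i2 = s0" "l \<star> i2 = s"
    using pb_lift[OF pbl, of s0 s] t0 ts0 ts\<sigma> by (metis arr_comp)
  have l0i1: "isz (l0 \<star> i1)" using i1 by auto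
  have "arr (l \<star> i1)" "src (l \<star> i1) = Z" "arr (l0 \<star> i2)" "src (l0 \<star> i2) = S" using i1 i2 t0 ts by
      auto
  then have ti: "arr i1" "src i1 = Z" "tgt i1 = P" "arr i2" "src i2 = S" "tgt i2 = P" using tl by
      auto
  have mi2: "mono i2" by (rule mono_comp_right[of l0]) (simp add: i2 ses_mono[OF ses0(1)])
  obtain e where e: "ses i2 e" using mono_ses_ex[OF mi2] by blast
  define E where "E = tgt e"
  have te: "arr e" "src e = P" "tgt e = E" using ses_arr[OF e] ti by (auto simp: E_def)
  define i where "i = e \<star> i1"
  have tyi: "arr i" "src i = Z" "tgt i = E" using te ti by (auto simp: i_def)
  have ei2: "isz (e \<star> i2)" by (rule ses_isz[OF e])
  have ei2u: "isz (e \<star> (i2 \<star> u))" if "arr u" "tgt u = S" for u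
    unfolding comp_assoc[symmetric] by (rule isz_comp_left[OF ei2]) (use te ti that in auto)
  have l0i1u: "isz (l0 \<star> (i1 \<star> u))" if "arr u" "tgt u = Z" for u
    unfolding comp_assoc[symmetric] by (rule isz_comp_left[OF l0i1]) (use tl ti that in auto)
  have "isz ((p \<star> (t \<star> l)) \<star> i2)" using ses_isz[OF ses1(1)] by (simp add: comp_assoc i2)
  then obtain q where q: "q \<star> e = p \<star> (t \<star> l)" using ses_colift[OF e] by blast
  have "arr (q \<star> e)" "tgt (q \<star> e) = X" using q tl ts by auto
  then have tq: "arr q" "src q = E" "tgt q = X" using te by auto
  have qe: "q \<star> e = (p \<star> t) \<star> l" "q \<star> e = (p \<star> t0) \<star> l0" using q pbc by (simp_all add: comp_assoc)
  define d where "d = i2 \<star> j \<boxminus> i1"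
  have td: "arr d" "src d = Z" "tgt d = P" using ti by (auto simp: d_def)
  have l0d: "l0 \<star> d = s0 \<star> j"
    unfolding d_def comp_sub reassoc[OF i2(1)] by (rule sub_isz[OF l0i1]) (use tl ti t0 in auto)
  have ld: "isz (l \<star> d)"
    unfolding d_def comp_sub isz_sub_iff using ts ti tl i1(2) by (simp add: reassoc[OF i2(2)])
  have ldu: "isz (l \<star> (d \<star> u))" if "arr u" "tgt u = Z" for u
    unfolding comp_assoc[symmetric] by (rule isz_comp_left[OF ld]) (use tl td that in auto)
  have ed: "e \<star> d = neg i"
    unfolding d_def comp_sub i_def by (rule isz_sub) (use ei2u[of j] te ti in auto)
  have md: "mono d" by (rule mono_comp_right[of l0]) (simp add: l0d ses_mono[OF ses0(2)])
  \<comment> \<open>The kernel of \<open>l\<close> is Z, embedded by \<open>d\<close>: since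
    \<open>t0 \<star> (l0 \<star> x)\<close> equals \<open>t \<star> (l \<star> x)\<close>, it
    vanishes, so \<open>l0 \<star> x\<close> lies in the image of
    \<open>s0 \<star> j\<close>.\<close>
  have kerl: "\<exists>z. d \<star> z = x" if x: "isz (l \<star> x)" for x
  proof -
    have ax: "arr x" "tgt x = P" using isz_arr[OF x] tl by auto
    have "isz (t \<star> (l \<star> x))" by (rule isz_comp_right[OF x]) (use ax tl ts in auto)
    then have "isz (t0 \<star> (l0 \<star> x))" by (simp add: reassoc[OF pbc] comp_assoc)
    then obtain z where z: "(s0 \<star> j) \<star> z = l0 \<star> x" using ses_lift[OF ses0(2)] by blast
    have az: "arr z" "tgt z = Z" "src z = src x" using comp_eq_arr[OF z[symmetric]] ax tl t0 by auto
    have "d \<star> z = x"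
    proof (rule pb_eq[OF pbl])
      show "l0 \<star> (d \<star> z) = l0 \<star> x" using z by (simp only: reassoc[OF l0d])
      show "l \<star> (d \<star> z) = l \<star> x" by (rule isz_eq[OF ldu x]) (use ax az tl td in auto)
    qed (use az td tl in auto)
    then show ?thesis by blast
  qed
  have epil: "epi l" by (rule pb_epi[OF pbl ses_epi[OF ses0(2)]])
  have sesx: "ses i q"
  proof (rule sesI)
    show "mono i" unfolding mono_def
    proof (intro conjI allI impI tyi)
      fix z assume z: "isz (i \<star> z)"
      have az: "arr z" "tgt z = Z" using isz_arr[OF z] tyi by auto
      have "isz (e \<star> (i1 \<star> z))" using z by (simp add: i_def comp_assoc)
      then obtain w where w: "i2 \<star> w = i1 \<star> z" using ses_lift[OF e] by blast
      have "isz (s0 \<star> w)" using l0i1u[OF az] unfolding w[symmetric] reassoc[OF i2(1)] .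
      then have "isz w" by (rule mono_isz[OF ses_mono[OF ses0(1)]])
      then have "isz (i1 \<star> z)" unfolding w[symmetric] by (rule isz_comp_right) (use w az ti in simp)
      then have "isz (l \<star> (i1 \<star> z))" by (rule isz_comp_right) (use az ti tl in auto)
      then show "isz z" unfolding reassoc[OF i1(2)] by (rule mono_isz[OF ses_mono[OF ses1(2)]])
    qed
    have "epi (q \<star> e)" unfolding qe(1)
      by (rule epi_comp[OF epil ses_epi[OF ses1(1)]]) (use tl ts in auto)
    then show "epi q" by (rule epi_comp_left)
    have "isz ((p \<star> t) \<star> (s \<star> j))" unfolding comp_assoc[of p]
      by (rule isz_comp_right[OF ses_isz[OF ses1(2)]]) (use ts in auto)
    then show "isz (q \<star> i)" unfolding i_def reassoc[OF qe(1)] comp_assoc[of _ l] i1(2) .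
    fix y assume y: "isz (q \<star> y)"
    have ay: "arr y" "tgt y = E" using isz_arr[OF y] tq by auto
    obtain c x where c: "epi c" "arr (y \<star> c)" "e \<star> x = y \<star> c"
      using epi_lift[OF ses_epi[OF e] ay(1)] ay te by auto
    have ax: "arr x" "tgt x = P" "src x = src c" "arr c" "tgt c = src y"
      using comp_eq_arr[OF c(3)[symmetric] c(2)] te by auto
    have "isz (q \<star> y \<star> c)" by (rule isz_comp_left[OF y]) (use tq ay ax in auto)
    then have "isz ((p \<star> t) \<star> (l \<star> x))" using c(3) qe(1) by (metis comp_assoc)
    then obtain w where w: "s \<star> w = l \<star> x" using ses_lift[OF ses1(1)] by blast
    have aw: "arr w" "tgt w = S" "src w = src x" using comp_eq_arr[OF w[symmetric]] ax tl ts by auto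
    have "isz (l \<star> (x \<boxminus> i2 \<star> w))"
      unfolding comp_sub reassoc[OF i2(2)] isz_sub_iff using w ax tl by simp
    then obtain z where z: "d \<star> z = x \<boxminus> i2 \<star> w" using kerl by blast
    have "arr (d \<star> z)" using z ax aw ti by simp
    then have az: "arr z" "tgt z = Z" using td by auto
    have "e \<star> (d \<star> z) = e \<star> x"
      unfolding z comp_sub by (rule sub_isz[OF ei2u]) (use aw ax te ti in auto)
    \<comment> \<open>The preimage carries a sign because \<open>e\<close> sends \<open>d\<close> to
      \<open>neg i\<close>.\<close>
    then have "i \<star> neg z = y \<star> c" unfolding c(3)[symmetric] by (simp add: reassoc[OF ed] neg_comp
        comp_neg)
    then show "\<exists>c z. epi c \<and> arr (y \<star> c) \<and> i \<star> z = y \<star> c" using c by blast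
  qed
  then have xq: "ext i q" using tyi tq by (simp add: ext_def)
  have "pb e l0 q (p \<star> t0)"
  proof (rule pbI)
    show "arr (q \<star> e)" "q \<star> e = (p \<star> t0) \<star> l0" using te tq qe tl ts by auto
    fix u assume u: "isz (e \<star> u)" "isz (l0 \<star> u)"
    have au: "arr u" using isz_arr[OF u(1)] by auto
    obtain w where w: "i2 \<star> w = u" using ses_lift[OF e u(1)] by blast
    have "isz (s0 \<star> w)" using u(2) unfolding w[symmetric] reassoc[OF i2(1)] .
    then have "isz w" by (rule mono_isz[OF ses_mono[OF ses0(1)]])
    then show "isz u" unfolding w[symmetric] by (rule isz_comp_right) (use w au in simp)
  next
    fix u v assume uv: "arr (q \<star> u)" "q \<star> u = (p \<star> t0) \<star> v"
    have auv: "arr u" "arr v" "src u = src v" "tgt u = E" "tgt v = L0"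
      using comp_eq_arr[OF uv(2,1)] t0 tq by auto
    obtain c x where c: "epi c" "arr (u \<star> c)" "e \<star> x = u \<star> c"
      using epi_lift[OF ses_epi[OF e] auv(1)] auv te by auto
    have ax: "arr x" "tgt x = P" "src x = src c" "arr c" "tgt c = src u"
      using comp_eq_arr[OF c(3)[symmetric] c(2)] te by auto
    have "(p \<star> t0) \<star> (l0 \<star> x) = (p \<star> t0) \<star> (v \<star> c)"
      using qe(2) c(3) uv(2) by (metis comp_assoc)
    then have "isz ((p \<star> t0) \<star> (l0 \<star> x \<boxminus> v \<star> c))"
      using ax tl t0 auv unfolding comp_sub isz_sub_iff by auto
    then obtain w where w: "s0 \<star> w = l0 \<star> x \<boxminus> v \<star> c" using ses_lift[OF ses0(1)] by blast
    have "arr (s0 \<star> w)" "src (s0 \<star> w) = src c" using w ax tl auv by auto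
    then have aw: "arr w" "tgt w = S" "src w = src c" using t0 by auto
    have "e \<star> (x \<boxminus> i2 \<star> w) = u \<star> c"
      unfolding comp_sub c(3)[symmetric] by (rule sub_isz[OF ei2u]) (use te ti ax aw in auto)
    moreover have "l0 \<star> (x \<boxminus> i2 \<star> w) = v \<star> c"
      unfolding comp_sub reassoc[OF i2(1)] w by (rule sub_sub_cancel) (use ax tl auv in auto)
    ultimately show "\<exists>c x. epi c \<and> arr (u \<star> c) \<and> e \<star> x = u \<star> c \<and> l0 \<star> x = v \<star> c"
      using c by blast
  qed
  moreover have "cok l d" using epi_ses[OF epil kerI[OF md ld kerl]] by (simp add: ses_def)
  moreover have "cok e i2" using e by (simp add: ses_def)
  ultimately have "baer s0 t0 i q s t"
    unfolding baer_def using i_def l0i1 i1(2) ei2 i2 pbc q pbl by (metis d_def)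
  then show ?thesis using xq by blast
qed

text \<open>The morphism \<open>f\<close> and the identity of the base completion induce a map
  \<open>w\<close> of the apices, viewed as fibre products over X. It takes \<open>i1\<close> and
  \<open>i2\<close> to their counterparts, hence one antidiagonal to the other, and descends to the
  quotients.\<close>

lemma translate_unique:
  assumes "baer s0 t0 i q s t" "baer s0 t0 i' q' s' t'" "f \<star> i = i'" "q' \<star> f = q"
    "compl s t" "compl s' t'" "ext i q" "ext i' q'"
  shows "\<exists>g. g \<star> s = s' \<and> t' \<star> g = t"
proof -
  from assms(1) obtain e l0 l i1 i2 where b: "e \<star> i1 = i" "isz (l0 \<star> i1)" "l \<star> i1 = s \<star> j"
     "isz (e \<star> i2)" "l0 \<star> i2 = s0" "l \<star> i2 = s" "t \<star> l = t0 \<star> l0" "q \<star> e = p \<star> (t \<star> l)"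
     "pb e l0 q (p \<star> t0)" "pb l0 l t0 t" "cok e i2" "cok l (i2 \<star> j \<boxminus> i1)" unfolding baer_def by
         blast
  from assms(2) obtain e' l0' l' i1' i2' where b': "e' \<star> i1' = i'" "isz (l0' \<star> i1')" "l' \<star> i1' =
      s' \<star> j"
     "isz (e' \<star> i2')" "l0' \<star> i2' = s0" "l' \<star> i2' = s'" "t' \<star> l' = t0 \<star> l0'" "q' \<star> e' = p \<star> (t' \<star>
         l')"
     "pb e' l0' q' (p \<star> t0)" "pb l0' l' t0 t'" "cok e' i2'" "cok l' (i2' \<star> j \<boxminus> i1')" unfolding
         baer_def by blast
  have tx: "arr i" "arr q" "src i = Z" "src q = tgt i" "tgt q = X"
    "arr i'" "arr q'" "src i' = Z" "src q' = tgt i'" "tgt q' = X" using ext_arr assms(7,8) by auto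
  have tc: "arr s" "arr t" "src s = S" "src t = tgt s" "tgt t = T"
    "arr s'" "arr t'" "src s' = S" "src t' = tgt s'" "tgt t' = T" using compl_arr assms(5,6) by auto
  have "arr (f \<star> i)" "arr (q' \<star> f)" using assms(3,4) tx by auto
  then have tf: "arr f" "src f = tgt i" "tgt f = tgt i'" using tx by auto
  have pe: "arr e" "arr l0" "src e = src l0" "tgt e = tgt i" "arr t0" "tgt l0 = src t0" "tgt t0 = T"
  proof -
    have 1: "arr e" "arr l0" "src e = src l0" "tgt e = src q" "tgt l0 = src (p \<star> t0)" "arr (p \<star> t0)"
      using pb_arr[OF b(9)] by blast+
    then have "arr t0" "tgt t0 = T" by simp_all
    then show "arr e" "arr l0" "src e = src l0" "tgt e = tgt i" "arr t0" "tgt l0 = src t0" "tgt t0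
        = T"
      using 1 tx by simp_all
  qed
  have pe': "arr e'" "arr l0'" "src e' = src l0'" "tgt e' = tgt i'" "tgt l0' = src t0"
  proof -
    have 1: "arr e'" "arr l0'" "src e' = src l0'" "tgt e' = src q'" "tgt l0' = src (p \<star> t0)"
      using pb_arr[OF b'(9)] by blast+
    then show "arr e'" "arr l0'" "src e' = src l0'" "tgt e' = tgt i'" "tgt l0' = src t0"
      using pe tx by simp_all
  qed
  have pl: "arr l" "tgt l = tgt s" "src l = src l0" using pb_arr[OF b(10)] tc(4) by simp_all
  have pl': "arr l'" "tgt l' = tgt s'" "src l' = src l0'" using pb_arr[OF b'(10)] tc(9) by simp_all
  have "q' \<star> (f \<star> e) = (p \<star> t0) \<star> l0" using b(7,8) by (simp add: reassoc[OF assms(4)] comp_assoc)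
  moreover have "arr (q' \<star> (f \<star> e))" using tf pe tx by simp
  ultimately obtain w where w: "e' \<star> w = f \<star> e" "l0' \<star> w = l0" using pb_lift[OF b'(9)] by blast
  have "arr (l0' \<star> w)" "src (l0' \<star> w) = src l0" using w pe by auto
  then have tw: "arr w" "src w = src l0" "tgt w = src l0'" by auto
  have "arr (e \<star> i1)" "src (e \<star> i1) = Z" "arr (l \<star> i2)" "src (l \<star> i2) = S" using b tx tc by auto
  then have ti: "arr i1" "src i1 = Z" "tgt i1 = src l0" "arr i2" "src i2 = S" "tgt i2 = src l0"
      using pe pl by auto
  have "arr (e' \<star> i1')" "src (e' \<star> i1') = Z" "arr (l' \<star> i2')" "src (l' \<star> i2') = S" using b' tx tc
      by auto
  then have ti': "arr i1'" "src i1' = Z" "tgt i1' = src l0'" "arr i2'" "src i2' = S" "tgt i2' =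
      src l0'" using pe' pl' by auto
  have w1: "w \<star> i1 = i1'"
  proof (rule pb_eq[OF b'(9)])
    show "e' \<star> (w \<star> i1) = e' \<star> i1'" using b(1) b'(1) assms(3) by (simp add: reassoc[OF w(1)]
        comp_assoc)
    have "isz (l0' \<star> (w \<star> i1))" using b(2) by (simp add: reassoc[OF w(2)])
    then show "l0' \<star> (w \<star> i1) = l0' \<star> i1'" by (rule isz_eq[OF _ b'(2)]) (use tw ti ti' pe' in auto)
  qed (use tw ti pe' in auto)
  have w2: "w \<star> i2 = i2'"
  proof (rule pb_eq[OF b'(9)])
    have "isz (f \<star> (e \<star> i2))" by (rule isz_comp_right[OF b(4)]) (use tf pe ti in auto)
    then have "isz (e' \<star> (w \<star> i2))" by (simp add: reassoc[OF w(1)] comp_assoc)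
    then show "e' \<star> (w \<star> i2) = e' \<star> i2'" by (rule isz_eq[OF _ b'(4)]) (use tw ti ti' pe' in auto)
    show "l0' \<star> (w \<star> i2) = l0' \<star> i2'" using b(5) b'(5) by (simp add: reassoc[OF w(2)])
  qed (use tw ti pe' in auto)
  have "(l' \<star> w) \<star> (i2 \<star> j \<boxminus> i1) = l' \<star> (i2' \<star> j \<boxminus> i1')"
    by (simp add: comp_sub comp_assoc w1 reassoc[OF w2])
  then have "isz ((l' \<star> w) \<star> (i2 \<star> j \<boxminus> i1))" using cok_isz[OF b'(12)] by simp
  then obtain g where g: "g \<star> l = l' \<star> w" using cok_lift[OF b(12)] by blast
  have "arr (g \<star> l)" using g tw pl' by simp
  then have tg: "arr g" "src g = tgt s" using pl by auto
  have "tgt (g \<star> l) = tgt s'" using g tw pl' by simp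
  then have tg': "tgt g = tgt s'" using tg pl by simp
  have "g \<star> s = s'" using b(6) b'(6) w2 g by (metis comp_assoc)
  moreover have "t' \<star> g = t"
    by (rule epiD[OF cok_epi[OF b(12)]])
      (use tg tg' tc pl pe b'(7) b(7) w g in \<open>simp_all add: comp_assoc reassoc[OF b'(7)]\<close>)
  ultimately show ?thesis by blast
qed

text \<open>The same comparison with the apices viewed as fibre products over T: \<open>w\<close> is
  induced by \<open>g\<close>, takes \<open>i2\<close> to \<open>i2'\<close>, and descends to the
  quotients by S, which are the two extensions.\<close>

lemma difference_unique:
  assumes "baer s0 t0 i q s t" "baer s0 t0 i' q' s' t'" "g \<star> s = s'" "t' \<star> g = t"
    "compl s t" "compl s' t'" "ext i q" "ext i' q'"
  shows "\<exists>f. f \<star> i = i' \<and> q' \<star> f = q"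
proof -
  from assms(1) obtain e l0 l i1 i2 where b: "e \<star> i1 = i" "isz (l0 \<star> i1)" "l \<star> i1 = s \<star> j"
     "isz (e \<star> i2)" "l0 \<star> i2 = s0" "l \<star> i2 = s" "t \<star> l = t0 \<star> l0" "q \<star> e = p \<star> (t \<star> l)"
     "pb e l0 q (p \<star> t0)" "pb l0 l t0 t" "cok e i2" "cok l (i2 \<star> j \<boxminus> i1)" unfolding baer_def by
         blast
  from assms(2) obtain e' l0' l' i1' i2' where b': "e' \<star> i1' = i'" "isz (l0' \<star> i1')" "l' \<star> i1' =
      s' \<star> j"
     "isz (e' \<star> i2')" "l0' \<star> i2' = s0" "l' \<star> i2' = s'" "t' \<star> l' = t0 \<star> l0'" "q' \<star> e' = p \<star> (t' \<star>
         l')"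
     "pb e' l0' q' (p \<star> t0)" "pb l0' l' t0 t'" "cok e' i2'" "cok l' (i2' \<star> j \<boxminus> i1')" unfolding
         baer_def by blast
  have tx: "arr i" "arr q" "src i = Z" "src q = tgt i" "tgt q = X"
    "arr i'" "arr q'" "src i' = Z" "src q' = tgt i'" "tgt q' = X" using ext_arr assms(7,8) by auto
  have tc: "arr s" "arr t" "src s = S" "src t = tgt s" "tgt t = T"
    "arr s'" "arr t'" "src s' = S" "src t' = tgt s'" "tgt t' = T" using compl_arr assms(5,6) by auto
  have pe: "arr e" "arr l0" "src e = src l0" "tgt e = tgt i" "arr t0" "tgt l0 = src t0" "tgt t0 = T"
  proof -
    have 1: "arr e" "arr l0" "src e = src l0" "tgt e = src q" "tgt l0 = src (p \<star> t0)" "arr (p \<star> t0)"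
      using pb_arr[OF b(9)] by blast+
    then have "arr t0" "tgt t0 = T" by simp_all
    then show "arr e" "arr l0" "src e = src l0" "tgt e = tgt i" "arr t0" "tgt l0 = src t0" "tgt t0
        = T"
      using 1 tx by simp_all
  qed
  have pe': "arr e'" "arr l0'" "src e' = src l0'" "tgt e' = tgt i'" "tgt l0' = src t0"
  proof -
    have 1: "arr e'" "arr l0'" "src e' = src l0'" "tgt e' = src q'" "tgt l0' = src (p \<star> t0)"
      using pb_arr[OF b'(9)] by blast+
    then show "arr e'" "arr l0'" "src e' = src l0'" "tgt e' = tgt i'" "tgt l0' = src t0"
      using pe tx by simp_all
  qed
  have pl: "arr l" "tgt l = tgt s" "src l = src l0" using pb_arr[OF b(10)] tc(4) by simp_all
  have pl': "arr l'" "tgt l' = tgt s'" "src l' = src l0'" using pb_arr[OF b'(10)] tc(9) by simp_all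
  have "t0 \<star> l0 = t' \<star> (g \<star> l)" using b(7) by (simp add: reassoc[OF assms(4)])
  moreover have "arr (t0 \<star> l0)" using pe by simp
  ultimately obtain w where w: "l0' \<star> w = l0" "l' \<star> w = g \<star> l" using pb_lift[OF b'(10)] by blast
  have "arr (l0' \<star> w)" "src (l0' \<star> w) = src l0" using w pe by auto
  then have tw: "arr w" "src w = src l0" "tgt w = src l0'" by auto
  have "arr (e \<star> i1)" "src (e \<star> i1) = Z" "arr (l \<star> i2)" "src (l \<star> i2) = S" using b tx tc by auto
  then have ti: "arr i1" "src i1 = Z" "tgt i1 = src l0" "arr i2" "src i2 = S" "tgt i2 = src l0"
      using pe pl by auto
  have "arr (e' \<star> i1')" "src (e' \<star> i1') = Z" "arr (l' \<star> i2')" "src (l' \<star> i2') = S" using b' tx tc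
      by auto
  then have ti': "arr i1'" "src i1' = Z" "tgt i1' = src l0'" "arr i2'" "src i2' = S" "tgt i2' =
      src l0'" using pe' pl' by auto
  have w1: "w \<star> i1 = i1'"
  proof (rule pb_eq[OF b'(10)])
    have "isz (l0' \<star> (w \<star> i1))" using b(2) by (simp add: reassoc[OF w(1)])
    then show "l0' \<star> (w \<star> i1) = l0' \<star> i1'" by (rule isz_eq[OF _ b'(2)]) (use tw ti ti' pe' in auto)
    show "l' \<star> (w \<star> i1) = l' \<star> i1'"
      using b(3) b'(3) by (simp add: reassoc[OF w(2)] comp_assoc reassoc[OF assms(3)])
  qed (use tw ti pe' in auto)
  have w2: "w \<star> i2 = i2'"
  proof (rule pb_eq[OF b'(10)])
    show "l0' \<star> (w \<star> i2) = l0' \<star> i2'" using b(5) b'(5) by (simp add: reassoc[OF w(1)])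
    show "l' \<star> (w \<star> i2) = l' \<star> i2'"
      using b(6) b'(6) by (simp add: reassoc[OF w(2)] comp_assoc assms(3))
  qed (use tw ti pe' in auto)
  have "isz ((e' \<star> w) \<star> i2)" using b'(4) by (simp add: comp_assoc w2)
  then obtain f where f: "f \<star> e = e' \<star> w" using cok_lift[OF b(11)] by blast
  have "arr (f \<star> e)" using f tw pe' by simp
  then have tf: "arr f" "src f = tgt i" using pe by auto
  have "tgt (f \<star> e) = tgt i'" using f tw pe' by simp
  then have tf': "tgt f = tgt i'" using tf pe by simp
  have "f \<star> i = i'" using b(1) b'(1) w1 f by (metis comp_assoc)
  moreover have "q' \<star> f = q"
  proof (rule epiD[OF cok_epi[OF b(11)]])
    show "arr (q' \<star> f \<star> e)" using tf tf' tx pe by simp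
    have "q' \<star> f \<star> e = p \<star> (t0 \<star> (l0' \<star> w))"
      using b'(7,8) f by (simp add: comp_assoc reassoc[OF b'(8)] reassoc[OF b'(7)])
    then show "q' \<star> f \<star> e = q \<star> e" using b(7,8) w by simp
  qed
  ultimately show ?thesis by blast
qed

text \<open>The difference of two such morphisms kills S and lands in the kernel of
  \<open>t'\<close>, so it factors through the quotient X and the subobject Z. Allowing different
  ends, rather than automorphisms only, gives the size of every fibre in the later orbit
  count.\<close>

lemma automorphisms_of_completion:
  assumes c: "compl s t" and c': "compl s' t'" and g: "g \<star> s = s'" "t' \<star> g = t"
  shows "bij_betw (\<lambda>w. g \<boxplus> (s' \<star> j) \<star> w \<star> (p \<star> t)) {w. arr w \<and> src w = X \<and> tgt w = Z}
    {h. h \<star> s = s' \<and> t' \<star> h = t}"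
proof -
  have tc: "arr s" "arr t" "src s = S" "src t = tgt s" "tgt t = T"
    "arr s'" "arr t'" "src s' = S" "src t' = tgt s'" "tgt t' = T" using compl_arr c c' by auto
  have h_ty: "arr h \<and> src h = tgt s \<and> tgt h = tgt s'" if "h \<star> s = s'" "t' \<star> h = t" for h
  proof -
    have "arr (h \<star> s)" "arr (t' \<star> h)" using that tc by auto
    then show ?thesis using tc by auto
  qed
  have tg: "arr g" "src g = tgt s" "tgt g = tgt s'" using h_ty[OF g] by auto
  have ses1: "ses s (p \<star> t)" and ses2: "ses (s' \<star> j) t'" using c c' by (auto simp: compl_def)
  let ?F = "\<lambda>w. (s' \<star> j) \<star> w \<star> (p \<star> t)"
  show ?thesis
  proof (rule bij_betwI')
    fix w v assume wv: "w \<in> {w. arr w \<and> src w = X \<and> tgt w = Z}" "v \<in> {w. arr w \<and> src w = X \<and> tgt w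
        = Z}"
    have "?F w = ?F v" if "g \<boxplus> ?F w = g \<boxplus> ?F v"
      by (rule add_cancel[OF tg(1) that]) (use wv tc tg in auto)
    moreover have "w = v" if "?F w = ?F v"
    proof -
      have "(s' \<star> j) \<star> w = (s' \<star> j) \<star> v"
        by (rule epiD[OF ses_epi[OF ses1] _ that]) (use wv tc in auto)
      then show ?thesis by (rule monoD[OF ses_mono[OF ses2], rotated]) (use wv tc in auto)
    qed
    ultimately show "(g \<boxplus> ?F w = g \<boxplus> ?F v) = (w = v)" by blast
  next
    fix w assume w: "w \<in> {w. arr w \<and> src w = X \<and> tgt w = Z}"
    have "isz (?F w \<star> s)" unfolding comp_assoc[of _ "p \<star> t"]
      by (rule isz_comp_right[OF ses_isz[OF ses1]]) (use w tc in auto)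
    then have 1: "(g \<boxplus> ?F w) \<star> s = s'" unfolding add_comp g by (rule add_isz) (use w tc tg in auto)
    have "isz (t' \<star> (s' \<star> j) \<star> (w \<star> (p \<star> t)))" 
      by (rule isz_comp_left[OF ses_isz[OF ses2]]) (use w tc in auto)
    then have "isz (t' \<star> ?F w)" by (simp add: comp_assoc)
    then have "t' \<star> (g \<boxplus> ?F w) = t" unfolding comp_add g by (rule add_isz) (use w tc tg in auto)
    then show "g \<boxplus> ?F w \<in> {h. h \<star> s = s' \<and> t' \<star> h = t}" using 1 by blast
  next
    fix h assume "h \<in> {h. h \<star> s = s' \<and> t' \<star> h = t}"
    then have h: "h \<star> s = s'" "t' \<star> h = t" by auto
    have th: "arr h" "src h = tgt s" "tgt h = tgt s'" using h_ty[OF h] by auto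
    have "isz (t' \<star> (h \<boxminus> g))" unfolding comp_sub h g isz_sub_iff using tc by simp
    then obtain u where u: "(s' \<star> j) \<star> u = h \<boxminus> g" using ses_lift[OF ses2] by blast
    have "arr ((s' \<star> j) \<star> u)" "src ((s' \<star> j) \<star> u) = tgt s" using u th tg by auto
    then have tu: "arr u" "src u = tgt s" "tgt u = Z" using tc by auto
    have "isz ((h \<boxminus> g) \<star> s)" unfolding sub_comp h g isz_sub_iff using tc by simp
    then have "isz ((s' \<star> j) \<star> (u \<star> s))" unfolding u[symmetric] comp_assoc[of _ u] .
    then have "isz (u \<star> s)" by (rule mono_isz[OF ses_mono[OF ses2]])
    then obtain w where w: "w \<star> (p \<star> t) = u" using ses_colift[OF ses1] by blast
    have "arr (w \<star> (p \<star> t))" "tgt (w \<star> (p \<star> t)) = Z" using w tu by auto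
    then have tw: "arr w" "src w = X" "tgt w = Z" using tc by auto
    have "(h \<boxminus> g) \<boxplus> g = h" by (rule sub_add_cancel) (use th tg in auto)
    then have "h = g \<boxplus> ?F w" unfolding u[symmetric] comp_assoc[of _ w] w by (simp add: add_commute)
    then show "\<exists>w\<in>{w. arr w \<and> src w = X \<and> tgt w = Z}. h = g \<boxplus> ?F w" using tw by blast
  qed
qed

end

section \<open>Frames of 3-by-3 diagrams\<close>

text \<open>The 3-by-3 diagram has rows B' -> N -> B, N' -> L -> M', A' -> M -> A and columns B' ->
  N' -> A', N -> L -> M, B -> M' -> A. The frame consists of the outer rows and columns; the middle
  row \<open>a'\<close>, \<open>b'\<close> and the middle column \<open>a\<close>, \<open>b\<close>
  form the cross.\<close>

locale frame = abelian_cat +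
  fixes A A' B B' M N M' N' \<alpha> \<beta> \<gamma> \<delta> \<epsilon> \<zeta> \<eta> \<theta>
  assumes ses\<alpha>: "ses \<alpha> \<beta>" and ses\<gamma>: "ses \<gamma> \<delta>" and ses\<epsilon>: "ses \<epsilon> \<zeta>" and ses\<eta>: "ses \<eta> \<theta>"
    and ty [simp]: "src \<alpha> = A'" "tgt \<alpha> = M" "tgt \<beta> = A" "src \<gamma> = B'" "tgt \<gamma> = N" "tgt \<delta> = B"
      "src \<epsilon> = B" "tgt \<epsilon> = M'" "tgt \<zeta> = A" "src \<eta> = B'" "tgt \<eta> = N'" "tgt \<theta> = A'"
begin

lemma arrs [simp]: "arr \<alpha>" "arr \<beta>" "arr \<gamma>" "arr \<delta>" "arr \<epsilon>" "arr \<zeta>" "arr \<eta>" "arr \<theta>"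
  and srcs [simp]: "src \<beta> = M" "src \<delta> = N" "src \<zeta> = M'" "src \<theta> = N'"
  using ses_arr[OF ses\<alpha>] ses_arr[OF ses\<gamma>] ses_arr[OF ses\<epsilon>] ses_arr[OF ses\<eta>] by simp_all

lemma Obs [simp]: "A \<in> Ob" "A' \<in> Ob" "B \<in> Ob" "B' \<in> Ob" "M \<in> Ob" "N \<in> Ob" "M' \<in> Ob" "N' \<in> Ob"
  using tgt_Ob[OF arrs(2)] src_Ob[OF arrs(1)] src_Ob[OF arrs(5)] src_Ob[OF arrs(3)]
    src_Ob[OF arrs(2)] src_Ob[OF arrs(4)] src_Ob[OF arrs(6)] src_Ob[OF arrs(8)] by simp_all

definition cross :: "'b \<Rightarrow> 'b \<Rightarrow> 'b \<Rightarrow> 'b \<Rightarrow> bool" where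
  "cross a b a' b' \<longleftrightarrow> ses a b \<and> ses a' b' \<and> a \<star> \<gamma> = a' \<star> \<eta> \<and> \<beta> \<star> b = \<zeta> \<star> b' \<and>
     b \<star> a' = \<alpha> \<star> \<theta> \<and> b' \<star> a = \<epsilon> \<star> \<delta>"

text \<open>Transposition of the diagram. Each argument about N and M thereby also covers N' and
  M'.\<close>

lemma swap: "frame Ob arr src tgt (\<star>) (\<boxplus>) neg zer idn A B A' B' M' N' M N \<epsilon> \<zeta> \<eta> \<theta> \<alpha> \<beta> \<gamma> \<delta>"
  by unfold_locales (use ses\<alpha> ses\<gamma> ses\<epsilon> ses\<eta> in simp_all)

lemma cross_arr:
  assumes "cross a b a' b'"
  shows "arr a" "arr b" "arr a'" "arr b'" "src a = N" "src b = tgt a" "tgt b = M" "src a' = N'"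
      "tgt a' = tgt a"
    "src b' = tgt a" "tgt b' = M'"
proof -
  have s: "ses a b" "ses a' b'" and e: "\<alpha> \<star> \<theta> = b \<star> a'" "\<epsilon> \<star> \<delta> = b' \<star> a" using assms by (auto
      simp: cross_def)
  have 1: "src \<theta> = src a'" "tgt \<alpha> = tgt b" "src \<delta> = src a" "tgt \<epsilon> = tgt b'" "tgt a' = src b"
    using comp_eq_arr[OF e(1)] comp_eq_arr[OF e(2)] by simp_all
  have 2: "arr a" "arr b" "arr a'" "arr b'" "tgt a = src b" "tgt a' = src b'" using ses_arr[OF
      s(1)] ses_arr[OF s(2)] by auto
  show "arr a" "arr b" "arr a'" "arr b'" by fact+
  show "src a = N" "src b = tgt a" "tgt b = M" "src a' = N'" "tgt a' = tgt a" "src b' = tgt a"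
      "tgt b' = M'"
    using 1 2 by simp_all
qed

end

text \<open>The four components of \<open>\<sigma>\<close> are those of \<open>t \<star> s\<close>
  for any cross: zero in the places of \<open>b \<star> a\<close> and \<open>b' \<star> a'\<close>,
  and the composites through the corners A' and B in the other two.\<close>

locale frame_middle = frame +
  fixes S T n n' m m' \<sigma>
  assumes po: "po n n' \<gamma> \<eta>" and pb: "pb m m' \<beta> \<zeta>"
    and ty2 [simp]: "tgt n = S" "src m = T" "arr \<sigma>" "src \<sigma> = S" "tgt \<sigma> = T"
    and z1: "isz (m \<star> (\<sigma> \<star> n))" and z2: "isz (m' \<star> (\<sigma> \<star> n'))"
    and e1: "m \<star> (\<sigma> \<star> n') = \<alpha> \<star> \<theta>" and e2: "m' \<star> (\<sigma> \<star> n) = \<epsilon> \<star> \<delta>"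
begin

lemma arr2 [simp]: "arr n" "arr n'" "arr m" "arr m'" "src n = N" "src n' = N'" "tgt n' = S"
   "tgt m = M" "tgt m' = M'" "src m' = T"
  using po_arr[OF po] pb_arr[OF pb] by simp_all

lemma swap2: "frame_middle Ob arr src tgt (\<star>) (\<boxplus>) neg zer idn A B A' B' M' N' M N \<epsilon> \<zeta> \<eta> \<theta> \<alpha> \<beta> \<gamma> \<delta>
   S T n' n m' m \<sigma>"
proof -
  interpret sw: frame Ob arr src tgt "(\<star>)" "(\<boxplus>)" neg zer idn A B A' B' M' N' M N \<epsilon> \<zeta> \<eta> \<theta> \<alpha> \<beta> \<gamma> \<delta>
      by (rule swap)
  show ?thesis
    by unfold_locales (use po_sym[OF po] pb_sym[OF pb] z1 z2 e1 e2 in simp_all)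
qed

lemma mono_n: "mono n" and mono_n': "mono n'" and epi_m: "epi m" and epi_m': "epi m'"
  using po_mono[OF po_sym[OF po] ses_mono[OF ses\<eta>]] po_mono[OF po ses_mono[OF ses\<gamma>]]
    pb_epi[OF pb_sym[OF pb] ses_epi[OF ses\<epsilon>]] pb_epi[OF pb ses_epi[OF ses\<alpha>]] by auto

lemma S_cover:
  assumes "arr x" "tgt x = S"
  obtains c u v where "epi c" "arr (x \<star> c)" "x \<star> c = n \<star> u \<boxplus> n' \<star> v"
    "arr u" "arr v" "src u = src c" "src v = src c" "tgt u = N" "tgt v = N'" "arr c" "tgt c = src x"
proof -
  have "tgt x = tgt n" using assms(2) by simp
  then obtain c u v where c: "epi c" "arr (x \<star> c)" "x \<star> c = n \<star> u \<boxplus> n' \<star> v"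
    using po_cover[OF po assms(1)] by blast
  have 1: "arr (n \<star> u \<boxplus> n' \<star> v)" using c(2,3) by simp
  then have 2: "arr u" "arr v" "tgt u = N" "tgt v = N'" by simp_all
  have "src (n \<star> u \<boxplus> n' \<star> v) = src v" "src (n \<star> u \<boxplus> n' \<star> v) = src u" using 1 2 by auto
  moreover have "src (n \<star> u \<boxplus> n' \<star> v) = src c" using c(2) unfolding c(3)[symmetric] by simp
  ultimately have "src u = src c" "src v = src c" by (metis (no_types))+
  then show thesis using that[OF c] 2 c(2) by simp
qed

text \<open>Of a local decomposition of \<open>x\<close>, the map into M sees only the part from N',
  as \<open>\<alpha> \<star> (\<theta> \<star> v)\<close>. Since \<open>\<alpha>\<close> is
  injective, \<open>v\<close> lies in the kernel of \<open>\<theta>\<close>.\<close>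

lemma \<sigma>_left:
  assumes "x \<star> c = n \<star> u \<boxplus> n' \<star> v" "arr u" "arr v" "src u = src c" "src v = src c" "tgt u = N"
      "tgt v = N'"
    "isz (m \<star> (\<sigma> \<star> x))" "arr c" "tgt c = src x"
  shows "\<exists>z. arr z \<and> src z = src c \<and> tgt z = B' \<and> \<eta> \<star> z = v"
proof -
  have "arr (m \<star> (\<sigma> \<star> x))" using assms(8) by (rule isz_arr)
  then have ax: "arr x" "tgt x = S" by auto
  have "isz ((m \<star> (\<sigma> \<star> x)) \<star> c)" by (rule isz_comp_left[OF assms(8)]) (use assms ax in auto)
  then have i: "isz (m \<star> (\<sigma> \<star> n) \<star> u \<boxplus> m \<star> (\<sigma> \<star> n') \<star> v)"
    using assms(1) by (simp add: comp_assoc comp_add)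
  have "isz (m \<star> (\<sigma> \<star> n) \<star> u)" by (rule isz_comp_left[OF z1]) (use assms in auto)
  then have "isz (m \<star> (\<sigma> \<star> n') \<star> v)" using add_isz_iff[OF i] by simp
  then have "isz (\<alpha> \<star> (\<theta> \<star> v))" by (simp add: e1 comp_assoc)
  then have "isz (\<theta> \<star> v)" by (rule mono_isz[OF ses_mono[OF ses\<alpha>]])
  then obtain z where z: "\<eta> \<star> z = v" using ses_lift[OF ses\<eta>] by blast
  have "arr (\<eta> \<star> z)" "src (\<eta> \<star> z) = src c" using z assms(3,5) by simp_all
  then have "arr z \<and> src z = src c \<and> tgt z = B'" by simp
  then show ?thesis using z by blast
qed

text \<open>If \<open>\<sigma>\<close> kills \<open>x\<close>, then by \<open>\<sigma>_left\<close>
  and its transpose both local components of \<open>x\<close> come from B'. The pushout identifies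
  the two copies of B', so their sum is the image of one element.\<close>

lemma ker_n\<gamma>: "ker (n \<star> \<gamma>) \<sigma>"
proof (rule kerI)
  interpret sw: frame_middle Ob arr src tgt "(\<star>)" "(\<boxplus>)" neg zer idn A B A' B' M' N' M N \<epsilon> \<zeta> \<eta> \<theta> \<alpha>
      \<beta> \<gamma> \<delta>
    S T n' n m' m \<sigma> by (rule swap2)
  show mj: "mono (n \<star> \<gamma>)" by (rule mono_comp[OF mono_n ses_mono[OF ses\<gamma>]]) simp
  show "isz (\<sigma> \<star> (n \<star> \<gamma>))"
  proof (rule pb_isz[OF pb])
    have "isz (m \<star> (\<sigma> \<star> n) \<star> \<gamma>)" by (rule isz_comp_left[OF z1]) simp
    then show "isz (m \<star> (\<sigma> \<star> (n \<star> \<gamma>)))" by (simp add: comp_assoc)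
    have "isz (\<epsilon> \<star> (\<delta> \<star> \<gamma>))" by (rule isz_comp_right[OF ses_isz[OF ses\<gamma>]]) simp
    moreover have "m' \<star> (\<sigma> \<star> (n \<star> \<gamma>)) = \<epsilon> \<star> (\<delta> \<star> \<gamma>)" using e2 by (metis comp_assoc)
    ultimately show "isz (m' \<star> (\<sigma> \<star> (n \<star> \<gamma>)))" by simp
  qed
  fix x assume x: "isz (\<sigma> \<star> x)"
  have ax: "arr x" "tgt x = S" using isz_arr[OF x] by auto
  have mx: "isz (m \<star> (\<sigma> \<star> x))" "isz (m' \<star> (\<sigma> \<star> x))"
    by (rule isz_comp_right[OF x]; use ax in simp)+
  obtain c u v where c: "epi c" "arr (x \<star> c)" "x \<star> c = n \<star> u \<boxplus> n' \<star> v"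
    "arr u" "arr v" "src u = src c" "src v = src c" "tgt u = N" "tgt v = N'" "arr c" "tgt c = src x"
    by (rule S_cover[OF ax])
  obtain z1 where z1: "arr z1 \<and> src z1 = src c \<and> tgt z1 = B'" "\<eta> \<star> z1 = v"
    using \<sigma>_left[OF c(3-9) mx(1) c(10,11)] by blast
  obtain z2 where z2: "arr z2 \<and> src z2 = src c \<and> tgt z2 = B'" "\<gamma> \<star> z2 = u"
    using sw.\<sigma>_left[of x c v u, OF _ c(5,4,7,6,9,8) mx(2) c(10,11)] c(3) add_commute by metis
  have "(n \<star> \<gamma>) \<star> (z2 \<boxplus> z1) = (n \<star> \<gamma>) \<star> z2 \<boxplus> (n' \<star> \<eta>) \<star> z1"
    unfolding comp_add using po_comm[OF po] by simp
  then have "(n \<star> \<gamma>) \<star> (z2 \<boxplus> z1) = x \<star> c" unfolding c(3) comp_assoc z1(2) z2(2) .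
  then show "\<exists>v. (n \<star> \<gamma>) \<star> v = x" by (rule mono_descent[OF mj c(1,2)])
qed

lemma dual_frame_middle: "frame_middle Ob arr tgt src (\<lambda>g f. f \<star> g) (\<boxplus>) neg (\<lambda>X Y. zer Y X) idn
    B' A' B A N' M' N M \<theta> \<eta> \<zeta> \<epsilon> \<delta> \<gamma> \<beta> \<alpha> T S m' m n' n \<sigma>"
proof -
  interpret op: abelian_cat Ob arr tgt src "\<lambda>g f. f \<star> g" add neg "\<lambda>X Y. zer Y X" idn by (rule dual)
  show ?thesis
    by unfold_locales
      (use ses\<alpha> ses\<gamma> ses\<epsilon> ses\<eta> po_sym[OF po] pb_sym[OF pb] z1 z2 e1 e2 in \<open>simp_all add: dual_defs
          comp_assoc\<close>)
qed

lemma cok_\<beta>m: "cok (\<beta> \<star> m) \<sigma>"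
  using frame_middle.ker_n\<gamma>[OF dual_frame_middle] pb_comm[OF pb] by (simp add: dual_defs)

sublocale two_extension Ob arr src tgt "(\<star>)" "(\<boxplus>)" neg zer idn B' S T A "n \<star> \<gamma>" \<sigma> "\<beta> \<star> m"
  by unfold_locales (use ker_n\<gamma> cok_\<beta>m in simp_all)

text \<open>An element of L that dies in M dies in A and so comes from S. Its component from N' is,
  by \<open>\<sigma>_left\<close>, an element of B', which the pushout allows to be moved over to
  N.\<close>

lemma ses_of_compl:
  assumes "compl s t" shows "ses (s \<star> n) (m \<star> t)"
proof -
  have tc: "arr s" "arr t" "src s = S" "src t = tgt s" "tgt t = T" using compl_arr[OF assms] by auto
  have ts: "t \<star> s = \<sigma>" and s1: "ses s (\<beta> \<star> m \<star> t)" and s2: "ses (s \<star> (n \<star> \<gamma>)) t"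
    using assms by (auto simp: compl_def)
  show ?thesis
  proof (rule sesI)
    show "mono (s \<star> n)" by (rule mono_comp[OF ses_mono[OF s1] mono_n]) (use tc in simp)
    show "epi (m \<star> t)" by (rule epi_comp[OF ses_epi[OF s2] epi_m]) (use tc in simp)
    show "isz (m \<star> t \<star> (s \<star> n))" using z1 ts by (simp add: comp_assoc reassoc[OF ts])
    fix y assume y: "isz (m \<star> t \<star> y)"
    have ay: "arr y" "tgt y = src t" using isz_arr[OF y] tc by auto
    have "isz (\<beta> \<star> (m \<star> t \<star> y))" by (rule isz_comp_right[OF y]) (use ay tc in simp)
    then obtain x where x: "s \<star> x = y" using ses_lift[OF s1] by (metis comp_assoc)
    have "arr (s \<star> x)" "src (s \<star> x) = src y" using x ay by auto
    then have ax: "arr x" "tgt x = S" "src x = src y" using tc by auto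
    have mx: "isz (m \<star> (\<sigma> \<star> x))" using y x ts by (metis comp_assoc)
    obtain c u v where c: "epi c" "arr (x \<star> c)" "x \<star> c = n \<star> u \<boxplus> n' \<star> v"
      "arr u" "arr v" "src u = src c" "src v = src c" "tgt u = N" "tgt v = N'" "arr c" "tgt c =
          src x"
      by (rule S_cover[OF ax(1,2)])
    obtain z where z: "arr z \<and> src z = src c \<and> tgt z = B'" "\<eta> \<star> z = v"
      using \<sigma>_left[OF c(3-9) mx c(10,11)] by blast
    have "n \<star> (u \<boxplus> \<gamma> \<star> z) = n \<star> u \<boxplus> (n' \<star> \<eta>) \<star> z"
      unfolding comp_add po_comm[OF po, symmetric] comp_assoc ..
    then have nn: "n \<star> (u \<boxplus> \<gamma> \<star> z) = x \<star> c" unfolding c(3) comp_assoc z(2) .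
    have "s \<star> n \<star> (u \<boxplus> \<gamma> \<star> z) = y \<star> c" unfolding comp_assoc nn using x by (metis comp_assoc)
    then show "\<exists>c z. epi c \<and> arr (y \<star> c) \<and> s \<star> n \<star> z = y \<star> c" using c(1,10,11) ay ax by (metis
        arr_comp)
  qed
qed

lemma cross_of_compl:
  assumes "compl s t" shows "cross (s \<star> n) (m \<star> t) (s \<star> n') (m' \<star> t)"
proof -
  interpret sw: frame_middle Ob arr src tgt "(\<star>)" "(\<boxplus>)" neg zer idn A B A' B' M' N' M N \<epsilon> \<zeta> \<eta> \<theta> \<alpha>
      \<beta> \<gamma> \<delta>
    S T n' n m' m \<sigma> by (rule swap2)
  have "sw.compl s t" using assms unfolding compl_def sw.compl_def po_comm[OF po] pb_comm[OF pb] .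
  then have "ses (s \<star> n') (m' \<star> t)" by (rule sw.ses_of_compl)
  moreover have ts: "t \<star> s = \<sigma>" using assms by (simp add: compl_def)
  moreover have "s \<star> n \<star> \<gamma> = s \<star> n' \<star> \<eta>" "\<beta> \<star> (m \<star> t) = \<zeta> \<star> (m' \<star> t)"
    using po_comm[OF po] pb_comm[OF pb] by (metis comp_assoc)+
  ultimately show ?thesis
    using ses_of_compl[OF assms] e1 e2 unfolding cross_def by (simp add: comp_assoc reassoc[OF ts])
qed

text \<open>The universal properties give \<open>s\<close> and \<open>t\<close>, and
  \<open>t \<star> s = \<sigma>\<close> is tested on N and N' and then in M and M'. What remains is
  exactness of S -> L -> A.\<close>

lemma compl_of_cross:
  assumes "cross a b a' b'"
  shows "\<exists>s t. compl s t \<and> s \<star> n = a \<and> m \<star> t = b \<and> s \<star> n' = a' \<and> m' \<star> t = b'"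
proof -
  have ta: "arr a" "arr b" "arr a'" "arr b'" "src a = N" "src b = tgt a" "tgt b = M" "src a' = N'"
      "tgt a' = tgt a"
    "src b' = tgt a" "tgt b' = M'" using cross_arr[OF assms] by auto
  have x: "ses a b" "ses a' b'" "a \<star> \<gamma> = a' \<star> \<eta>" "\<beta> \<star> b = \<zeta> \<star> b'" "b \<star> a' = \<alpha> \<star> \<theta>" "b' \<star> a = \<epsilon> \<star> \<delta>"
    using assms by (auto simp: cross_def)
  obtain s where s: "s \<star> n = a" "s \<star> n' = a'" using po_lift[OF po _ x(3)] ta by auto
  obtain t where t: "m \<star> t = b" "m' \<star> t = b'" using pb_lift[OF pb _ x(4)] ta by auto
  have "arr (s \<star> n)" "tgt (s \<star> n) = tgt a" using s ta by auto
  then have ts: "arr s" "src s = S" "tgt s = tgt a" by auto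
  have "arr (m \<star> t)" "src (m \<star> t) = tgt a" using t ta by auto
  then have tt: "arr t" "src t = tgt a" "tgt t = T" by auto
  have ta\<sigma>: "t \<star> a = \<sigma> \<star> n"
  proof (rule pb_eq[OF pb])
    have "isz (m \<star> (t \<star> a))" using ses_isz[OF x(1)] by (simp add: reassoc[OF t(1)])
    then show "m \<star> (t \<star> a) = m \<star> (\<sigma> \<star> n)" by (rule isz_eq[OF _ z1]) (use ta tt in simp_all)
    show "m' \<star> (t \<star> a) = m' \<star> (\<sigma> \<star> n)" using x(6) e2 by (simp add: reassoc[OF t(2)])
  qed (use ta tt in simp)
  have ta\<sigma>': "t \<star> a' = \<sigma> \<star> n'"
  proof (rule pb_eq[OF pb])
    have "isz (m' \<star> (t \<star> a'))" using ses_isz[OF x(2)] by (simp add: reassoc[OF t(2)])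
    then show "m' \<star> (t \<star> a') = m' \<star> (\<sigma> \<star> n')" by (rule isz_eq[OF _ z2]) (use ta tt in simp_all)
    show "m \<star> (t \<star> a') = m \<star> (\<sigma> \<star> n')" using x(5) e1 by (simp add: reassoc[OF t(1)])
  qed (use ta tt in simp)
  have ts\<sigma>: "t \<star> s = \<sigma>"
    by (rule po_eq[OF po]) (use ta\<sigma> ta\<sigma>' s ts tt in \<open>simp_all add: comp_assoc\<close>)
  have pt: "\<beta> \<star> m \<star> t = \<beta> \<star> b" by (simp add: comp_assoc t)
  have "ses s (\<beta> \<star> m \<star> t)" unfolding pt
  proof (rule sesI)
    show "epi (\<beta> \<star> b)" by (rule epi_comp[OF ses_epi[OF x(1)] ses_epi[OF ses\<alpha>]]) (use ta in simp)
    show "isz (\<beta> \<star> b \<star> s)" unfolding pt[symmetric] comp_assoc[of _ t] ts\<sigma> by (rule p\<sigma>)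
    show "mono s" unfolding mono_def
    proof (intro conjI allI impI ts)
      fix y assume y: "isz (s \<star> y)"
      have ay: "arr y" "tgt y = S" using isz_arr[OF y] ts by auto
      obtain c u v where c: "epi c" "arr (y \<star> c)" "y \<star> c = n \<star> u \<boxplus> n' \<star> v"
        "arr u" "arr v" "src u = src c" "src v = src c" "tgt u = N" "tgt v = N'" "arr c" "tgt c =
            src y"
        by (rule S_cover[OF ay(1,2)])
      have "isz (t \<star> (s \<star> y))" by (rule isz_comp_right[OF y]) (use tt ay ts in auto)
      then have "isz (\<sigma> \<star> y)" using ts\<sigma> by (simp add: comp_assoc[symmetric])
      then obtain z where z: "(n \<star> \<gamma>) \<star> z = y" using ker_lift[OF ker_j] by blast
      have az: "arr ((n \<star> \<gamma>) \<star> z)" using z ay by simp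
      have "isz ((a \<star> \<gamma>) \<star> z)" using y s z by (metis comp_assoc)
      moreover have "mono (a \<star> \<gamma>)" by (rule mono_comp[OF ses_mono[OF x(1)] ses_mono[OF ses\<gamma>]])
          (use ta in simp)
      ultimately have "isz z" using mono_isz by blast
      then show "isz y" unfolding z[symmetric] by (rule isz_comp_right[OF _ az])
    qed
    fix y assume y: "isz (\<beta> \<star> b \<star> y)"
    have ay: "arr y" "tgt y = tgt a" using isz_arr[OF y] ta by auto
    \<comment> \<open>An element of L that dies in A has its image in M coming from A', hence
      locally from N'. Subtracting that element of N' leaves something \<open>b\<close> kills, which
      comes from N.\<close>
    obtain w where w: "\<alpha> \<star> w = b \<star> y" using ses_lift[OF ses\<alpha>] y by (metis comp_assoc)
    have aw: "arr w" "tgt w = A'" "src w = src y" using comp_eq_arr[OF w[symmetric]] ay ta by auto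
    obtain c v where c: "epi c" "arr (w \<star> c)" "\<theta> \<star> v = w \<star> c"
      using epi_lift[OF ses_epi[OF ses\<eta>] aw(1)] aw by auto
    have av: "arr v" "tgt v = N'" "src v = src c" "arr c" "tgt c = src w" using comp_eq_arr[OF
        c(3)[symmetric] c(2)] by auto
    have "b \<star> (y \<star> c) = b \<star> (a' \<star> v)" using w c(3) x(5) by (metis comp_assoc)
    then have "isz (b \<star> (y \<star> c \<boxminus> a' \<star> v))" unfolding comp_sub isz_sub_iff using ta ay aw av by auto
    then obtain u where u: "a \<star> u = y \<star> c \<boxminus> a' \<star> v" using ses_lift[OF x(1)] by blast
    have "s \<star> (n \<star> u \<boxplus> n' \<star> v) = (y \<star> c \<boxminus> a' \<star> v) \<boxplus> a' \<star> v"
      unfolding comp_add reassoc[OF s(1)] reassoc[OF s(2)] u ..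
    also have "\<dots> = y \<star> c" by (rule sub_add_cancel) (use ta ay aw av in auto)
    finally show "\<exists>c z. epi c \<and> arr (y \<star> c) \<and> s \<star> z = y \<star> c" using c(1) ay aw av by (metis arr_comp)
  qed
  then have "compl s t" by (rule complI[OF ts\<sigma>])
  then show ?thesis using s t by blast
qed

text \<open>Composition with \<open>n\<close> leaves the target of \<open>s\<close> unchanged, so
  any restriction \<open>Rs\<close> on the centre is preserved. The count later takes centres only
  among representatives.\<close>

lemma cross_bij:
  "bij_betw (\<lambda>(s, t). ((s \<star> n, m \<star> t), (s \<star> n', m' \<star> t))) {(s, t). compl s t \<and> tgt s \<in> Rs}
     {((a, b), (a', b')). cross a b a' b' \<and> tgt a \<in> Rs}"
  unfolding bij_betw_def
proof (intro conjI)
  show "inj_on (\<lambda>(s, t). ((s \<star> n, m \<star> t), (s \<star> n', m' \<star> t))) {(s, t). compl s t \<and> tgt s \<in> Rs}"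
  proof (rule inj_onI, clarsimp)
    fix s t s' t' assume h: "compl s t" "compl s' t'" "s \<star> n = s' \<star> n" "m \<star> t = m \<star> t'" "s \<star> n' =
        s' \<star> n'"
      "m' \<star> t = m' \<star> t'"
    have "s = s'" by (rule po_eq[OF po _ h(3,5)]) (use compl_arr[OF h(1)] in simp)
    moreover have "t = t'" by (rule pb_eq[OF pb _ h(4,6)]) (use compl_arr[OF h(1)] in simp)
    ultimately show "s = s' \<and> t = t'" by simp
  qed
  show "(\<lambda>(s, t). ((s \<star> n, m \<star> t), (s \<star> n', m' \<star> t))) ` {(s, t). compl s t \<and> tgt s \<in> Rs} =
     {((a, b), (a', b')). cross a b a' b' \<and> tgt a \<in> Rs}" (is "?f ` ?C = ?D")
  proof (intro equalityI subsetI)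
    fix x assume "x \<in> ?f ` ?C"
    then obtain s t where "x = ((s \<star> n, m \<star> t), (s \<star> n', m' \<star> t))" "compl s t" "tgt s \<in> Rs" by auto
    then show "x \<in> ?D" using cross_of_compl compl_arr by auto
  next
    fix x assume "x \<in> ?D"
    then obtain a b a' b' where x: "x = ((a, b), (a', b'))" "cross a b a' b'" "tgt a \<in> Rs" by auto
    then obtain s t where st: "compl s t" "s \<star> n = a" "m \<star> t = b" "s \<star> n' = a'" "m' \<star> t = b'"
      using compl_of_cross by blast
    have "tgt s = tgt (s \<star> n)" using compl_arr[OF st(1)] by simp
    then show "x \<in> ?f ` ?C" using st x by (intro image_eqI[of _ _ "(s, t)"]) auto
  qed
qed

end

context frame
begin

text \<open>The canonical map is assembled from its columns: \<open>u\<close> from N with components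
  zero and \<open>\<epsilon> \<star> \<delta>\<close>, and \<open>u'\<close> from N' with components
  \<open>\<alpha> \<star> \<theta>\<close> and zero, glued along B'.\<close>

lemma middle_ex:
  "\<exists>S T n n' m m' \<sigma>. frame_middle Ob arr src tgt (\<star>) (\<boxplus>) neg zer idn A A' B B' M N M' N' \<alpha> \<beta> \<gamma> \<delta> \<epsilon>
      \<zeta> \<eta> \<theta>
     S T n n' m m' \<sigma>"
proof -
  obtain n n' where po: "po n n' \<gamma> \<eta>" using po_ex[of \<gamma> \<eta>] by auto
  obtain m m' where pb: "pb m m' \<beta> \<zeta>" using pb_ex[of \<beta> \<zeta>] by auto
  define S where "S = tgt n"
  define T where "T = src m"
  have tn: "arr n" "arr n'" "src n = N" "src n' = N'" "tgt n = S" "tgt n' = S" using po_arr[OF po]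
      by (simp_all add: S_def)
  have tm: "arr m" "arr m'" "tgt m = M" "tgt m' = M'" "src m = T" "src m' = T" using pb_arr[OF pb]
      by (simp_all add: T_def)
  have "\<beta> \<star> zer N M = \<zeta> \<star> (\<epsilon> \<star> \<delta>)" 
  proof (rule isz_eq)
    show "isz (\<beta> \<star> zer N M)" by (rule isz_comp_right) simp_all
    show "isz (\<zeta> \<star> (\<epsilon> \<star> \<delta>))" unfolding comp_assoc[symmetric] by (rule isz_comp_left[OF ses_isz[OF
        ses\<epsilon>]]) simp
  qed simp_all
  from pb_lift[OF pb _ this] obtain u where u: "m \<star> u = zer N M" "m' \<star> u = \<epsilon> \<star> \<delta>" by auto
  have "\<beta> \<star> (\<alpha> \<star> \<theta>) = \<zeta> \<star> zer N' M'" 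
  proof (rule isz_eq)
    show "isz (\<zeta> \<star> zer N' M')" by (rule isz_comp_right) simp_all
    show "isz (\<beta> \<star> (\<alpha> \<star> \<theta>))" unfolding comp_assoc[symmetric] by (rule isz_comp_left[OF ses_isz[OF
        ses\<alpha>]]) simp
  qed simp_all
  from pb_lift[OF pb _ this] obtain u' where u': "m \<star> u' = \<alpha> \<star> \<theta>" "m' \<star> u' = zer N' M'" by auto
  have "arr (m \<star> u)" "arr (m \<star> u')" "src (m \<star> u) = N" "src (m \<star> u') = N'" using u u' by simp_all
  then have tu: "arr u" "arr u'" "tgt u = T" "tgt u' = T" "src u = N" "src u' = N'" using tm by
      simp_all
  \<comment> \<open>All four components vanish: two contain a zero component of \<open>u\<close> or
    \<open>u'\<close>, two contain consecutive maps of a short exact sequence.\<close>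
  have "u \<star> \<gamma> = u' \<star> \<eta>"
  proof (rule pb_eq[OF pb])
    have 1: "isz (m \<star> (u \<star> \<gamma>))" unfolding reassoc[OF u(1)] by (rule isz_comp_left) simp_all
    have "isz (\<alpha> \<star> (\<theta> \<star> \<eta>))" by (rule isz_comp_right[OF ses_isz[OF ses\<eta>]]) simp
    then have 2: "isz (m \<star> (u' \<star> \<eta>))" unfolding reassoc[OF u'(1)] comp_assoc .
    show "m \<star> (u \<star> \<gamma>) = m \<star> (u' \<star> \<eta>)" by (rule isz_eq[OF 1 2]) (use tu tm in simp_all)
    have 1: "isz (m' \<star> (u' \<star> \<eta>))" unfolding reassoc[OF u'(2)] by (rule isz_comp_left) simp_all
    have "isz (\<epsilon> \<star> (\<delta> \<star> \<gamma>))" by (rule isz_comp_right[OF ses_isz[OF ses\<gamma>]]) simp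
    then have 2: "isz (m' \<star> (u \<star> \<gamma>))" unfolding reassoc[OF u(2)] comp_assoc .
    show "m' \<star> (u \<star> \<gamma>) = m' \<star> (u' \<star> \<eta>)" by (rule isz_eq[OF 2 1]) (use tu tm in simp_all)
  qed (use tu tm in simp)
  then obtain \<sigma> where \<sigma>: "\<sigma> \<star> n = u" "\<sigma> \<star> n' = u'" using po_lift[OF po, of u u'] tu by auto
  have "arr (\<sigma> \<star> n)" "tgt (\<sigma> \<star> n) = T" using \<sigma> tu by simp_all
  then have "arr \<sigma>" "src \<sigma> = S" "tgt \<sigma> = T" using tn by simp_all
  then have "frame_middle Ob arr src tgt (\<star>) (\<boxplus>) neg zer idn A A' B B' M N M' N' \<alpha> \<beta> \<gamma> \<delta> \<epsilon> \<zeta> \<eta> \<theta>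
     S T n n' m m' \<sigma>"
    by unfold_locales (use po pb tn tm \<sigma> u u' in simp_all)
  then show ?thesis by blast
qed

end

section \<open>Frames compatible with a cross\<close>

text \<open>Meant for correspondences where the partner is known only through unique existence, in
  both directions.\<close>

lemma bij_of_relation:
  assumes "\<And>a. a \<in> A \<Longrightarrow> \<exists>!b. b \<in> B \<and> R a b" "\<And>b. b \<in> B \<Longrightarrow> \<exists>!a. a \<in> A \<and> R a b"
  shows "\<exists>h. bij_betw h A B"
proof -
  define h where "h a = (THE b. b \<in> B \<and> R a b)" for a
  have h: "h a \<in> B \<and> R a (h a)" if "a \<in> A" for a
    unfolding h_def by (rule theI'[OF assms(1)[OF that]])
  have "bij_betw h A B"
  proof (rule bij_betwI')
    fix a a' assume "a \<in> A" "a' \<in> A" then show "(h a = h a') = (a = a')" using h assms(2) by metis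
  next
    fix b assume b: "b \<in> B"
    then obtain a where "a \<in> A" "R a b" using assms(2) by blast
    then show "\<exists>a\<in>A. b = h a" using h assms(1) b by metis
  qed (use h in blast)
  then show ?thesis by blast
qed

section \<open>Isomorphisms, and the corners determined by a cross\<close>

context abelian_cat
begin

definition hom :: "'a \<Rightarrow> 'a \<Rightarrow> 'b set" where
  "hom X Y = {f. arr f \<and> src f = X \<and> tgt f = Y}"

definition iso :: "'a \<Rightarrow> 'a \<Rightarrow> 'b set" where
  "iso X Y = {f \<in> hom X Y. \<exists>g. g \<star> f = idn X \<and> f \<star> g = idn Y}"

definition sess :: "'a \<Rightarrow> 'a \<Rightarrow> 'a \<Rightarrow> ('b \<times> 'b) set" where
  "sess X Z L = {(f, g). ses f g \<and> src f = Z \<and> tgt f = L \<and> tgt g = X}"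

lemma isoD:
  assumes "f \<in> iso X Y"
  shows "arr f" "src f = X" "tgt f = Y" "mono f" "epi f" "X \<in> Ob" "Y \<in> Ob"
    "\<exists>g. g \<in> iso Y X \<and> g \<star> f = idn X \<and> f \<star> g = idn Y"
proof -
  show 1: "arr f" "src f = X" "tgt f = Y" using assms by (auto simp: iso_def hom_def)
  show 2: "X \<in> Ob" "Y \<in> Ob" using src_Ob[OF 1(1)] tgt_Ob[OF 1(1)] 1 by simp_all
  obtain g where g: "g \<star> f = idn X" "f \<star> g = idn Y" using assms by (auto simp: iso_def)
  have "arr (g \<star> f)" "tgt (g \<star> f) = X" using g 2 by simp_all
  then have "arr g" "src g = Y" "tgt g = X" using 1 by simp_all
  then show "\<exists>g. g \<in> iso Y X \<and> g \<star> f = idn X \<and> f \<star> g = idn Y" using g 1 by (auto simp: iso_def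
      hom_def)
  show "mono f" by (rule mono_comp_right[of g]) (simp add: g 2 mono_idn)
  show "epi f" by (rule epi_comp_left[of _ g]) (simp add: g 2 epi_idn)
qed

lemma mono_epi_in_iso: "\<lbrakk>mono f; epi f\<rbrakk> \<Longrightarrow> f \<in> iso (src f) (tgt f)"
  using mono_epi_iso mono_arr unfolding iso_def hom_def by blast

lemma idn_iso: "X \<in> Ob \<Longrightarrow> idn X \<in> iso X X"
  by (auto simp: iso_def hom_def comp_idn intro!: exI[of _ "idn X"])

lemma iso_comp:
  assumes f: "f \<in> iso X Y" and g: "g \<in> iso Y V" shows "g \<star> f \<in> iso X V"
proof -
  have "mono (g \<star> f)" by (rule mono_comp[OF isoD(4)[OF g] isoD(4)[OF f]]) (use isoD[OF f] isoD[OF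
      g] in simp)
  moreover have "epi (g \<star> f)" by (rule epi_comp[OF isoD(5)[OF f] isoD(5)[OF g]]) (use isoD[OF f]
      isoD[OF g] in simp)
  ultimately have "g \<star> f \<in> iso (src (g \<star> f)) (tgt (g \<star> f))" by (rule mono_epi_in_iso)
  then show ?thesis using isoD(1-3)[OF f] isoD(1-3)[OF g] by simp
qed

lemma ses_iso:
  assumes s: "ses f g" and u: "u \<in> iso Z (src f)" and v: "v \<in> iso (tgt g) X"
  shows "ses (f \<star> u) (v \<star> g)"
proof -
  have a: "arr f" "arr g" "tgt f = src g" using ses_arr[OF s] by auto
  have b: "arr u" "tgt u = src f" "arr v" "src v = tgt g" using isoD[OF u] isoD[OF v] by auto
  obtain u' where u': "u' \<in> iso (src f) Z" "u \<star> u' = idn (src f)" using isoD(8)[OF u] by blast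
  have "epi (v \<star> g)" by (rule epi_comp[OF ses_epi[OF s] isoD(5)[OF v]]) (use a b in simp)
  moreover have "ker (f \<star> u) (v \<star> g)"
  proof (rule kerI)
    show "mono (f \<star> u)" by (rule mono_comp[OF ses_mono[OF s] isoD(4)[OF u]]) (use a b in simp)
    have "isz ((v \<star> (g \<star> f)) \<star> u)"
      by (rule isz_comp_left[OF isz_comp_right[OF ses_isz[OF s]]]) (use a b in simp_all)
    then show "isz (v \<star> g \<star> (f \<star> u))" by (simp add: comp_assoc)
    fix x assume "isz (v \<star> g \<star> x)"
    then have "isz (g \<star> x)" using mono_isz[OF isoD(4)[OF v]] by (simp add: comp_assoc)
    then obtain y where y: "f \<star> y = x" using ses_lift[OF s] by blast
    have ax: "arr (g \<star> x)" using \<open>isz (g \<star> x)\<close> by (rule isz_arr)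
    then have "arr (f \<star> y)" using y by simp
    then have "u \<star> (u' \<star> y) = y" by (simp add: reassoc[OF u'(2)] idn_comp)
    then show "\<exists>w. f \<star> u \<star> w = x" using y by (metis comp_assoc)
  qed
  ultimately show ?thesis by (rule epi_ses)
qed

text \<open>B' is the intersection of N and N' inside L: an element of both is killed by
  \<open>b'\<close>, hence by \<open>\<delta>\<close> because \<open>\<epsilon>\<close> is
  injective, and so comes from B'. This pins the corner down up to unique isomorphism; dually A is a
  pushout.\<close>

lemma corner_pb:
  assumes "ses a b" "ses a' b'" "ses \<gamma> \<delta>" "ses \<epsilon> \<zeta>" "a \<star> \<gamma> = a' \<star> \<eta>" "b' \<star> a = \<epsilon> \<star> \<delta>"
    "arr (b' \<star> a)"
  shows "pb \<gamma> \<eta> a a'"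
proof -
  have ar: "arr a" "arr a'" "arr b'" "tgt a' = src b'" "tgt a = src b'" "arr \<gamma>" "arr \<delta>" "tgt \<gamma> =
      src \<delta>"
    "arr \<epsilon>" "tgt \<delta> = src \<epsilon>" "src a = src \<delta>"
    using ses_arr[OF assms(1)] ses_arr[OF assms(2)] ses_arr[OF assms(3)] comp_eq_arr[OF
        assms(6,7)] by auto
  show ?thesis unfolding pb_def
  proof (intro conjI allI impI)
    show "arr (a \<star> \<gamma>)" using ar by simp
    fix u v assume uv: "arr (a \<star> u) \<and> a \<star> u = a' \<star> v"
    have auv: "arr u" "tgt u = src \<delta>" "arr v" "tgt v = src a'"
      using comp_eq_arr[of a u a' v, OF conjunct2[OF uv] conjunct1[OF uv]] ar(11) by simp_all
    have "isz ((b' \<star> a') \<star> v)" by (rule isz_comp_left[OF ses_isz[OF assms(2)]]) (use auv ar in simp)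
    then have "isz (b' \<star> (a \<star> u))" using uv by (simp add: comp_assoc)
    then have "isz (\<epsilon> \<star> (\<delta> \<star> u))" by (simp add: reassoc[OF assms(6)] comp_assoc)
    then have "isz (\<delta> \<star> u)" by (rule mono_isz[OF ses_mono[OF assms(4)]])
    then obtain z where z: "\<gamma> \<star> z = u" using ses_lift[OF assms(3)] by blast
    have "a' \<star> (\<eta> \<star> z) = a' \<star> v" using z uv assms(5) by (metis comp_assoc)
    moreover have "arr (a' \<star> (\<eta> \<star> z))" unfolding calculation using auv ar by simp
    ultimately have "\<eta> \<star> z = v" using monoD[OF ses_mono[OF assms(2)]] by blast
    then show "\<exists>!w. \<gamma> \<star> w = u \<and> \<eta> \<star> w = v"
      using z auv monoD[OF ses_mono[OF assms(3)], of _ z] by metis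
  qed (rule assms(5))
qed

text \<open>Once N -> M' and N' -> M are factored through their images, both have the intersection
  of N and N' as kernel. The dual version produces their common cokernel.\<close>

lemma corners_ex_half:
  assumes "ses a b" "ses a' b'" "tgt a = tgt a'" "mono \<epsilon>" "epi \<delta>" "\<epsilon> \<star> \<delta> = b' \<star> a" 
    "mono \<alpha>" "epi \<theta>" "\<alpha> \<star> \<theta> = b \<star> a'"
  shows "\<exists>\<gamma> \<eta>. ses \<gamma> \<delta> \<and> ses \<eta> \<theta> \<and> a \<star> \<gamma> = a' \<star> \<eta>"
proof -
  have ar: "arr a" "arr a'" "arr b" "arr b'" "tgt a' = src b'" "tgt a = src b'" "src b = src b'"
    using ses_arr[OF assms(1)] ses_arr[OF assms(2)] assms(3) by auto
  have ar2: "arr \<epsilon>" "arr \<delta>" "tgt \<delta> = src \<epsilon>" "src a = src \<delta>"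
    using comp_eq_arr[OF assms(6)[symmetric]] ar by auto
  have ar3: "arr \<alpha>" "arr \<theta>" "tgt \<theta> = src \<alpha>" "src a' = src \<theta>"
    using comp_eq_arr[OF assms(9)[symmetric]] ar by auto
  obtain \<gamma> where \<gamma>: "ses \<gamma> \<delta>" using epi_ses_ex[OF assms(5)] by blast
  have a\<gamma>: "arr \<gamma>" "tgt \<gamma> = src \<delta>" using ses_arr[OF \<gamma>] by auto
  have "isz (\<epsilon> \<star> (\<delta> \<star> \<gamma>))" by (rule isz_comp_right[OF ses_isz[OF \<gamma>]]) (use ar2 a\<gamma> in simp)
  then have "isz (b' \<star> (a \<star> \<gamma>))" by (simp add: reassoc[OF assms(6)] comp_assoc)
  then obtain \<eta> where \<eta>: "a' \<star> \<eta> = a \<star> \<gamma>" using ses_lift[OF assms(2)] by blast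
  have "ker \<eta> \<theta>"
  proof (rule kerI)
    have "mono (a' \<star> \<eta>)" unfolding \<eta>
      by (rule mono_comp[OF ses_mono[OF assms(1)] ses_mono[OF \<gamma>]]) (use ar ar2 a\<gamma> in simp)
    then show "mono \<eta>" by (rule mono_comp_right)
    have "isz ((b \<star> a) \<star> \<gamma>)" by (rule isz_comp_left[OF ses_isz[OF assms(1)]]) (use ar ar2 a\<gamma> in
        simp)
    then have "isz (\<alpha> \<star> (\<theta> \<star> \<eta>))" using \<eta> by (simp add: reassoc[OF assms(9)] comp_assoc)
    then show "isz (\<theta> \<star> \<eta>)" by (rule mono_isz[OF assms(7)])
    fix v assume v: "isz (\<theta> \<star> v)"
    have av: "arr v" "tgt v = src \<theta>" using isz_arr[OF v] by auto
    have "isz (\<alpha> \<star> (\<theta> \<star> v))" by (rule isz_comp_right[OF v]) (use av ar3 in simp)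
    then have "isz (b \<star> (a' \<star> v))" by (simp add: reassoc[OF assms(9)] comp_assoc)
    then obtain u where u: "a \<star> u = a' \<star> v" using ses_lift[OF assms(1)] by blast
    have "isz ((b' \<star> a') \<star> v)" by (rule isz_comp_left[OF ses_isz[OF assms(2)]]) (use av ar ar3 in
        simp)
    then have "isz (b' \<star> (a \<star> u))" using u by (simp add: comp_assoc)
    then have "isz (\<epsilon> \<star> (\<delta> \<star> u))" by (simp add: reassoc[OF assms(6)] comp_assoc)
    then have "isz (\<delta> \<star> u)" by (rule mono_isz[OF assms(4)])
    then obtain z where z: "\<gamma> \<star> z = u" using ses_lift[OF \<gamma>] by blast
    have "a' \<star> (\<eta> \<star> z) = a' \<star> v" using u z \<eta> by (metis comp_assoc)
    moreover have "arr (a' \<star> (\<eta> \<star> z))" unfolding calculation using av ar ar3 by simp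
    ultimately have "\<eta> \<star> z = v" using monoD[OF ses_mono[OF assms(2)]] by blast
    then show "\<exists>w. \<eta> \<star> w = v" by blast
  qed
  then have "ses \<eta> \<theta>" using epi_ses[OF assms(8)] by blast
  then show ?thesis using \<gamma> \<eta> by metis
qed

lemmas corner_po = abelian_cat.corner_pb[OF dual, unfolded dual_defs]
lemmas corners_ex_half_dual = abelian_cat.corners_ex_half[OF dual, unfolded dual_defs]

definition compat :: "(('b \<times> 'b) \<times> ('b \<times> 'b) \<times> ('b \<times> 'b) \<times> ('b \<times> 'b)) \<Rightarrow> ('b \<times> 'b) \<times> ('b \<times> 'b) \<Rightarrow>
    bool" where
  "compat = (\<lambda>((\<alpha>, \<beta>), (\<gamma>, \<delta>), (\<epsilon>, \<zeta>), (\<eta>, \<theta>)) ((a, b), (a', b')).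
     a \<star> \<gamma> = a' \<star> \<eta> \<and> \<beta> \<star> b = \<zeta> \<star> b' \<and> b \<star> a' = \<alpha> \<star> \<theta> \<and> b' \<star> a = \<epsilon> \<star> \<delta>)"

definition frames where
  "frames M N M' N' = (\<lambda>(A, A', B, B'). sess A A' M \<times> sess B B' N \<times> sess A B M' \<times> sess A' B' N')"

definition crosses where
  "crosses M N M' N' L = sess M N L \<times> sess M' N' L"

lemma frame_iff:
  "((\<alpha>, \<beta>), (\<gamma>, \<delta>), (\<epsilon>, \<zeta>), (\<eta>, \<theta>)) \<in> frames M N M' N' (A, A', B, B') \<longleftrightarrow>
   frame Ob arr src tgt (\<star>) (\<boxplus>) neg zer idn A A' B B' M N M' N' \<alpha> \<beta> \<gamma> \<delta> \<epsilon> \<zeta> \<eta> \<theta>"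
  unfolding frame_def frame_axioms_def frames_def sess_def using abelian_cat_axioms by auto

text \<open>B is the image of N -> M', A' the image of N' -> M. The corner B' is then the common
  kernel and A the common cokernel.\<close>

lemma frame_of_cross_ex:
  assumes "c \<in> crosses M N M' N' L"
  shows "\<exists>A A' B B' f. A \<in> Ob \<and> A' \<in> Ob \<and> B \<in> Ob \<and> B' \<in> Ob \<and> f \<in> frames M N M' N' (A, A', B, B') \<and>
      compat f c"
proof -
  obtain a b a' b' where c: "c = ((a, b), (a', b'))" by (metis prod.exhaust)
  have s: "ses a b" "ses a' b'" and t: "src a = N" "tgt a = L" "tgt b = M" "src a' = N'" "tgt a' =
      L" "tgt b' = M'"
    using assms unfolding c by (auto simp: crosses_def sess_def)
  have ar: "arr a" "arr b" "arr a'" "arr b'" "src b = L" "src b' = L"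
    using ses_arr[OF s(1)] ses_arr[OF s(2)] t by auto
  obtain \<epsilon> \<delta> where 1: "mono \<epsilon>" "epi \<delta>" "\<epsilon> \<star> \<delta> = b' \<star> a" using factor_ex[of "b' \<star> a"] ar t by auto
  obtain \<alpha> \<theta> where 2: "mono \<alpha>" "epi \<theta>" "\<alpha> \<star> \<theta> = b \<star> a'" using factor_ex[of "b \<star> a'"] ar t by auto
  have tt: "tgt a = tgt a'" "src b' = src b" using t ar by simp_all
  obtain \<gamma> \<eta> where 3: "ses \<gamma> \<delta>" "ses \<eta> \<theta>" "a \<star> \<gamma> = a' \<star> \<eta>"
    using corners_ex_half[OF s tt(1) 1 2] by blast
  obtain \<zeta> \<beta> where 4: "ses \<epsilon> \<zeta>" "ses \<alpha> \<beta>" "\<zeta> \<star> b' = \<beta> \<star> b"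
    using corners_ex_half_dual[OF s(2,1) tt(2) 1(2,1) 1(3) 2(2,1) 2(3)] by blast
  have 5: "tgt \<delta> = src \<epsilon>" "src \<delta> = N" "tgt \<epsilon> = M'"
    using comp_eq_arr[OF 1(3)[symmetric]] ar t by simp_all
  have 6: "tgt \<theta> = src \<alpha>" "src \<theta> = N'" "tgt \<alpha> = M"
    using comp_eq_arr[OF 2(3)[symmetric]] ar t by simp_all
  have 7: "tgt \<gamma> = src \<delta>" "tgt \<eta> = src \<theta>" "arr \<gamma>" "arr \<eta>" "arr \<epsilon>" "arr \<zeta>" "arr \<alpha>" "arr \<beta>" "tgt \<epsilon> =
      src \<zeta>" "tgt \<alpha> = src \<beta>"
    using ses_arr[OF 3(1)] ses_arr[OF 3(2)] ses_arr[OF 4(1)] ses_arr[OF 4(2)] by auto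
  have "arr (a \<star> \<gamma>)" using ar 7 5 t by simp
  then have 8: "src \<gamma> = src \<eta>" using comp_eq_arr[OF 3(3)] by blast
  have "arr (\<zeta> \<star> b')" using ar 7 5 t by simp
  then have 9: "tgt \<zeta> = tgt \<beta>" using comp_eq_arr[OF 4(3)] by blast
  let ?f = "((\<alpha>, \<beta>), (\<gamma>, \<delta>), (\<epsilon>, \<zeta>), (\<eta>, \<theta>))"
  have "?f \<in> frames M N M' N' (tgt \<beta>, src \<alpha>, src \<epsilon>, src \<gamma>)"
    using 3 4 5 6 7 8 9 unfolding frames_def sess_def by simp
  moreover have "compat ?f c" unfolding compat_def c using 1 2 3 4 by simp
  ultimately show ?thesis using 7 src_Ob tgt_Ob by blast
qed

definition frame_morph where
  "frame_morph = (\<lambda>(x, x', y, y') ((\<alpha>, \<beta>), (\<gamma>, \<delta>), (\<epsilon>, \<zeta>), (\<eta>, \<theta>)) ((\<alpha>1, \<beta>1), (\<gamma>1, \<delta>1), (\<epsilon>1, \<zeta>1),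
      (\<eta>1, \<theta>1)).
     \<alpha>1 \<star> x' = \<alpha> \<and> x \<star> \<beta> = \<beta>1 \<and> \<gamma>1 \<star> y' = \<gamma> \<and> y \<star> \<delta> = \<delta>1 \<and>
     \<epsilon>1 \<star> y = \<epsilon> \<and> x \<star> \<zeta> = \<zeta>1 \<and> \<eta>1 \<star> y' = \<eta> \<and> x' \<star> \<theta> = \<theta>1)"

lemma compat_cross:
  assumes "frame Ob arr src tgt (\<star>) (\<boxplus>) neg zer idn A A' B B' M N M' N' \<alpha> \<beta> \<gamma> \<delta> \<epsilon> \<zeta> \<eta> \<theta>"
  shows "((a, b), (a', b')) \<in> crosses M N M' N' (tgt a) \<and> compat ((\<alpha>, \<beta>), (\<gamma>, \<delta>), (\<epsilon>, \<zeta>), (\<eta>, \<theta>))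
      ((a, b), (a', b'))
    \<longleftrightarrow> frame.cross arr src tgt (\<star>) zer \<alpha> \<beta> \<gamma> \<delta> \<epsilon> \<zeta> \<eta> \<theta> a b a' b'"
proof -
  interpret f: frame Ob arr src tgt "(\<star>)" "(\<boxplus>)" neg zer idn A A' B B' M N M' N' \<alpha> \<beta> \<gamma> \<delta> \<epsilon> \<zeta> \<eta> \<theta> by
      (rule assms)
  show ?thesis
    using f.cross_arr[of a b a' b'] unfolding crosses_def sess_def compat_def f.cross_def by auto
qed

text \<open>The maps on B' and A come from the pullback and pushout descriptions, together with
  their inverses. On B and A', which are images, the induced maps commute with the epi and the mono
  of the factorisation and are therefore epi and mono.\<close>

lemma frame_morph_ex:
  assumes f: "f \<in> frames M N M' N' (A, A', B, B')" "compat f c"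
    and f1: "f1 \<in> frames M N M' N' (A1, A1', B1, B1')" "compat f1 c"
    and c: "c \<in> crosses M N M' N' L"
  shows "\<exists>x x' y y'. x \<in> iso A A1 \<and> x' \<in> iso A' A1' \<and> y \<in> iso B B1 \<and> y' \<in> iso B' B1' \<and> frame_morph
      (x, x', y, y') f f1"
proof -
  obtain a b a' b' where c': "c = ((a, b), (a', b'))" by (metis prod.exhaust)
  have s: "ses a b" "ses a' b'" and t: "src a = N" "tgt a = L" "tgt b = M" "src a' = N'" "tgt a' =
      L" "tgt b' = M'"
    using c unfolding c' by (auto simp: crosses_def sess_def)
  have ar: "arr a" "arr b" "arr a'" "arr b'" "src b = L" "src b' = L"
    using ses_arr[OF s(1)] ses_arr[OF s(2)] t by auto
  have ba: "arr (b' \<star> a)" using ar t by simp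
  obtain \<alpha> \<beta> \<gamma> \<delta> \<epsilon> \<zeta> \<eta> \<theta> where f': "f = ((\<alpha>, \<beta>), (\<gamma>, \<delta>), (\<epsilon>, \<zeta>), (\<eta>, \<theta>))" by (metis prod.exhaust)
  obtain \<alpha>1 \<beta>1 \<gamma>1 \<delta>1 \<epsilon>1 \<zeta>1 \<eta>1 \<theta>1 where f1': "f1 = ((\<alpha>1, \<beta>1), (\<gamma>1, \<delta>1), (\<epsilon>1, \<zeta>1), (\<eta>1, \<theta>1))" by
      (metis prod.exhaust)
  have fr: "frame Ob arr src tgt (\<star>) (\<boxplus>) neg zer idn A A' B B' M N M' N' \<alpha> \<beta> \<gamma> \<delta> \<epsilon> \<zeta> \<eta> \<theta>"
    and fr1: "frame Ob arr src tgt (\<star>) (\<boxplus>) neg zer idn A1 A1' B1 B1' M N M' N' \<alpha>1 \<beta>1 \<gamma>1 \<delta>1 \<epsilon>1 \<zeta>1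
        \<eta>1 \<theta>1"
    using f(1) f1(1) unfolding f' f1' frame_iff by auto
  interpret f: frame Ob arr src tgt "(\<star>)" "(\<boxplus>)" neg zer idn A A' B B' M N M' N' \<alpha> \<beta> \<gamma> \<delta> \<epsilon> \<zeta> \<eta> \<theta> by
      (rule fr)
  interpret g: frame Ob arr src tgt "(\<star>)" "(\<boxplus>)" neg zer idn A1 A1' B1 B1' M N M' N' \<alpha>1 \<beta>1 \<gamma>1 \<delta>1 \<epsilon>1
      \<zeta>1 \<eta>1 \<theta>1 by (rule fr1)
  have e: "a \<star> \<gamma> = a' \<star> \<eta>" "\<beta> \<star> b = \<zeta> \<star> b'" "b \<star> a' = \<alpha> \<star> \<theta>" "b' \<star> a = \<epsilon> \<star> \<delta>"
    and e1: "a \<star> \<gamma>1 = a' \<star> \<eta>1" "\<beta>1 \<star> b = \<zeta>1 \<star> b'" "b \<star> a' = \<alpha>1 \<star> \<theta>1" "b' \<star> a = \<epsilon>1 \<star> \<delta>1"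
    using f(2) f1(2) unfolding f' f1' c' compat_def by auto
  have pb: "pb \<gamma> \<eta> a a'" by (rule corner_pb[OF s f.ses\<gamma> f.ses\<epsilon> e(1,4) ba])
  have pb1: "pb \<gamma>1 \<eta>1 a a'" by (rule corner_pb[OF s g.ses\<gamma> g.ses\<epsilon> e1(1,4) ba])
  have po: "po \<zeta> \<beta> b' b" by (rule corner_po[OF s(2,1) f.ses\<epsilon> f.ses\<gamma> e(2)[symmetric] e(4) ba])
  have po1: "po \<zeta>1 \<beta>1 b' b" by (rule corner_po[OF s(2,1) g.ses\<epsilon> g.ses\<gamma> e1(2)[symmetric] e1(4) ba])
  obtain y' where y': "\<gamma>1 \<star> y' = \<gamma>" "\<eta>1 \<star> y' = \<eta>" using pb_lift[OF pb1 _ e(1)] ar t by auto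
  obtain z' where z': "\<gamma> \<star> z' = \<gamma>1" "\<eta> \<star> z' = \<eta>1" using pb_lift[OF pb _ e1(1)] ar t by auto
  have "arr (\<gamma>1 \<star> y')" "src (\<gamma>1 \<star> y') = B'" "arr (\<gamma> \<star> z')" "src (\<gamma> \<star> z') = B1'" using y' z' by
      simp_all
  then have ty: "arr y'" "src y' = B'" "tgt y' = B1'" "arr z'" "src z' = B1'" "tgt z' = B'" by
      simp_all
  have "y' \<star> z' = idn B1'"
    by (rule monoD[OF ses_mono[OF g.ses\<gamma>]]) (use ty in \<open>simp_all add: reassoc[OF y'(1)] z'
        comp_idn\<close>)
  moreover have "z' \<star> y' = idn B'"
    by (rule monoD[OF ses_mono[OF f.ses\<gamma>]]) (use ty in \<open>simp_all add: reassoc[OF z'(1)] y'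
        comp_idn\<close>)
  ultimately have iy': "y' \<in> iso B' B1'" using ty by (auto simp: iso_def hom_def)
  have "arr (\<zeta>1 \<star> b')" "arr (\<zeta> \<star> b')" using ar t by simp_all
  then obtain x z where x: "x \<star> \<zeta> = \<zeta>1" "x \<star> \<beta> = \<beta>1" and z: "z \<star> \<zeta>1 = \<zeta>" "z \<star> \<beta>1 = \<beta>"
    using po_lift[OF po _ e1(2)[symmetric]] po_lift[OF po1 _ e(2)[symmetric]] by blast
  have "arr (x \<star> \<beta>)" "tgt (x \<star> \<beta>) = A1" "arr (z \<star> \<beta>1)" "tgt (z \<star> \<beta>1) = A" using x z by simp_all
  then have tx: "arr x" "src x = A" "tgt x = A1" "arr z" "src z = A1" "tgt z = A" by simp_all
  have "z \<star> x = idn A"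
    by (rule epiD[OF ses_epi[OF f.ses\<alpha>]]) (use tx in \<open>simp_all add: comp_assoc x z idn_comp\<close>)
  moreover have "x \<star> z = idn A1"
    by (rule epiD[OF ses_epi[OF g.ses\<alpha>]]) (use tx in \<open>simp_all add: comp_assoc x z idn_comp\<close>)
  ultimately have ix: "x \<in> iso A A1" using tx by (auto simp: iso_def hom_def)
  have "isz ((\<delta>1 \<star> \<gamma>1) \<star> y')" by (rule isz_comp_left[OF ses_isz[OF g.ses\<gamma>]]) (use ty in simp)
  then have "isz (\<delta>1 \<star> \<gamma>)" by (simp add: comp_assoc y')
  then obtain y where y: "y \<star> \<delta> = \<delta>1" using ses_colift[OF f.ses\<gamma>] by blast
  have "arr (y \<star> \<delta>)" "tgt (y \<star> \<delta>) = B1" using y by simp_all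
  then have tyy: "arr y" "src y = B" "tgt y = B1" by simp_all
  have y2: "\<epsilon>1 \<star> y = \<epsilon>"
    by (rule epiD[OF ses_epi[OF f.ses\<gamma>]]) (use tyy e(4) e1(4) in \<open>simp_all add: comp_assoc y\<close>)
  have "mono y" by (rule mono_comp_right[of \<epsilon>1]) (simp add: y2 ses_mono[OF f.ses\<epsilon>])
  moreover have "epi y" by (rule epi_comp_left[of _ \<delta>]) (simp add: y ses_epi[OF g.ses\<gamma>])
  ultimately have iy: "y \<in> iso B B1" using mono_epi_in_iso tyy by blast
  have "isz ((\<theta>1 \<star> \<eta>1) \<star> y')" by (rule isz_comp_left[OF ses_isz[OF g.ses\<eta>]]) (use ty in simp)
  then have "isz (\<theta>1 \<star> \<eta>)" by (simp add: comp_assoc y')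
  then obtain x' where x': "x' \<star> \<theta> = \<theta>1" using ses_colift[OF f.ses\<eta>] by blast
  have "arr (x' \<star> \<theta>)" "tgt (x' \<star> \<theta>) = A1'" using x' by simp_all
  then have tx': "arr x'" "src x' = A'" "tgt x' = A1'" by simp_all
  have x2: "\<alpha>1 \<star> x' = \<alpha>"
    by (rule epiD[OF ses_epi[OF f.ses\<eta>]]) (use tx' e(3) e1(3) in \<open>simp_all add: comp_assoc x'\<close>)
  have "mono x'" by (rule mono_comp_right[of \<alpha>1]) (simp add: x2 ses_mono[OF f.ses\<alpha>])
  moreover have "epi x'" by (rule epi_comp_left[of _ \<theta>]) (simp add: x' ses_epi[OF g.ses\<eta>])
  ultimately have ix': "x' \<in> iso A' A1'" using mono_epi_in_iso tx' by blast
  have "frame_morph (x, x', y, y') f f1"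
    unfolding frame_morph_def f' f1' using x x' y y' x2 y2 by simp
  then show ?thesis using ix ix' iy iy' by blast
qed

text \<open>Transport of structure: arrows out of a corner are composed with the inverse of its
  isomorphism, arrows into it with the isomorphism itself. The equations of
  \<open>frame_morph\<close> leave no other choice.\<close>

lemma frame_transport:
  assumes f: "f \<in> frames M N M' N' (A, A', B, B')" "compat f c"
    and i: "x \<in> iso A A1" "x' \<in> iso A' A1'" "y \<in> iso B B1" "y' \<in> iso B' B1'"
    and c: "c \<in> crosses M N M' N' L"
  shows "\<exists>!f1. f1 \<in> frames M N M' N' (A1, A1', B1, B1') \<and> compat f1 c \<and> frame_morph (x, x', y, y')
      f f1"
proof -
  obtain a b a' b' where c': "c = ((a, b), (a', b'))" by (metis prod.exhaust)
  obtain \<alpha> \<beta> \<gamma> \<delta> \<epsilon> \<zeta> \<eta> \<theta> where f': "f = ((\<alpha>, \<beta>), (\<gamma>, \<delta>), (\<epsilon>, \<zeta>), (\<eta>, \<theta>))" by (metis prod.exhaust)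
  interpret f: frame Ob arr src tgt "(\<star>)" "(\<boxplus>)" neg zer idn A A' B B' M N M' N' \<alpha> \<beta> \<gamma> \<delta> \<epsilon> \<zeta> \<eta> \<theta>
    using f(1) unfolding f' frame_iff .
  have e: "a \<star> \<gamma> = a' \<star> \<eta>" "\<beta> \<star> b = \<zeta> \<star> b'" "b \<star> a' = \<alpha> \<star> \<theta>" "b' \<star> a = \<epsilon> \<star> \<delta>"
    using f(2) unfolding f' c' compat_def by auto
  obtain u where u: "u \<in> iso A1' A'" "u \<star> x' = idn A'" "x' \<star> u = idn A1'" using isoD(8)[OF i(2)]
      by blast
  obtain v where v: "v \<in> iso B1 B" "v \<star> y = idn B" "y \<star> v = idn B1" using isoD(8)[OF i(3)] by blast
  obtain w where w: "w \<in> iso B1' B'" "w \<star> y' = idn B'" "y' \<star> w = idn B1'" using isoD(8)[OF i(4)]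
      by blast
  note ti = isoD(1-3)[OF i(1)] isoD(1-3)[OF i(2)] isoD(1-3)[OF i(3)] isoD(1-3)[OF i(4)]
      isoD(1-3)[OF u(1)]
    isoD(1-3)[OF v(1)] isoD(1-3)[OF w(1)]
  let ?f1 = "((\<alpha> \<star> u, x \<star> \<beta>), (\<gamma> \<star> w, y \<star> \<delta>), (\<epsilon> \<star> v, x \<star> \<zeta>), (\<eta> \<star> w, x' \<star> \<theta>))"
  have fr: "?f1 \<in> frames M N M' N' (A1, A1', B1, B1')"
    unfolding frames_def sess_def using ti i u(1) v(1) w(1)
    by (auto intro!: ses_iso f.ses\<alpha> f.ses\<gamma> f.ses\<epsilon> f.ses\<eta>)
  have co: "compat ?f1 c"
    unfolding compat_def c'
    by (simp add: comp_assoc e reassoc[OF e(1)] reassoc[OF u(2)] reassoc[OF v(2)] idn_comp)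
  have mo: "frame_morph (x, x', y, y') f ?f1"
    unfolding frame_morph_def f' using u v w by (simp add: comp_assoc comp_idn)
  show ?thesis
  proof (rule ex1I[of _ ?f1])
    fix f2 assume f2: "f2 \<in> frames M N M' N' (A1, A1', B1, B1') \<and> compat f2 c \<and> frame_morph (x,
        x', y, y') f f2"
    obtain \<alpha>2 \<beta>2 \<gamma>2 \<delta>2 \<epsilon>2 \<zeta>2 \<eta>2 \<theta>2 where f2': "f2 = ((\<alpha>2, \<beta>2), (\<gamma>2, \<delta>2), (\<epsilon>2, \<zeta>2), (\<eta>2, \<theta>2))" by
        (metis prod.exhaust)
    interpret g: frame Ob arr src tgt "(\<star>)" "(\<boxplus>)" neg zer idn A1 A1' B1 B1' M N M' N' \<alpha>2 \<beta>2 \<gamma>2 \<delta>2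
        \<epsilon>2 \<zeta>2 \<eta>2 \<theta>2
      using f2 unfolding f2' frame_iff by simp
    have m: "\<alpha>2 \<star> x' = \<alpha>" "x \<star> \<beta> = \<beta>2" "\<gamma>2 \<star> y' = \<gamma>" "y \<star> \<delta> = \<delta>2" "\<epsilon>2 \<star> y = \<epsilon>" "x \<star> \<zeta> = \<zeta>2"
      "\<eta>2 \<star> y' = \<eta>" "x' \<star> \<theta> = \<theta>2"
      using f2 unfolding f' f2' frame_morph_def by auto
    have "\<alpha>2 = \<alpha> \<star> u" "\<gamma>2 = \<gamma> \<star> w" "\<epsilon>2 = \<epsilon> \<star> v" "\<eta>2 = \<eta> \<star> w"
      unfolding m(1,3,5,7)[symmetric] comp_assoc u v w by (simp_all add: comp_idn)
    then show "f2 = ?f1" using m unfolding f2' by simp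
  qed (use fr co mo in blast)
qed

text \<open>The frame \<open>f\<close> is taken as origin, and a quadruple of corner automorphisms
  corresponds to the frame transported along it. The quadruple is recovered because the sides are
  mono where they leave a corner and epi where they enter one.\<close>

lemma compatible_frames_bij:
  assumes f: "f \<in> frames M N M' N' (A, A', B, B')" "compat f c" and c: "c \<in> crosses M N M' N' L"
  shows "\<exists>h. bij_betw h (iso A A \<times> iso A' A' \<times> iso B B \<times> iso B' B')
    {f1 \<in> frames M N M' N' (A, A', B, B'). compat f1 c}"
proof (rule bij_of_relation[where R = "\<lambda>i f1. frame_morph i f f1"])
  fix i assume "i \<in> iso A A \<times> iso A' A' \<times> iso B B \<times> iso B' B'"
  then obtain x x' y y' where i: "i = (x, x', y, y')" "x \<in> iso A A" "x' \<in> iso A' A'" "y \<in> iso B B"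
      "y' \<in> iso B' B'"
    by auto
  show "\<exists>!b. b \<in> {f1 \<in> frames M N M' N' (A, A', B, B'). compat f1 c} \<and> frame_morph i f b"
    using frame_transport[OF f i(2-5) c] unfolding i(1) by simp
next
  fix f1 assume "f1 \<in> {f1 \<in> frames M N M' N' (A, A', B, B'). compat f1 c}"
  then have f1: "f1 \<in> frames M N M' N' (A, A', B, B')" "compat f1 c" by auto
  obtain x x' y y' where i: "x \<in> iso A A \<and> x' \<in> iso A' A' \<and> y \<in> iso B B \<and> y' \<in> iso B' B' \<and>
      frame_morph (x, x', y, y') f f1"
    using frame_morph_ex[OF f f1 c] by blast
  show "\<exists>!a. a \<in> iso A A \<times> iso A' A' \<times> iso B B \<times> iso B' B' \<and> frame_morph a f f1"
  proof (rule ex1I[of _ "(x, x', y, y')"])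
    fix j assume j: "j \<in> iso A A \<times> iso A' A' \<times> iso B B \<times> iso B' B' \<and> frame_morph j f f1"
    obtain x2 x2' y2 y2' where j': "j = (x2, x2', y2, y2')" by (metis prod.exhaust)
    obtain \<alpha> \<beta> \<gamma> \<delta> \<epsilon> \<zeta> \<eta> \<theta> where f': "f = ((\<alpha>, \<beta>), (\<gamma>, \<delta>), (\<epsilon>, \<zeta>), (\<eta>, \<theta>))" by (metis prod.exhaust)
    obtain \<alpha>2 \<beta>2 \<gamma>2 \<delta>2 \<epsilon>2 \<zeta>2 \<eta>2 \<theta>2 where f1': "f1 = ((\<alpha>2, \<beta>2), (\<gamma>2, \<delta>2), (\<epsilon>2, \<zeta>2), (\<eta>2, \<theta>2))" by
        (metis prod.exhaust)
    interpret f: frame Ob arr src tgt "(\<star>)" "(\<boxplus>)" neg zer idn A A' B B' M N M' N' \<alpha> \<beta> \<gamma> \<delta> \<epsilon> \<zeta> \<eta> \<theta>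
      using f(1) unfolding f' frame_iff .
    interpret g: frame Ob arr src tgt "(\<star>)" "(\<boxplus>)" neg zer idn A A' B B' M N M' N' \<alpha>2 \<beta>2 \<gamma>2 \<delta>2 \<epsilon>2
        \<zeta>2 \<eta>2 \<theta>2
      using f1(1) unfolding f1' frame_iff .
    have m: "\<alpha>2 \<star> x' = \<alpha>" "x \<star> \<beta> = \<beta>2" "\<gamma>2 \<star> y' = \<gamma>" "y \<star> \<delta> = \<delta>2"
      using i unfolding f' f1' frame_morph_def by auto
    have m2: "\<alpha>2 \<star> x2' = \<alpha>" "x2 \<star> \<beta> = \<beta>2" "\<gamma>2 \<star> y2' = \<gamma>" "y2 \<star> \<delta> = \<delta>2"
      using j unfolding f' f1' j' frame_morph_def by auto
    have "x2' = x'" by (rule monoD[OF ses_mono[OF g.ses\<alpha>]]) (simp_all only: m m2 f.arrs)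
    moreover have "x2 = x" by (rule epiD[OF ses_epi[OF f.ses\<alpha>]]) (simp_all only: m m2 g.arrs)
    moreover have "y2' = y'" by (rule monoD[OF ses_mono[OF g.ses\<gamma>]]) (simp_all only: m m2 f.arrs)
    moreover have "y2 = y" by (rule epiD[OF ses_epi[OF f.ses\<gamma>]]) (simp_all only: m m2 g.arrs)
    ultimately show "j = (x, x', y, y')" by (simp add: j')
  qed (use i in simp)
qed

end

section \<open>Counting\<close>

text \<open>A correspondence that is total on both sides and respects the equivalences both ways
  suffices, so no map between the underlying sets has to be chosen.\<close>

lemma quotient_bij_of_relation:
  assumes r: "equiv A r" and s: "equiv B s"
    and tot: "\<And>a. a \<in> A \<Longrightarrow> \<exists>b\<in>B. P a b" and surj: "\<And>b. b \<in> B \<Longrightarrow> \<exists>a\<in>A. P a b"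
    and cong: "\<And>a a' b b'. \<lbrakk>a \<in> A; a' \<in> A; b \<in> B; b' \<in> B; P a b; P a' b'\<rbrakk> \<Longrightarrow> (a, a') \<in> r \<longleftrightarrow> (b, b')
        \<in> s"
  shows "\<exists>h. bij_betw h (A // r) (B // s)"
proof -
  define h where "h c = {b \<in> B. \<exists>a\<in>c. P a b}" for c
  have h: "h (r `` {a}) = s `` {b}" if ab: "a \<in> A" "b \<in> B" "P a b" for a b
  proof (intro equalityI subsetI)
    fix b' assume "b' \<in> h (r `` {a})"
    then obtain a' where a': "b' \<in> B" "(a, a') \<in> r" "P a' b'" by (auto simp: h_def)
    then have "a' \<in> A" using equivE[OF r] by (meson refl_on_def equiv_class_eq_iff r)
    then show "b' \<in> s `` {b}" using cong[OF ab(1) _ ab(2) a'(1) ab(3) a'(3)] a'(2) by simp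
  next
    fix b' assume b': "b' \<in> s `` {b}"
    then have B: "b' \<in> B" using s by (auto simp: equiv_class_eq_iff)
    obtain a' where a': "a' \<in> A" "P a' b'" using surj[OF B] by blast
    then have "(a, a') \<in> r" using cong[OF ab(1) a'(1) ab(2) B ab(3) a'(2)] b' by simp
    then show "b' \<in> h (r `` {a})" using a' B by (auto simp: h_def)
  qed
  have "bij_betw h (A // r) (B // s)"
  proof (rule bij_betwI')
    fix c c' assume "c \<in> A // r" "c' \<in> A // r"
    then obtain a a' where a: "c = r `` {a}" "a \<in> A" "c' = r `` {a'}" "a' \<in> A" by (auto simp:
        quotient_def)
    obtain b b' where b: "b \<in> B" "P a b" "b' \<in> B" "P a' b'" using tot a by meson
    have "h c = h c' \<longleftrightarrow> (b, b') \<in> s"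
      using h[OF a(2) b(1,2)] h[OF a(4) b(3,4)] a eq_equiv_class_iff[OF s b(1,3)] by simp
    also have "\<dots> \<longleftrightarrow> (a, a') \<in> r" using cong[OF a(2,4) b(1,3,2,4)] by simp
    also have "\<dots> \<longleftrightarrow> c = c'" using eq_equiv_class_iff[OF r a(2,4)] a by simp
    finally show "(h c = h c') = (c = c')" .
  next
    fix c assume "c \<in> A // r"
    then obtain a where a: "c = r `` {a}" "a \<in> A" by (auto simp: quotient_def)
    obtain b where "b \<in> B" "P a b" using tot a by meson
    then show "h c \<in> B // s" using h a by (auto simp: quotient_def)
  next
    fix d assume "d \<in> B // s"
    then obtain b where b: "d = s `` {b}" "b \<in> B" by (auto simp: quotient_def)
    obtain a where "a \<in> A" "P a b" using surj b by meson
    then show "\<exists>c\<in>A // r. d = h c" using h[of a b] b by (intro bexI[of _ "r `` {a}"]) (auto simp: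
        quotient_def)
  qed
  then show ?thesis by blast
qed

lemma equiv_restrict:
  assumes r: "equiv A r" and "B \<subseteq> A" shows "equiv B (r \<inter> B \<times> B)"
proof -
  have "refl_on A r" "sym r" "trans r" using r by (auto elim: equivE)
  then show ?thesis using assms(2)
    by (intro equivI refl_onI symI transI) (blast dest: symD transD refl_onD)+
qed

context abelian_cat
begin

definition exts :: "'a \<Rightarrow> 'a \<Rightarrow> ('b \<times> 'b) set" where
  "exts X Z = {(i, q). ses i q \<and> src i = Z \<and> tgt q = X}"

text \<open>Asking for a mere morphism is enough: by the short five lemma it is invertible, which is
  also why the relation is symmetric.\<close>

definition ext_rel :: "'a \<Rightarrow> 'a \<Rightarrow> (('b \<times> 'b) \<times> ('b \<times> 'b)) set" where
  "ext_rel X Z = {((i, q), (i', q')). (i, q) \<in> exts X Z \<and> (i', q') \<in> exts X Z \<and> (\<exists>f. f \<star> i = i' \<and>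
      q' \<star> f = q)}"

lemma ses_morph_iso:
  assumes "ses i q" "ses i' q'" "f \<star> i = i'" "q' \<star> f = q"
  shows "f \<in> iso (tgt i) (tgt i')"
proof -
  have "arr (f \<star> i)" "tgt (f \<star> i) = tgt i'" using ses_arr[OF assms(2)] assms(3) by simp_all
  then have "src f = tgt i" "tgt f = tgt i'" by simp_all
  then show ?thesis
    using mono_epi_in_iso[OF five_lemma_mono[OF assms] five_lemma_epi[OF assms(2,1,4,3)]] by simp
qed

lemma inverse_morph:
  assumes "ses i q" "ses i' q'" "f \<star> i = i'" "q' \<star> f = q"
  shows "\<exists>g. g \<star> i' = i \<and> q \<star> g = q'"
proof -
  have fi: "f \<in> iso (tgt i) (tgt i')" by (rule ses_morph_iso[OF assms])
  then obtain g where g: "g \<star> f = idn (tgt i)" "f \<star> g = idn (tgt i')" using isoD(8) by blast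
  have a: "arr i" "arr q'" "src q' = tgt i'" using ses_arr[OF assms(1)] ses_arr[OF assms(2)] by auto
  have "g \<star> i' = i" using a by (simp add: assms(3)[symmetric] reassoc[OF g(1)] idn_comp)
  moreover have "q \<star> g = q'" using a by (simp add: assms(4)[symmetric] comp_assoc g(2) comp_idn)
  ultimately show ?thesis by blast
qed

lemma equiv_ext_rel: "equiv (exts X Z) (ext_rel X Z)"
proof (rule equivI)
  show "ext_rel X Z \<subseteq> exts X Z \<times> exts X Z" by (auto simp: ext_rel_def)
  show "refl_on (exts X Z) (ext_rel X Z)"
  proof (rule refl_onI)
    fix e assume e: "e \<in> exts X Z"
    obtain i q where iq: "e = (i, q)" by (metis prod.exhaust)
    then have "ses i q" using e by (simp add: exts_def)
    then have "idn (tgt i) \<star> i = i" "q \<star> idn (tgt i) = q" using ses_arr by (simp_all add: idn_comp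
        comp_idn)
    then show "(e, e) \<in> ext_rel X Z" using e iq by (auto simp: ext_rel_def)
  qed
  show "sym (ext_rel X Z)"
    by (rule symI) (auto simp: ext_rel_def exts_def intro: inverse_morph)
  show "trans (ext_rel X Z)"
  proof (rule transI)
    fix a b c assume h: "(a, b) \<in> ext_rel X Z" "(b, c) \<in> ext_rel X Z"
    obtain i q where 1: "a = (i, q)" by (metis prod.exhaust)
    obtain i' q' where 2: "b = (i', q')" by (metis prod.exhaust)
    obtain i'' q'' where 3: "c = (i'', q'')" by (metis prod.exhaust)
    from h obtain f g where fg: "f \<star> i = i'" "q' \<star> f = q" "g \<star> i' = i''" "q'' \<star> g = q'"
      and m: "(i, q) \<in> exts X Z" "(i'', q'') \<in> exts X Z" unfolding 1 2 3 by (auto simp: ext_rel_def)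
    have "(g \<star> f) \<star> i = i''" "q'' \<star> (g \<star> f) = q" using fg by (simp_all add: comp_assoc reassoc[OF
        fg(4)])
    then show "(a, c) \<in> ext_rel X Z" using m unfolding 1 3 by (auto simp: ext_rel_def)
  qed
qed

lemma ses_iso_middle:
  assumes "ses f g" "u' \<star> u = idn (tgt f)" "u \<star> u' = idn L" "u \<in> iso (tgt f) L"
  shows "ses (u \<star> f) (g \<star> u')"
proof -
  have a: "arr f" "arr g" "tgt f = src g" using ses_arr[OF assms(1)] by auto
  have b: "arr u" "src u = src g" "tgt u = L" "L \<in> Ob" using isoD[OF assms(4)] a by auto
  have "arr (u' \<star> u)" "tgt (u' \<star> u) = src g" using assms(2) a by simp_all
  then have c: "arr u'" "src u' = L" "tgt u' = src g" using b by simp_all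
  have "mono (u \<star> f)" by (rule mono_comp[OF isoD(4)[OF assms(4)] ses_mono[OF assms(1)]]) (use a b
      in simp)
  moreover have "epi (g \<star> u')"
  proof -
    have "u' \<in> iso L (tgt f)" using assms(2,3) a b c by (auto simp: iso_def hom_def)
    from isoD(5)[OF this] show ?thesis by (rule epi_comp[OF _ ses_epi[OF assms(1)]]) (use a c in
        simp)
  qed
  moreover have "ker (u \<star> f) (g \<star> u')"
  proof (rule kerI[OF calculation(1)])
    show "isz (g \<star> u' \<star> (u \<star> f))"
      using ses_isz[OF assms(1)] a by (simp add: comp_assoc reassoc[OF assms(2)] idn_comp)
    fix x assume x: "isz (g \<star> u' \<star> x)"
    have ax: "arr x" "tgt x = L" using isz_arr[OF x] c by auto
    have "isz (g \<star> (u' \<star> x))" using x by (simp add: comp_assoc)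
    then obtain y where y: "f \<star> y = u' \<star> x" using ses_lift[OF assms(1)] by blast
    have "u \<star> f \<star> y = x" using ax by (simp add: comp_assoc y reassoc[OF assms(3)] idn_comp)
    then show "\<exists>v. u \<star> f \<star> v = x" by blast
  qed
  ultimately show ?thesis using epi_ses by blast
qed

end

section \<open>Isomorphism of completions\<close>

context two_extension
begin

definition compls :: "('b \<times> 'b) set" where "compls = {(s, t). compl s t}"

definition compl_rel :: "(('b \<times> 'b) \<times> ('b \<times> 'b)) set" where
  "compl_rel = {((s, t), (s', t')). compl s t \<and> compl s' t' \<and> (\<exists>g. g \<star> s = s' \<and> t' \<star> g = t)}"

lemma compl_morph_iso:
  assumes "compl s t" "compl s' t'" "g \<star> s = s'" "t' \<star> g = t"
  shows "g \<in> iso (tgt s) (tgt s')"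
proof (rule ses_morph_iso)
  show "ses s (p \<star> t)" "ses s' (p \<star> t')" using assms by (auto simp: compl_def)
  show "p \<star> t' \<star> g = p \<star> t" using assms by (simp add: comp_assoc)
qed (rule assms)

lemma equiv_compl_rel: "equiv compls compl_rel"
proof (rule equivI)
  show "compl_rel \<subseteq> compls \<times> compls" by (auto simp: compl_rel_def compls_def)
  show "refl_on compls compl_rel"
  proof (rule refl_onI)
    fix e assume "e \<in> compls"
    then obtain s t where e: "e = (s, t)" "compl s t" by (auto simp: compls_def)
    have "idn (tgt s) \<star> s = s" "t \<star> idn (tgt s) = t" using compl_arr[OF e(2)] by (simp_all add:
        idn_comp comp_idn)
    then show "(e, e) \<in> compl_rel" using e by (auto simp: compl_rel_def)
  qed
  show "sym compl_rel"
  proof (rule symI)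
    fix a b assume "(a, b) \<in> compl_rel"
    then obtain s t s' t' g where h: "a = (s, t)" "b = (s', t')" "compl s t" "compl s' t'" "g \<star> s
        = s'" "t' \<star> g = t"
      by (auto simp: compl_rel_def)
    obtain u where u: "u \<star> g = idn (tgt s)" "g \<star> u = idn (tgt s')" using isoD(8)[OF
        compl_morph_iso[OF h(3-6)]] by blast
    have "u \<star> s' = s" using compl_arr[OF h(3)] by (simp add: h(5)[symmetric] reassoc[OF u(1)]
        idn_comp)
    moreover have "t \<star> u = t'" using compl_arr[OF h(4)] by (simp add: h(6)[symmetric] comp_assoc
        u(2) comp_idn)
    ultimately show "(b, a) \<in> compl_rel" using h by (auto simp: compl_rel_def)
  qed
  show "trans compl_rel"
  proof (rule transI)
    fix a b c assume h: "(a, b) \<in> compl_rel" "(b, c) \<in> compl_rel"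
    obtain i q where 1: "a = (i, q)" by (metis prod.exhaust)
    obtain i' q' where 2: "b = (i', q')" by (metis prod.exhaust)
    obtain i'' q'' where 3: "c = (i'', q'')" by (metis prod.exhaust)
    from h obtain f g where fg: "f \<star> i = i'" "q' \<star> f = q" "g \<star> i' = i''" "q'' \<star> g = q'"
      and m: "compl i q" "compl i'' q''" unfolding 1 2 3 by (auto simp: compl_rel_def)
    have "(g \<star> f) \<star> i = i''" "q'' \<star> (g \<star> f) = q" using fg by (simp_all add: comp_assoc reassoc[OF
        fg(4)])
    then show "(a, c) \<in> compl_rel" using m unfolding 1 3 by (auto simp: compl_rel_def)
  qed
qed

lemma compl_transport:
  assumes c: "compl s t" and u: "u \<in> iso (tgt s) L"
  shows "\<exists>s' t'. compl s' t' \<and> tgt s' = L \<and> ((s, t), (s', t')) \<in> compl_rel"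
proof -
  obtain v where v: "v \<star> u = idn (tgt s)" "u \<star> v = idn L" using isoD(8)[OF u] by blast
  have tc: "arr s" "arr t" "src t = tgt s" using compl_arr[OF c] by auto
  have ts: "t \<star> s = \<sigma>" "ses s (p \<star> t)" using c by (auto simp: compl_def)
  have tu: "t \<star> v \<star> u = t" using tc by (simp add: comp_assoc v comp_idn)
  have "ses (u \<star> s) (p \<star> t \<star> v)" by (rule ses_iso_middle[OF ts(2) v u])
  moreover have "t \<star> v \<star> (u \<star> s) = \<sigma>" using ts by (simp add: comp_assoc[symmetric] tu)
  ultimately have "compl (u \<star> s) (t \<star> v)" by (intro complI) (simp_all add: comp_assoc)
  moreover have "tgt (u \<star> s) = L" using isoD[OF u] tc by simp
  moreover have "((s, t), (u \<star> s, t \<star> v)) \<in> compl_rel"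
    using c tu calculation(1) unfolding compl_rel_def by blast
  ultimately show ?thesis by blast
qed

end

text \<open>The assumption \<open>unobstructed\<close> is the form in which the vanishing of Ext^2
  is used, and \<open>R\<close> is a transversal of the isomorphism classes of objects.\<close>

locale finitary_cat = abelian_cat +
  fixes R
  assumes fin_hom: "\<lbrakk>X \<in> Ob; Y \<in> Ob\<rbrakk> \<Longrightarrow> finite (hom X Y)"
    and fin_ext: "\<lbrakk>X \<in> Ob; Z \<in> Ob\<rbrakk> \<Longrightarrow> finite (exts X Z // ext_rel X Z)"
    and unobstructed: "\<lbrakk>ker j \<sigma>; cok p \<sigma>\<rbrakk> \<Longrightarrow> \<exists>s t. t \<star> s = \<sigma> \<and> ses s (p \<star> t)"
    and R_sub: "R \<subseteq> Ob"
    and R_ex: "X \<in> Ob \<Longrightarrow> \<exists>Y\<in>R. iso X Y \<noteq> {}"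
    and R_uniq: "\<lbrakk>X \<in> R; Y \<in> R; iso X Y \<noteq> {}\<rbrakk> \<Longrightarrow> X = Y"

context finitary_cat
begin

lemma finite_iso: "finite (iso U V)"
proof (cases "U \<in> Ob \<and> V \<in> Ob")
  case True then show ?thesis using finite_subset[OF _ fin_hom[of U V]] by (auto simp: iso_def)
next
  case False then have "iso U V = {}" using isoD(6,7) by blast
  then show ?thesis by simp
qed

end

section \<open>The weighted number of completions centred at representatives\<close>

locale fin_two_extension = two_extension + finitary_cat
begin

definition rep_compls :: "('b \<times> 'b) set" where "rep_compls = {(s, t). compl s t \<and> tgt s \<in> R}"

lemma compl_rep: "compl s t \<Longrightarrow> \<exists>x\<in>rep_compls. ((s, t), x) \<in> compl_rel"
proof -
  assume c: "compl s t"
  obtain L u where L: "L \<in> R" "u \<in> iso (tgt s) L" using R_ex[of "tgt s"] compl_arr[OF c] by auto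
  show ?thesis using compl_transport[OF c L(2)] L(1) by (auto simp: rep_compls_def)
qed

text \<open>A base completion, supplied by \<open>unobstructed\<close>, trivialises the torsor. A
  second comparison restricts to centres in \<open>R\<close>, as every completion can be moved there
  along an isomorphism.\<close>

lemma rep_compls_quotient: "\<exists>h. bij_betw h (exts X Z // ext_rel X Z) (rep_compls // (compl_rel \<inter>
    rep_compls \<times> rep_compls))"
proof -
  obtain s0 t0 where "t0 \<star> s0 = \<sigma>" "ses s0 (p \<star> t0)" using unobstructed[OF ker_j cok_p] by blast
  then have c0: "compl s0 t0" by (rule complI)
  have "\<exists>h. bij_betw h (exts X Z // ext_rel X Z) (compls // compl_rel)"
  proof (rule quotient_bij_of_relation[OF equiv_ext_rel equiv_compl_rel,
        where P = "\<lambda>x y. baer s0 t0 (fst x) (snd x) (fst y) (snd y)"])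
    fix a assume "a \<in> exts X Z"
    then have "ext (fst a) (snd a)" by (auto simp: exts_def ext_def)
    from ext_translate[OF c0 this] show "\<exists>b\<in>compls. baer s0 t0 (fst a) (snd a) (fst b) (snd b)"
      by (auto simp: compls_def)
  next
    fix b assume "b \<in> compls"
    then have "compl (fst b) (snd b)" by (auto simp: compls_def)
    from compl_difference[OF c0 this] show "\<exists>a\<in>exts X Z. baer s0 t0 (fst a) (snd a) (fst b) (snd b)"
      by (auto simp: exts_def ext_def)
  next
    fix a a' b b' assume h: "a \<in> exts X Z" "a' \<in> exts X Z" "b \<in> compls" "b' \<in> compls"
      "baer s0 t0 (fst a) (snd a) (fst b) (snd b)" "baer s0 t0 (fst a') (snd a') (fst b') (snd b')"
    have e: "ext (fst a) (snd a)" "ext (fst a') (snd a')" "compl (fst b) (snd b)" "compl (fst b')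
        (snd b')"
      using h(1-4) by (auto simp: exts_def ext_def compls_def)
    have "(a, a') \<in> ext_rel X Z \<longleftrightarrow> (\<exists>f. f \<star> fst a = fst a' \<and> snd a' \<star> f = snd a)"
      using h(1,2) by (cases a; cases a') (auto simp: ext_rel_def)
    also have "\<dots> \<longleftrightarrow> (\<exists>g. g \<star> fst b = fst b' \<and> snd b' \<star> g = snd b)"
      using translate_unique[OF h(5,6) _ _ e(3,4,1,2)] difference_unique[OF h(5,6) _ _ e(3,4,1,2)]
          by blast
    also have "\<dots> \<longleftrightarrow> (b, b') \<in> compl_rel" using e(3,4) by (cases b; cases b') (auto simp:
        compl_rel_def)
    finally show "(a, a') \<in> ext_rel X Z \<longleftrightarrow> (b, b') \<in> compl_rel" .
  qed
  then obtain h1 where h1: "bij_betw h1 (exts X Z // ext_rel X Z) (compls // compl_rel)" by blast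
  have sub: "rep_compls \<subseteq> compls" by (auto simp: rep_compls_def compls_def)
  have eq: "equiv rep_compls (compl_rel \<inter> rep_compls \<times> rep_compls)"
    by (rule equiv_restrict[OF equiv_compl_rel sub])
  have "\<exists>h. bij_betw h (compls // compl_rel) (rep_compls // (compl_rel \<inter> rep_compls \<times> rep_compls))"
  proof (rule quotient_bij_of_relation[OF equiv_compl_rel eq, where P = "\<lambda>x y. (x, y) \<in> compl_rel"])
    fix a assume "a \<in> compls"
    then show "\<exists>b\<in>rep_compls. (a, b) \<in> compl_rel" using compl_rep by (auto simp: compls_def)
  next
    fix b assume "b \<in> rep_compls"
    then show "\<exists>a\<in>compls. (a, b) \<in> compl_rel" using sub equiv_compl_rel by (auto simp: equiv_def
        refl_on_def)
  next
    fix a a' b b' assume h: "b \<in> rep_compls" "b' \<in> rep_compls" "(a, b) \<in> compl_rel" "(a', b') \<in>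
        compl_rel"
    have s: "sym compl_rel" "trans compl_rel" using equiv_compl_rel by (auto simp: equiv_def)
    show "(a, a') \<in> compl_rel \<longleftrightarrow> (b, b') \<in> compl_rel \<inter> rep_compls \<times> rep_compls"
      using h s by (auto dest: symD transD)
  qed
  then obtain h2 where "bij_betw h2 (compls // compl_rel) (rep_compls // (compl_rel \<inter> rep_compls \<times>
      rep_compls))" by blast
  then show ?thesis using bij_betw_trans[OF h1] by blast
qed

text \<open>Orbit and stabiliser. All members of the class have the same centre L, since isomorphic
  representatives are equal, and Aut L acts transitively on the class with stabilisers of size
  |Hom(X, Z)|. Hence the class has |Aut L| / |Hom(X, Z)| members, each of weight 1 / |Aut
  L|.\<close>

lemma rep_class_mass:
  assumes "c \<in> rep_compls // (compl_rel \<inter> rep_compls \<times> rep_compls)"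
  shows "finite c \<and> (\<Sum>x\<in>c. 1 / real (card (iso (tgt (fst x)) (tgt (fst x))))) = 1 / real (card
      (hom X Z))"
proof -
  obtain s t where st: "compl s t" "tgt s \<in> R" "c = (compl_rel \<inter> rep_compls \<times> rep_compls) `` {(s,
      t)}"
    using assms by (auto simp: quotient_def rep_compls_def)
  define L where "L = tgt s"
  have LO: "L \<in> Ob" using st(2) R_sub by (auto simp: L_def)
  have tgtc: "tgt (fst x) = L" if "x \<in> c" for x
  proof -
    obtain s' t' g where x: "x = (s', t')" "compl s' t'" "tgt s' \<in> R" "g \<star> s = s'" "t' \<star> g = t"
      using \<open>x \<in> c\<close> unfolding st(3) by (auto simp: compl_rel_def rep_compls_def)
    have "g \<in> iso L (tgt s')" unfolding L_def by (rule compl_morph_iso[OF st(1) x(2,4,5)])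
    then have "iso (tgt s) (tgt s') \<noteq> {}" by (auto simp: L_def)
    then have "tgt s = tgt s'" by (rule R_uniq[OF st(2) x(3)])
    then show ?thesis using x(1) by (simp add: L_def)
  qed
  have cmem: "(s', t') \<in> c \<longleftrightarrow> compl s' t' \<and> (\<exists>g\<in>iso L L. g \<star> s = s' \<and> t' \<star> g = t)" (is "_ = ?r")
      for s' t'
  proof
    assume m: "(s', t') \<in> c"
    then obtain g where x: "compl s' t'" "g \<star> s = s'" "t' \<star> g = t"
      unfolding st(3) by (auto simp: compl_rel_def rep_compls_def)
    have "g \<in> iso L L" using compl_morph_iso[OF st(1) x] tgtc[OF m] by (simp add: L_def)
    then show ?r using x by blast
  next
    assume ?r
    then obtain g where x: "compl s' t'" "g \<in> iso L L" "g \<star> s = s'" "t' \<star> g = t" by blast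
    have "tgt s' = L" using x(3) isoD[OF x(2)] compl_arr[OF st(1)] L_def by auto
    then show "(s', t') \<in> c" using x st by (auto simp: compl_rel_def rep_compls_def L_def)
  qed
  \<comment> \<open>The automorphisms of L that carry the chosen completion \<open>(s, t)\<close> to
    \<open>x\<close>.\<close>
  define F where "F x = {h. h \<star> s = fst x \<and> snd x \<star> h = t}" for x
  have Fsub: "F x \<subseteq> iso L L" if x: "x \<in> c" for x
  proof
    fix h assume "h \<in> F x"
    then show "h \<in> iso L L" using compl_morph_iso[OF st(1), of "fst x" "snd x" h] tgtc[OF x] x
        cmem[of "fst x" "snd x"]
      by (auto simp: F_def L_def)
  qed
  have cardF: "card (F x) = card (hom X Z)" if x: "x \<in> c" for x
  proof -
    obtain g where g: "compl (fst x) (snd x)" "g \<star> s = fst x" "snd x \<star> g = t"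
      using x cmem[of "fst x" "snd x"] by auto
    show ?thesis unfolding F_def hom_def
      using bij_betw_same_card[OF automorphisms_of_completion[OF st(1) g]] by simp
  qed
  \<comment> \<open>Any automorphism \<open>g\<close> with inverse \<open>v\<close> takes
    \<open>(s, t)\<close> to the completion \<open>(g \<star> s, t \<star> v)\<close>, so the fibres
    exhaust Aut L.\<close>
  have un: "iso L L = (\<Union>x\<in>c. F x)"
  proof (intro equalityI subsetI)
    fix g assume g: "g \<in> iso L L"
    obtain v where v: "v \<star> g = idn L" "g \<star> v = idn L" using isoD(8)[OF g] by blast
    have tc: "arr s" "arr t" "src t = tgt s" using compl_arr[OF st(1)] by auto
    have ts: "t \<star> s = \<sigma>" "ses s (p \<star> t)" using st(1) by (auto simp: compl_def)
    have tu: "t \<star> v \<star> g = t" using tc by (simp add: comp_assoc v comp_idn L_def)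
    have "ses (g \<star> s) (p \<star> t \<star> v)" by (rule ses_iso_middle[OF ts(2)]) (use v g in \<open>auto simp:
        L_def\<close>)
    moreover have "t \<star> v \<star> (g \<star> s) = \<sigma>" using ts by (simp add: comp_assoc[symmetric] tu)
    ultimately have "compl (g \<star> s) (t \<star> v)" by (intro complI) (simp_all add: comp_assoc)
    then have "(g \<star> s, t \<star> v) \<in> c" using cmem g tu by blast
    moreover have "g \<in> F (g \<star> s, t \<star> v)" using tu by (simp add: F_def)
    ultimately show "g \<in> (\<Union>x\<in>c. F x)" by blast
  qed (use Fsub in blast)
  have "c \<subseteq> hom S L \<times> hom L T"
  proof
    fix x assume x: "x \<in> c"
    then have "compl (fst x) (snd x)" using cmem[of "fst x" "snd x"] by auto
    from compl_arr[OF this] show "x \<in> hom S L \<times> hom L T" using tgtc[OF x]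
      by (cases x) (auto simp: hom_def)
  qed
  then have finc: "finite c" using finite_subset fin_hom[OF _ LO, of S] fin_hom[OF LO, of T] by
      (metis finite_cartesian_product Ob_simps(2,3))
  have "card (iso L L) = (\<Sum>x\<in>c. card (F x))" unfolding un
  proof (rule card_UN_disjoint[OF finc])
    show "\<forall>x\<in>c. finite (F x)" using Fsub finite_iso finite_subset by metis
    show "\<forall>x\<in>c. \<forall>y\<in>c. x \<noteq> y \<longrightarrow> F x \<inter> F y = {}"
    proof (intro ballI impI)
      fix x y assume xy: "x \<in> c" "y \<in> c" "x \<noteq> y"
      show "F x \<inter> F y = {}"
      proof (rule ccontr)
        assume "F x \<inter> F y \<noteq> {}"
        then obtain h where hF: "h \<in> F x" "h \<in> F y" by blast
        then have h: "h \<star> s = fst x" "snd x \<star> h = t" "h \<star> s = fst y" "snd y \<star> h = t"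
          by (simp_all add: F_def)
        have "epi h" using Fsub[OF xy(1)] hF isoD(5) by blast
        moreover have "arr (snd x \<star> h)" "snd x \<star> h = snd y \<star> h" using compl_arr[OF st(1)] h by
            simp_all
        ultimately have "snd x = snd y" by (rule epiD)
        then show False using h xy(3) by (simp add: prod_eq_iff)
      qed
    qed
  qed
  then have iso_card: "card (iso L L) = card c * card (hom X Z)" using cardF by simp
  have "idn L \<in> iso L L" by (rule idn_iso[OF LO])
  then have ipos: "card (iso L L) > 0" using finite_iso card_gt_0_iff by blast
  have "(\<Sum>x\<in>c. 1 / real (card (iso (tgt (fst x)) (tgt (fst x))))) = real (card c) * (1 / real
      (card (iso L L)))"
    using tgtc by simp
  also have "\<dots> = 1 / real (card (hom X Z))" using iso_card ipos by (auto simp: field_simps)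
  finally show ?thesis using finc by blast
qed

text \<open>Nonemptiness is recorded as well: it later shows that every frame occurs under some
  cross, from which the finiteness of the set of frames follows.\<close>

theorem completion_mass:
  "finite rep_compls \<and> rep_compls \<noteq> {} \<and>
   (\<Sum>x\<in>rep_compls. 1 / real (card (iso (tgt (fst x)) (tgt (fst x))))) =
   real (card (exts X Z // ext_rel X Z)) / real (card (hom X Z))"
proof -
  let ?r = "compl_rel \<inter> rep_compls \<times> rep_compls"
  let ?w = "\<lambda>x. 1 / real (card (iso (tgt (fst x)) (tgt (fst x))))"
  obtain h where h: "bij_betw h (exts X Z // ext_rel X Z) (rep_compls // ?r)" using
      rep_compls_quotient by blast
  have fq: "finite (rep_compls // ?r)" using bij_betw_finite[OF h] fin_ext by simp
  have sub: "rep_compls \<subseteq> compls" by (auto simp: rep_compls_def compls_def)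
  have eq: "equiv rep_compls ?r"
    by (rule equiv_restrict[OF equiv_compl_rel sub])
  have un: "\<Union>(rep_compls // ?r) = rep_compls" by (rule Union_quotient[OF eq])
  have fin: "finite rep_compls" using fq rep_class_mass finite_Union[of "rep_compls // ?r"] un by
      metis
  obtain s0 t0 where "t0 \<star> s0 = \<sigma>" "ses s0 (p \<star> t0)" using unobstructed[OF ker_j cok_p] by blast
  then have ne: "rep_compls \<noteq> {}" using compl_rep complI by blast
  have "(\<Sum>x\<in>rep_compls. ?w x) = (\<Sum>x\<in>\<Union>(rep_compls // ?r). ?w x)" using un by simp
  also have "\<dots> = (\<Sum>c\<in>rep_compls // ?r. \<Sum>x\<in>c. ?w x)"
    by (subst sum.Union_disjoint) (use rep_class_mass quotient_disj[OF eq] in auto)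
  also have "\<dots> = (\<Sum>c\<in>rep_compls // ?r. 1 / real (card (hom X Z)))"
    using rep_class_mass by (intro sum.cong) auto
  also have "\<dots> = real (card (exts X Z // ext_rel X Z)) / real (card (hom X Z))"
    using bij_betw_same_card[OF h] by simp
  finally show ?thesis using fin ne by blast
qed

end

section \<open>Double counting of crosses and frames\<close>

context finitary_cat
begin

lemma card_iso_pos: "X \<in> Ob \<Longrightarrow> card (iso X X) > 0"
  using idn_iso finite_iso card_gt_0_iff by blast

lemma finite_sess: "\<lbrakk>X \<in> Ob; Z \<in> Ob; L \<in> Ob\<rbrakk> \<Longrightarrow> finite (sess X Z L)"
proof -
  assume o: "X \<in> Ob" "Z \<in> Ob" "L \<in> Ob"
  have "sess X Z L \<subseteq> hom Z L \<times> hom L X" using ses_arr by (auto simp: sess_def hom_def)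
  then show ?thesis using fin_hom o finite_subset by (metis finite_cartesian_product)
qed

text \<open>Choosing one short exact sequence for each L gives an injection into Ext^1: equivalent
  extensions have isomorphic middle terms, and isomorphic representatives are equal.\<close>

lemma finite_middles:
  assumes "X \<in> Ob" "Z \<in> Ob" shows "finite {L \<in> R. sess X Z L \<noteq> {}}"
proof -
  let ?A = "{L \<in> R. sess X Z L \<noteq> {}}"
  define e where "e L = (SOME x. x \<in> sess X Z L)" for L
  have e: "e L \<in> sess X Z L" if "L \<in> ?A" for L
    using that unfolding e_def some_in_eq by blast
  have e': "e L \<in> exts X Z" if "L \<in> ?A" for L using e[OF that] by (auto simp: sess_def exts_def)
  have "inj_on (\<lambda>L. ext_rel X Z `` {e L}) ?A"
  proof (rule inj_onI)
    fix L L' assume L: "L \<in> ?A" "L' \<in> ?A" "ext_rel X Z `` {e L} = ext_rel X Z `` {e L'}"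
    then have "(e L, e L') \<in> ext_rel X Z"
      using eq_equiv_class_iff[OF equiv_ext_rel e'[OF L(1)] e'[OF L(2)]] by simp
    then obtain f where f: "f \<star> fst (e L) = fst (e L')" "snd (e L') \<star> f = snd (e L)"
      by (auto simp: ext_rel_def)
    have "ses (fst (e L)) (snd (e L))" "ses (fst (e L')) (snd (e L'))"
      "tgt (fst (e L)) = L" "tgt (fst (e L')) = L'"
      using e[OF L(1)] e[OF L(2)] by (auto simp: sess_def)
    then have "f \<in> iso L L'" using ses_morph_iso[OF _ _ f] by simp
    then show "L = L'" using R_uniq[of L L'] L(1,2) by blast
  qed
  moreover have "(\<lambda>L. ext_rel X Z `` {e L}) ` ?A \<subseteq> exts X Z // ext_rel X Z"
    using e' by (auto simp: quotient_def)
  ultimately show ?thesis using fin_ext[OF assms] by (meson finite_subset finite_imageD)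
qed

text \<open>The exact sequence B' -> S -> T -> A attached to the frame is the two-fold extension;
  \<open>cross_bij\<close> moves the mass of its completions to the crosses, with the same centre
  and hence the same weight.\<close>

lemma frame_mass:
  assumes f: "f \<in> frames M N M' N' (A, A', B, B')"
  defines "CC \<equiv> {c. tgt (fst (fst c)) \<in> R \<and> c \<in> crosses M N M' N' (tgt (fst (fst c))) \<and> compat f c}"
  shows "finite CC \<and> CC \<noteq> {} \<and>
    (\<Sum>c\<in>CC. 1 / real (card (iso (tgt (fst (fst c))) (tgt (fst (fst c)))))) =
      real (card (exts A B' // ext_rel A B')) / real (card (hom A B'))"
proof -
  obtain \<alpha> \<beta> \<gamma> \<delta> \<epsilon> \<zeta> \<eta> \<theta> where f': "f = ((\<alpha>, \<beta>), (\<gamma>, \<delta>), (\<epsilon>, \<zeta>), (\<eta>, \<theta>))" by (metis prod.exhaust)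
  have fr: "frame Ob arr src tgt (\<star>) (\<boxplus>) neg zer idn A A' B B' M N M' N' \<alpha> \<beta> \<gamma> \<delta> \<epsilon> \<zeta> \<eta> \<theta>"
    using f unfolding f' frame_iff .
  interpret f: frame Ob arr src tgt "(\<star>)" "(\<boxplus>)" neg zer idn A A' B B' M N M' N' \<alpha> \<beta> \<gamma> \<delta> \<epsilon> \<zeta> \<eta> \<theta> by
      (rule fr)
  obtain S T n n' m m' \<sigma> where "frame_middle Ob arr src tgt (\<star>) (\<boxplus>) neg zer idn A A' B B' M N M'
      N' \<alpha> \<beta> \<gamma> \<delta> \<epsilon> \<zeta> \<eta> \<theta>
     S T n n' m m' \<sigma>" using f.middle_ex by blast
  then interpret g: frame_middle Ob arr src tgt "(\<star>)" "(\<boxplus>)" neg zer idn A A' B B' M N M' N' \<alpha> \<beta> \<gamma>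
      \<delta> \<epsilon> \<zeta> \<eta> \<theta>
     S T n n' m m' \<sigma> .
  interpret h: fin_two_extension Ob arr src tgt "(\<star>)" "(\<boxplus>)" neg zer idn B' S T A "n \<star> \<gamma>" \<sigma> "\<beta> \<star> m" R
    by unfold_locales
  let ?F = "\<lambda>(s, t). ((s \<star> n, m \<star> t), (s \<star> n', m' \<star> t))"
  have CC: "CC = {((a, b), (a', b')). f.cross a b a' b' \<and> tgt a \<in> R}"
  proof (rule Set.set_eqI)
    fix c :: "('b \<times> 'b) \<times> 'b \<times> 'b"
    obtain a b a' b' where c: "c = ((a, b), (a', b'))" by (metis prod.exhaust)
    show "c \<in> CC \<longleftrightarrow> c \<in> {((a, b), (a', b')). f.cross a b a' b' \<and> tgt a \<in> R}"
      unfolding CC_def f' c mem_Collect_eq fst_conv prod.case compat_cross[OF fr, symmetric] by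
          blast
  qed
  have bij: "bij_betw ?F h.rep_compls CC"
    unfolding CC h.rep_compls_def by (rule g.cross_bij)
  have "(\<Sum>c\<in>CC. 1 / real (card (iso (tgt (fst (fst c))) (tgt (fst (fst c)))))) =
    (\<Sum>x\<in>h.rep_compls. 1 / real (card (iso (tgt (fst (fst (?F x)))) (tgt (fst (fst (?F x)))))))"
    by (rule sum.reindex_bij_betw[OF bij, symmetric])
  also have "\<dots> = (\<Sum>x\<in>h.rep_compls. 1 / real (card (iso (tgt (fst x)) (tgt (fst x)))))"
  proof (rule sum.cong)
    fix x assume "x \<in> h.rep_compls"
    then obtain s t where x: "x = (s, t)" "g.compl s t" by (auto simp: h.rep_compls_def)
    have "tgt (s \<star> n) = tgt s" using g.compl_arr[OF x(2)] by simp
    then show "1 / real (card (iso (tgt (fst (fst (?F x)))) (tgt (fst (fst (?F x)))))) =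
      1 / real (card (iso (tgt (fst x)) (tgt (fst x))))" using x(1) by simp
  qed simp
  also have "\<dots> = real (card (exts A B' // ext_rel A B')) / real (card (hom A B'))"
    using h.completion_mass by blast
  finally show ?thesis using h.completion_mass bij_betw_finite[OF bij] bij by (auto simp:
      bij_betw_def)
qed

text \<open>Compatible pairs of a cross and a frame are weighted by the inverse automorphism numbers
  of the centre and of the four corners. Summing over frames first gives the left side, over crosses
  first the right side.\<close>

theorem green_count:
  assumes Ob: "M \<in> Ob" "N \<in> Ob" "M' \<in> Ob" "N' \<in> Ob"
  defines "a \<equiv> \<lambda>X. real (card (iso X X))"
  defines "FL \<equiv> {L \<in> R. crosses M N M' N' L \<noteq> {}}"
    and "FQ \<equiv> {Q \<in> R \<times> R \<times> R \<times> R. frames M N M' N' Q \<noteq> {}}"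
  shows "finite FL" "finite FQ"
    "(\<Sum>L\<in>FL. real (card (crosses M N M' N' L)) / a L) =
     (\<Sum>(A, A', B, B')\<in>FQ. real (card (exts A B' // ext_rel A B')) / real (card (hom A B')) *
        real (card (frames M N M' N' (A, A', B, B'))) / (a A * a A' * a B * a B'))"
proof -
  define mid where "mid c = tgt (fst (fst c))" for c :: "('b \<times> 'b) \<times> 'b \<times> 'b"
  define cor where "cor f = (tgt (snd (fst f)), src (fst (fst f)), src (fst (fst (snd (snd f)))),
      src (fst (fst (snd f))))"
    for f :: "('b \<times> 'b) \<times> ('b \<times> 'b) \<times> ('b \<times> 'b) \<times> ('b \<times> 'b)"
  define w where "w = (\<lambda>(A, A', B, B'). a A * a A' * a B * a B')"
  define ee :: "'a \<times> 'a \<times> 'a \<times> 'a \<Rightarrow> real" where "ee = (\<lambda>(A, A', B, B'). real (card (exts A B' //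
      ext_rel A B')) / real (card (hom A B')))"
  let ?X = "crosses M N M' N'" and ?F = "frames M N M' N'"
  have midX: "c \<in> ?X L \<Longrightarrow> mid c = L" for c L by (auto simp: crosses_def sess_def mid_def)
  have corF: "f \<in> ?F Q \<Longrightarrow> cor f = Q" for f Q by (cases Q) (auto simp: frames_def sess_def cor_def)
  define CR where "CR = (\<Union>L\<in>FL. ?X L)"
  define FR where "FR = (\<Union>Q\<in>FQ. ?F Q)"
  have CR: "c \<in> CR \<longleftrightarrow> mid c \<in> R \<and> c \<in> ?X (mid c)" for c
  proof -
    have "c \<in> CR \<longleftrightarrow> (\<exists>L\<in>R. c \<in> ?X L)" unfolding CR_def FL_def by blast
    then show ?thesis using midX by metis
  qed
  have FR: "f \<in> FR \<longleftrightarrow> cor f \<in> R \<times> R \<times> R \<times> R \<and> f \<in> ?F (cor f)" for f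
  proof -
    have "f \<in> FR \<longleftrightarrow> (\<exists>Q\<in>R \<times> R \<times> R \<times> R. f \<in> ?F Q)" unfolding FR_def FQ_def by blast
    then show ?thesis using corF by metis
  qed
  have "FL \<subseteq> {L \<in> R. sess M N L \<noteq> {}}" by (auto simp: FL_def crosses_def)
  then show finFL: "finite FL" using finite_middles[OF Ob(1,2)] finite_subset by blast
  have finX: "finite (?X L)" if "L \<in> R" for L
    using finite_sess Ob R_sub that unfolding crosses_def by (intro finite_cartesian_product) blast+
  have finF: "finite (?F Q)" if "Q \<in> R \<times> R \<times> R \<times> R" for Q
    using finite_sess Ob R_sub that unfolding frames_def by (cases Q) (auto intro!:
        finite_cartesian_product)
  have finCR: "finite CR" unfolding CR_def using finFL finX by (auto simp: FL_def)
  have apos: "a X > 0" if "X \<in> R" for X using card_iso_pos R_sub that by (auto simp: a_def)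
  have wpos: "w Q > 0" if "Q \<in> R \<times> R \<times> R \<times> R" for Q using apos that by (auto simp: w_def)
  \<comment> \<open>The frames over one cross all have the same corners, since corners are unique up
    to isomorphism and run over representatives. Their number is exactly \<open>w\<close> of these
    corners, so the weights add up to one.\<close>
  have cf: "finite {f \<in> FR. compat f c} \<and> (\<Sum>f\<in>{f \<in> FR. compat f c}. 1 / w (cor f)) = 1" if c: "c \<in>
      CR" for c
  proof -
    have cX: "c \<in> ?X (mid c)" using c CR by blast
    obtain A0 A0' B0 B0' f0 where f0: "A0 \<in> Ob" "A0' \<in> Ob" "B0 \<in> Ob" "B0' \<in> Ob"
       "f0 \<in> ?F (A0, A0', B0, B0')" "compat f0 c" using frame_of_cross_ex[OF cX] by blast
    obtain A x where A: "A \<in> R" "x \<in> iso A0 A" using R_ex[OF f0(1)] by blast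
    obtain A' x' where A': "A' \<in> R" "x' \<in> iso A0' A'" using R_ex[OF f0(2)] by blast
    obtain B y where B: "B \<in> R" "y \<in> iso B0 B" using R_ex[OF f0(3)] by blast
    obtain B' y' where B': "B' \<in> R" "y' \<in> iso B0' B'" using R_ex[OF f0(4)] by blast
    obtain f where f: "f \<in> ?F (A, A', B, B')" "compat f c"
      using frame_transport[OF f0(5,6) A(2) A'(2) B(2) B'(2) cX] by blast
    let ?Q = "(A, A', B, B')"
    have Q: "?Q \<in> R \<times> R \<times> R \<times> R" using A A' B B' by blast
    have same: "cor f1 = ?Q" if f1: "f1 \<in> FR" "compat f1 c" for f1
    proof -
      obtain A1 A1' B1 B1' where c1: "cor f1 = (A1, A1', B1, B1')" by (metis prod.exhaust)
      have m1: "f1 \<in> ?F (A1, A1', B1, B1')" "A1 \<in> R" "A1' \<in> R" "B1 \<in> R" "B1' \<in> R" using f1 FR c1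
          by auto
      obtain x x' y y' where "x \<in> iso A A1 \<and> x' \<in> iso A' A1' \<and> y \<in> iso B B1 \<and> y' \<in> iso B' B1'"
        using frame_morph_ex[OF f m1(1) f1(2) cX] by blast
      then show ?thesis using R_uniq A(1) A'(1) B(1) B'(1) m1 unfolding c1 by blast
    qed
    have eq: "{f \<in> FR. compat f c} = {f1 \<in> ?F ?Q. compat f1 c}"
      using same FR corF Q by (metis (lifting))
    obtain h where h: "bij_betw h (iso A A \<times> iso A' A' \<times> iso B B \<times> iso B' B') {f1 \<in> ?F ?Q. compat
        f1 c}"
      using compatible_frames_bij[OF f cX] by blast
    have "real (card {f1 \<in> ?F ?Q. compat f1 c}) = w ?Q"
      unfolding bij_betw_same_card[OF h, symmetric] by (simp add: w_def a_def
          card_cartesian_product)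
    moreover have "(\<Sum>f\<in>{f \<in> FR. compat f c}. 1 / w (cor f)) = (\<Sum>f\<in>{f1 \<in> ?F ?Q. compat f1 c}. 1 / w
        ?Q)"
      unfolding eq by (rule sum.cong) (auto dest: corF)
    ultimately show ?thesis using wpos[OF Q] finF[OF Q] eq by simp
  qed
  have fc: "finite {c \<in> CR. compat f c} \<and> {c \<in> CR. compat f c} \<noteq> {} \<and> (\<Sum>c\<in>{c \<in> CR. compat f c}. 1
      / a (mid c)) = ee (cor f)"
    if f: "f \<in> FR" for f
  proof -
    obtain A A' B B' where Q: "cor f = (A, A', B, B')" by (metis prod.exhaust)
    have fF: "f \<in> ?F (A, A', B, B')" using f FR Q by simp
    have "{c \<in> CR. compat f c} = {c. mid c \<in> R \<and> c \<in> ?X (mid c) \<and> compat f c}" using CR by blast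
    then show ?thesis using frame_mass[OF fF] unfolding a_def ee_def Q mid_def by simp
  qed
  \<comment> \<open>Finiteness of the set of frames comes from the crosses: there are finitely many
    of them, each carries finitely many frames, and every frame has a cross.\<close>
  have "FR \<subseteq> (\<Union>c\<in>CR. {f \<in> FR. compat f c})" using fc by blast
  then have finFR: "finite FR" using finCR cf by (meson finite_UN_I finite_subset)
  have FQim: "FQ = cor ` FR"
  proof (intro equalityI subsetI)
    fix Q assume Q: "Q \<in> FQ"
    then obtain f where f: "f \<in> ?F Q" unfolding FQ_def by blast
    then have "f \<in> FR" using Q unfolding FR_def by blast
    then show "Q \<in> cor ` FR" using corF[OF f] by blast
  next
    fix Q assume "Q \<in> cor ` FR"
    then obtain f where "f \<in> FR" "Q = cor f" by blast
    then show "Q \<in> FQ" using FR unfolding FQ_def by blast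
  qed
  then show finFQ: "finite FQ" using finFR by simp
  have "(\<Sum>L\<in>FL. real (card (?X L)) / a L) = (\<Sum>L\<in>FL. \<Sum>c\<in>?X L. 1 / a (mid c))"
    using midX by (intro sum.cong) auto
  also have "\<dots> = (\<Sum>c\<in>CR. 1 / a (mid c))"
    unfolding CR_def
  proof (rule sum.UNION_disjoint[OF finFL, symmetric])
    show "\<forall>L\<in>FL. finite (?X L)" using finX by (auto simp: FL_def)
    show "\<forall>L\<in>FL. \<forall>L'\<in>FL. L \<noteq> L' \<longrightarrow> ?X L \<inter> ?X L' = {}" using midX by blast
  qed
  \<comment> \<open>Each weight is multiplied by the inner sum over frames, which equals one, so
    that the order of summation can be exchanged.\<close>
  also have "\<dots> = (\<Sum>c\<in>CR. \<Sum>f\<in>{f \<in> FR. compat f c}. 1 / a (mid c) * (1 / w (cor f)))"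
    unfolding sum_distrib_left[symmetric] using cf by (intro sum.cong) simp_all
  also have "\<dots> = (\<Sum>f\<in>FR. \<Sum>c\<in>{c \<in> CR. compat f c}. 1 / a (mid c) * (1 / w (cor f)))"
    by (rule sum.swap_restrict[OF finCR finFR])
  also have "\<dots> = (\<Sum>f\<in>FR. ee (cor f) / w (cor f))"
    unfolding sum_distrib_right[symmetric] using fc by (intro sum.cong) simp_all
  also have "\<dots> = (\<Sum>Q\<in>FQ. \<Sum>f\<in>?F Q. ee (cor f) / w (cor f))"
    unfolding FR_def
  proof (rule sum.UNION_disjoint[OF finFQ])
    show "\<forall>Q\<in>FQ. finite (?F Q)" using finF unfolding FQ_def by blast
    show "\<forall>Q\<in>FQ. \<forall>Q'\<in>FQ. Q \<noteq> Q' \<longrightarrow> ?F Q \<inter> ?F Q' = {}" using corF by blast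
  qed
  also have "\<dots> = (\<Sum>Q\<in>FQ. ee Q * real (card (?F Q)) / w Q)"
    using corF by (intro sum.cong) auto
  also have "\<dots> = (\<Sum>(A, A', B, B')\<in>FQ. real (card (exts A B' // ext_rel A B')) / real (card (hom A
      B')) *
        real (card (frames M N M' N' (A, A', B, B'))) / (a A * a A' * a B * a B'))"
    by (intro sum.cong) (auto simp: ee_def w_def)
  finally show "(\<Sum>L\<in>FL. real (card (crosses M N M' N' L)) / a L) =
     (\<Sum>(A, A', B, B')\<in>FQ. real (card (exts A B' // ext_rel A B')) / real (card (hom A B')) *
        real (card (frames M N M' N' (A, A', B, B'))) / (a A * a A' * a B * a B'))" .
qed

end

section \<open>Tagged morphisms\<close>

text \<open>\<open>None\<close> is the single undefined value: every ill-typed composite or sum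
  equals it, and every operation applied to it returns it again.\<close>

type_synonym ('o, 'm) tagged = "('o \<times> 'm \<times> 'o) option"

definition tsrc :: "('o, 'm) tagged \<Rightarrow> 'o" where "tsrc x = fst (the x)"
definition tmor :: "('o, 'm) tagged \<Rightarrow> 'm" where "tmor x = fst (snd (the x))"
definition ttgt :: "('o, 'm) tagged \<Rightarrow> 'o" where "ttgt x = snd (snd (the x))"

definition tarr :: "('o, 'k, 'm) linear_category \<Rightarrow> ('o, 'm) tagged \<Rightarrow> bool" where
  "tarr C x \<longleftrightarrow> x \<noteq> None \<and> tsrc x \<in> Obj C \<and> ttgt x \<in> Obj C \<and> tmor x \<in> carrier (Hom C (tsrc x) (ttgt
      x))"

definition tcomp :: "('o, 'k, 'm) linear_category \<Rightarrow> ('o, 'm) tagged \<Rightarrow> ('o, 'm) tagged \<Rightarrow> ('o, 'm)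
    tagged" where
  "tcomp C g f = (if tarr C g \<and> tarr C f \<and> ttgt f = tsrc g
     then Some (tsrc f, tmor g \<cdot>\<^bsub>C\<^esub> tmor f, ttgt g) else None)"

definition tadd :: "('o, 'k, 'm) linear_category \<Rightarrow> ('o, 'm) tagged \<Rightarrow> ('o, 'm) tagged \<Rightarrow> ('o, 'm)
    tagged" where
  "tadd C f g = (if tarr C f \<and> tarr C g \<and> tsrc f = tsrc g \<and> ttgt f = ttgt g
     then Some (tsrc f, tmor f \<oplus>\<^bsub>Hom C (tsrc f) (ttgt f)\<^esub> tmor g, ttgt f) else None)"

definition tneg :: "('o, 'k, 'm) linear_category \<Rightarrow> ('o, 'm) tagged \<Rightarrow> ('o, 'm) tagged" where
  "tneg C f = (if tarr C f then Some (tsrc f, \<ominus>\<^bsub>Hom C (tsrc f) (ttgt f)\<^esub> tmor f, ttgt f) else None)"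

definition tzer :: "('o, 'k, 'm) linear_category \<Rightarrow> 'o \<Rightarrow> 'o \<Rightarrow> ('o, 'm) tagged" where
  "tzer C X Y = Some (X, \<zero>\<^bsub>Hom C X Y\<^esub>, Y)"

definition tidn :: "('o, 'k, 'm) linear_category \<Rightarrow> 'o \<Rightarrow> ('o, 'm) tagged" where
  "tidn C X = Some (X, ident C X, X)"

lemma tag_simps [simp]: "tsrc (Some (X, f, Y)) = X" "tmor (Some (X, f, Y)) = f" "ttgt (Some (X, f,
    Y)) = Y"
  by (simp_all add: tsrc_def tmor_def ttgt_def)

lemma tarr_Some [simp]:
  "tarr C (Some (X, f, Y)) \<longleftrightarrow> X \<in> Obj C \<and> Y \<in> Obj C \<and> f \<in> carrier (Hom C X Y)"
  by (simp add: tarr_def)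

lemma tarr_None [simp]: "\<not> tarr C None"
  by (simp add: tarr_def)

lemma tarrE:
  assumes "tarr C x"
  obtains X f Y where "x = Some (X, f, Y)" "X \<in> Obj C" "Y \<in> Obj C" "f \<in> carrier (Hom C X Y)"
  using assms by (cases x) auto

lemma tcomp_Some [simp]: "\<lbrakk>tarr C (Some (Y, g, Z)); tarr C (Some (X, f, Y))\<rbrakk> \<Longrightarrow>
    tcomp C (Some (Y, g, Z)) (Some (X, f, Y)) = Some (X, g \<cdot>\<^bsub>C\<^esub> f, Z)"
  by (simp add: tcomp_def)

lemma tadd_Some [simp]: "\<lbrakk>tarr C (Some (X, f, Y)); tarr C (Some (X, g, Y))\<rbrakk> \<Longrightarrow>
    tadd C (Some (X, f, Y)) (Some (X, g, Y)) = Some (X, f \<oplus>\<^bsub>Hom C X Y\<^esub> g, Y)"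
  by (simp add: tadd_def)

lemma tneg_Some [simp]: "tarr C (Some (X, f, Y)) \<Longrightarrow> tneg C (Some (X, f, Y)) = Some (X, \<ominus>\<^bsub>Hom C X Y\<^esub>
    f, Y)"
  by (simp add: tneg_def)

section \<open>The tagged morphisms form a preadditive category\<close>

context linear_category
begin

lemma hom_group: "\<lbrakk>X \<in> Obj C; Y \<in> Obj C\<rbrakk> \<Longrightarrow> abelian_group (Hom C X Y)"
  using hom_module by (simp add: Module.module_def)

lemma add_closed: "\<lbrakk>X \<in> Obj C; Y \<in> Obj C; f \<in> carrier (Hom C X Y); g \<in> carrier (Hom C X Y)\<rbrakk>
    \<Longrightarrow> f \<oplus>\<^bsub>Hom C X Y\<^esub> g \<in> carrier (Hom C X Y)"
  by (rule abelian_monoid.a_closed[OF abelian_group.axioms(1)[OF hom_group]])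

lemma zero_closed: "\<lbrakk>X \<in> Obj C; Y \<in> Obj C\<rbrakk> \<Longrightarrow> \<zero>\<^bsub>Hom C X Y\<^esub> \<in> carrier (Hom C X Y)"
  by (rule abelian_monoid.zero_closed[OF abelian_group.axioms(1)[OF hom_group]])

lemma neg_closed: "\<lbrakk>X \<in> Obj C; Y \<in> Obj C; f \<in> carrier (Hom C X Y)\<rbrakk> \<Longrightarrow> \<ominus>\<^bsub>Hom C X Y\<^esub> f \<in> carrier (Hom
    C X Y)"
  by (rule abelian_group.a_inv_closed[OF hom_group])

lemma comp_zero_right: "\<lbrakk>X \<in> Obj C; Y \<in> Obj C; Z \<in> Obj C; h \<in> carrier (Hom C Y Z)\<rbrakk>
    \<Longrightarrow> h \<cdot>\<^bsub>C\<^esub> \<zero>\<^bsub>Hom C X Y\<^esub> = \<zero>\<^bsub>Hom C X Z\<^esub>"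
proof -
  assume a: "X \<in> Obj C" "Y \<in> Obj C" "Z \<in> Obj C" "h \<in> carrier (Hom C Y Z)"
  interpret XY: abelian_group "Hom C X Y" using a hom_group by simp
  interpret XZ: abelian_group "Hom C X Z" using a hom_group by simp
  let ?z = "h \<cdot>\<^bsub>C\<^esub> \<zero>\<^bsub>Hom C X Y\<^esub>"
  have c: "?z \<in> carrier (Hom C X Z)" using comp_closed[OF a(1-3) zero_closed[OF a(1,2)] a(4)] .
  have "?z \<oplus>\<^bsub>Hom C X Z\<^esub> ?z = ?z"
    using comp_add_right[OF a(1-3) zero_closed[OF a(1,2)] zero_closed[OF a(1,2)] a(4)] by simp
  then show ?thesis using c XZ.add.r_cancel_one by blast
qed

lemma comp_zero_left: "\<lbrakk>X \<in> Obj C; Y \<in> Obj C; Z \<in> Obj C; h \<in> carrier (Hom C X Y)\<rbrakk>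
    \<Longrightarrow> \<zero>\<^bsub>Hom C Y Z\<^esub> \<cdot>\<^bsub>C\<^esub> h = \<zero>\<^bsub>Hom C X Z\<^esub>"
proof -
  assume a: "X \<in> Obj C" "Y \<in> Obj C" "Z \<in> Obj C" "h \<in> carrier (Hom C X Y)"
  interpret YZ: abelian_group "Hom C Y Z" using a hom_group by simp
  interpret XZ: abelian_group "Hom C X Z" using a hom_group by simp
  let ?z = "\<zero>\<^bsub>Hom C Y Z\<^esub> \<cdot>\<^bsub>C\<^esub> h"
  have c: "?z \<in> carrier (Hom C X Z)" using comp_closed[OF a(1-3) a(4) zero_closed[OF a(2,3)]] .
  have "?z \<oplus>\<^bsub>Hom C X Z\<^esub> ?z = ?z"
    using comp_add_left[OF a(1-3) a(4) zero_closed[OF a(2,3)] zero_closed[OF a(2,3)]] by simp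
  then show ?thesis using c XZ.add.r_cancel_one by blast
qed

lemma comp_neg_right: "\<lbrakk>X \<in> Obj C; Y \<in> Obj C; Z \<in> Obj C; f \<in> carrier (Hom C X Y); h \<in> carrier (Hom
    C Y Z)\<rbrakk>
    \<Longrightarrow> h \<cdot>\<^bsub>C\<^esub> (\<ominus>\<^bsub>Hom C X Y\<^esub> f) = \<ominus>\<^bsub>Hom C X Z\<^esub> (h \<cdot>\<^bsub>C\<^esub> f)"
proof -
  assume a: "X \<in> Obj C" "Y \<in> Obj C" "Z \<in> Obj C" "f \<in> carrier (Hom C X Y)" "h \<in> carrier (Hom C Y Z)"
  interpret XY: abelian_group "Hom C X Y" using a hom_group by simp
  interpret XZ: abelian_group "Hom C X Z" using a hom_group by simp
  have n: "\<ominus>\<^bsub>Hom C X Y\<^esub> f \<in> carrier (Hom C X Y)" using a by simp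
  have "h \<cdot>\<^bsub>C\<^esub> (\<ominus>\<^bsub>Hom C X Y\<^esub> f) \<oplus>\<^bsub>Hom C X Z\<^esub> h \<cdot>\<^bsub>C\<^esub> f = \<zero>\<^bsub>Hom C X Z\<^esub>"
    using comp_add_right[OF a(1-3) n a(4,5)] a comp_zero_right XY.l_neg by simp
  then show ?thesis
    using XZ.minus_equality[of "h \<cdot>\<^bsub>C\<^esub> (\<ominus>\<^bsub>Hom C X Y\<^esub> f)" "h \<cdot>\<^bsub>C\<^esub> f"] comp_closed[OF a(1-3) n a(5)]
        comp_closed[OF a] by simp
qed

lemma comp_neg_left: "\<lbrakk>X \<in> Obj C; Y \<in> Obj C; Z \<in> Obj C; f \<in> carrier (Hom C X Y); h \<in> carrier (Hom
    C Y Z)\<rbrakk>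
    \<Longrightarrow> (\<ominus>\<^bsub>Hom C Y Z\<^esub> h) \<cdot>\<^bsub>C\<^esub> f = \<ominus>\<^bsub>Hom C X Z\<^esub> (h \<cdot>\<^bsub>C\<^esub> f)"
proof -
  assume a: "X \<in> Obj C" "Y \<in> Obj C" "Z \<in> Obj C" "f \<in> carrier (Hom C X Y)" "h \<in> carrier (Hom C Y Z)"
  interpret YZ: abelian_group "Hom C Y Z" using a hom_group by simp
  interpret XZ: abelian_group "Hom C X Z" using a hom_group by simp
  have n: "\<ominus>\<^bsub>Hom C Y Z\<^esub> h \<in> carrier (Hom C Y Z)" using a by simp
  have "(\<ominus>\<^bsub>Hom C Y Z\<^esub> h) \<cdot>\<^bsub>C\<^esub> f \<oplus>\<^bsub>Hom C X Z\<^esub> h \<cdot>\<^bsub>C\<^esub> f = \<zero>\<^bsub>Hom C X Z\<^esub>"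
    using comp_add_left[OF a(1-3) a(4) n a(5)] a comp_zero_left YZ.l_neg by simp
  then show ?thesis
    using XZ.minus_equality[of "(\<ominus>\<^bsub>Hom C Y Z\<^esub> h) \<cdot>\<^bsub>C\<^esub> f" "h \<cdot>\<^bsub>C\<^esub> f"] comp_closed[OF a(1-3) a(4) n]
        comp_closed[OF a] by simp
qed

lemma tarr_tcomp: "tarr C (tcomp C g f) \<longleftrightarrow> tarr C g \<and> tarr C f \<and> ttgt f = tsrc g"
  by (auto simp: tcomp_def comp_closed elim!: tarrE)

lemma tarr_tadd: "tarr C (tadd C f g) \<longleftrightarrow> tarr C f \<and> tarr C g \<and> tsrc f = tsrc g \<and> ttgt f = ttgt g"
  by (auto simp: tadd_def add_closed elim!: tarrE)

lemma tadd_arrD: "tarr C (tadd C f g) \<Longrightarrow> tarr C f \<and> tarr C g \<and> tsrc f = tsrc g \<and> ttgt f = ttgt g \<and>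
    tsrc (tadd C f g) = tsrc g \<and> ttgt (tadd C f g) = ttgt g"
  unfolding tarr_tadd by (simp add: tadd_def)

lemma tcomp_arrD: "tarr C (tcomp C g f) \<Longrightarrow> tarr C f \<and> tarr C g \<and> ttgt f = tsrc g \<and>
    tsrc (tcomp C g f) = tsrc f \<and> ttgt (tcomp C g f) = ttgt g"
  unfolding tarr_tcomp by (simp add: tcomp_def)

lemma tarr_tneg: "tarr C (tneg C f) \<longleftrightarrow> tarr C f"
  by (auto simp: tneg_def neg_closed elim!: tarrE)

lemma tneg_arrD: "tarr C (tneg C f) \<Longrightarrow> tarr C f \<and> tsrc (tneg C f) = tsrc f \<and> ttgt (tneg C f) = ttgt
    f"
  unfolding tarr_tneg by (simp add: tneg_def)

text \<open>A result that is not an arrow is \<open>None\<close>. Hence in the ill-typed cases of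
  associativity and distributivity both sides coincide.\<close>

lemma not_tarr_None: "\<not> tarr C (tadd C f g) \<Longrightarrow> tadd C f g = None"
  "\<not> tarr C (tcomp C f g) \<Longrightarrow> tcomp C f g = None" "\<not> tarr C (tneg C f) \<Longrightarrow> tneg C f = None"
  using tarr_tadd[of f g] tarr_tcomp[of f g] tarr_tneg[of f] by (auto simp: tadd_def tcomp_def
      tneg_def)

lemma tagged_preadditive:
  "preadditive (Obj C) (tarr C) tsrc ttgt (tcomp C) (tadd C) (tneg C) (tzer C) (tidn C)"
proof
  fix f g h :: "('o, 'm) tagged"
  show "tarr C f \<Longrightarrow> tsrc f \<in> Obj C" "tarr C f \<Longrightarrow> ttgt f \<in> Obj C" by (auto elim!: tarrE)
  show "tarr C (tcomp C g f) \<longleftrightarrow> tarr C g \<and> tarr C f \<and> ttgt f = tsrc g" by (rule tarr_tcomp)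
  show "tarr C (tadd C f g) \<longleftrightarrow> tarr C f \<and> tarr C g \<and> tsrc f = tsrc g \<and> ttgt f = ttgt g" by (rule
      tarr_tadd)
  show "\<lbrakk>tarr C g; tarr C f; ttgt f = tsrc g\<rbrakk> \<Longrightarrow> tsrc (tcomp C g f) = tsrc f"
    "\<lbrakk>tarr C g; tarr C f; ttgt f = tsrc g\<rbrakk> \<Longrightarrow> ttgt (tcomp C g f) = ttgt g" by (simp_all add:
        tcomp_def)
  show "\<lbrakk>tarr C f; tarr C g; tsrc f = tsrc g; ttgt f = ttgt g\<rbrakk> \<Longrightarrow> tsrc (tadd C f g) = tsrc g"
    "\<lbrakk>tarr C f; tarr C g; tsrc f = tsrc g; ttgt f = ttgt g\<rbrakk> \<Longrightarrow> ttgt (tadd C f g) = ttgt g" by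
        (simp_all add: tadd_def)
  show "tcomp C (tcomp C h g) f = tcomp C h (tcomp C g f)"
  proof (cases "tarr C h \<and> tarr C g \<and> tarr C f \<and> ttgt f = tsrc g \<and> ttgt g = tsrc h")
    case True then show ?thesis by (auto simp: comp_closed comp_assoc elim!: tarrE)
  next
    case False then show ?thesis using tcomp_arrD not_tarr_None(2) by metis
  qed
  show "tadd C (tadd C f g) h = tadd C f (tadd C g h)"
  proof (cases "tarr C f \<and> tarr C g \<and> tarr C h \<and> tsrc f = tsrc g \<and> tsrc g = tsrc h \<and> ttgt f = ttgt
      g \<and> ttgt g = ttgt h")
    case True then show ?thesis
      by (auto simp: add_closed abelian_monoid.a_assoc[OF abelian_group.axioms(1)[OF hom_group]]
          elim!: tarrE)
  next
    case False then show ?thesis using tadd_arrD not_tarr_None(1) by metis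
  qed
  show "tadd C f g = tadd C g f"
  proof (cases "tarr C f \<and> tarr C g \<and> tsrc f = tsrc g \<and> ttgt f = ttgt g")
    case True then show ?thesis
      by (auto simp: abelian_monoid.a_comm[OF abelian_group.axioms(1)[OF hom_group]] elim!: tarrE)
  next
    case False then show ?thesis using tadd_arrD not_tarr_None(1) by metis
  qed
  show "tarr C (tneg C f) \<longleftrightarrow> tarr C f" by (rule tarr_tneg)
  show "tarr C f \<Longrightarrow> tsrc (tneg C f) = tsrc f" "tarr C f \<Longrightarrow> ttgt (tneg C f) = ttgt f"
    by (simp_all add: tneg_def)
  show "tarr C f \<Longrightarrow> tadd C f (tzer C (tsrc f) (ttgt f)) = f"
    by (auto simp: tzer_def zero_closed abelian_monoid.r_zero[OF abelian_group.axioms(1)[OF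
        hom_group]] elim!: tarrE)
  show "tarr C f \<Longrightarrow> tadd C f (tneg C f) = tzer C (tsrc f) (ttgt f)"
    by (auto simp: tzer_def neg_closed abelian_group.r_neg[OF hom_group] elim!: tarrE)
  show "tcomp C h (tadd C f g) = tadd C (tcomp C h f) (tcomp C h g)"
  proof (cases "tarr C h \<and> tarr C g \<and> tarr C f \<and> tsrc f = tsrc g \<and> ttgt g = ttgt f \<and> ttgt f = tsrc
      h")
    case True then show ?thesis by (auto simp: comp_closed add_closed comp_add_right elim!: tarrE)
  next
    case False then show ?thesis using tadd_arrD tcomp_arrD not_tarr_None(1,2) by metis
  qed
  show "tcomp C (tadd C g h) f = tadd C (tcomp C g f) (tcomp C h f)"
  proof (cases "tarr C h \<and> tarr C g \<and> tarr C f \<and> tsrc h = tsrc g \<and> ttgt g = ttgt h \<and> ttgt f = tsrc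
      h")
    case True then show ?thesis by (auto simp: comp_closed add_closed comp_add_left elim!: tarrE)
  next
    case False then show ?thesis using tadd_arrD tcomp_arrD not_tarr_None(1,2) by metis
  qed
  show "tcomp C h (tneg C f) = tneg C (tcomp C h f)"
  proof (cases "tarr C h \<and> tarr C f \<and> ttgt f = tsrc h")
    case True then show ?thesis by (auto simp: comp_closed neg_closed comp_neg_right elim!: tarrE)
  next
    case False then show ?thesis using tneg_arrD tcomp_arrD not_tarr_None(3,2) by metis
  qed
  show "tcomp C (tneg C h) f = tneg C (tcomp C h f)"
  proof (cases "tarr C h \<and> tarr C f \<and> ttgt f = tsrc h")
    case True then show ?thesis by (auto simp: comp_closed neg_closed comp_neg_left elim!: tarrE)
  next
    case False then show ?thesis using tneg_arrD tcomp_arrD not_tarr_None(3,2) by metis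
  qed
next
  fix X Y :: 'o and f :: "('o, 'm) tagged"
  show "\<lbrakk>X \<in> Obj C; Y \<in> Obj C\<rbrakk> \<Longrightarrow> tarr C (tzer C X Y)"
    "\<lbrakk>X \<in> Obj C; Y \<in> Obj C\<rbrakk> \<Longrightarrow> tsrc (tzer C X Y) = X" "\<lbrakk>X \<in> Obj C; Y \<in> Obj C\<rbrakk> \<Longrightarrow> ttgt (tzer C X Y) =
        Y"
    by (simp_all add: tzer_def zero_closed)
  show "X \<in> Obj C \<Longrightarrow> tarr C (tidn C X)" "X \<in> Obj C \<Longrightarrow> tsrc (tidn C X) = X" "X \<in> Obj C \<Longrightarrow> ttgt (tidn C
      X) = X"
    by (simp_all add: tidn_def ident_closed)
  show "\<lbrakk>tarr C f; tsrc f = X\<rbrakk> \<Longrightarrow> tcomp C f (tidn C X) = f"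
    "\<lbrakk>tarr C f; ttgt f = X\<rbrakk> \<Longrightarrow> tcomp C (tidn C X) f = f"
    by (auto simp: tidn_def ident_closed ident_left ident_right elim!: tarrE)
qed

sublocale T: preadditive "Obj C" "tarr C" tsrc ttgt "tcomp C" "tadd C" "tneg C" "tzer C" "tidn C"
  by (rule tagged_preadditive)

lemma isz_tag: "T.isz (Some (X, f, Y)) \<longleftrightarrow> X \<in> Obj C \<and> Y \<in> Obj C \<and> f = \<zero>\<^bsub>Hom C X Y\<^esub>"
  unfolding T.isz_def by (auto simp: tzer_def zero_closed)

text \<open>A tagged test morphism carries its source with it. This splits the single quantifier in
  \<open>ker\<close> into the quantifiers over objects and Hom-sets in
  \<open>is_kernel\<close>.\<close>

lemma isz_comp_tag:
  assumes "X \<in> Obj C" "Y \<in> Obj C" "f \<in> carrier (Hom C X Y)"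
  shows "T.isz (tcomp C (Some (X, f, Y)) u) \<longleftrightarrow>
    (\<exists>W u'. u = Some (W, u', X) \<and> W \<in> Obj C \<and> u' \<in> carrier (Hom C W X) \<and> f \<cdot>\<^bsub>C\<^esub> u' = \<zero>\<^bsub>Hom C W Y\<^esub>)"
proof
  assume z: "T.isz (tcomp C (Some (X, f, Y)) u)"
  from T.isz_arr[OF z] obtain W u' where "u = Some (W, u', X)" "W \<in> Obj C" "u' \<in> carrier (Hom C W
      X)"
    by (auto elim!: tarrE)
  then show "\<exists>W u'. u = Some (W, u', X) \<and> W \<in> Obj C \<and> u' \<in> carrier (Hom C W X) \<and> f \<cdot>\<^bsub>C\<^esub> u' = \<zero>\<^bsub>Hom
      C W Y\<^esub>"
    using z assms by (auto simp: isz_tag)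
qed (use assms in \<open>auto simp: isz_tag\<close>)

lemma isz_comp_tag':
  assumes "X \<in> Obj C" "Y \<in> Obj C" "f \<in> carrier (Hom C X Y)"
  shows "T.isz (tcomp C u (Some (X, f, Y))) \<longleftrightarrow>
    (\<exists>W u'. u = Some (Y, u', W) \<and> W \<in> Obj C \<and> u' \<in> carrier (Hom C Y W) \<and> u' \<cdot>\<^bsub>C\<^esub> f = \<zero>\<^bsub>Hom C X W\<^esub>)"
proof
  assume z: "T.isz (tcomp C u (Some (X, f, Y)))"
  from T.isz_arr[OF z] obtain W u' where "u = Some (Y, u', W)" "W \<in> Obj C" "u' \<in> carrier (Hom C Y
      W)"
    by (auto elim!: tarrE)
  then show "\<exists>W u'. u = Some (Y, u', W) \<and> W \<in> Obj C \<and> u' \<in> carrier (Hom C Y W) \<and> u' \<cdot>\<^bsub>C\<^esub> f = \<zero>\<^bsub>Hom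
      C X W\<^esub>"
    using z assms by (auto simp: isz_tag)
qed (use assms in \<open>auto simp: isz_tag\<close>)

lemma tcomp_eq_Some:
  assumes "X \<in> Obj C" "Y \<in> Obj C" "f \<in> carrier (Hom C X Y)" "u' \<in> carrier (Hom C W Y)" "W \<in> Obj C"
  shows "tcomp C (Some (X, f, Y)) v = Some (W, u', Y) \<longleftrightarrow>
    (\<exists>v'. v = Some (W, v', X) \<and> v' \<in> carrier (Hom C W X) \<and> f \<cdot>\<^bsub>C\<^esub> v' = u')"
proof
  assume e: "tcomp C (Some (X, f, Y)) v = Some (W, u', Y)"
  then have "tarr C (tcomp C (Some (X, f, Y)) v)" using assms by simp
  then obtain V v' where "v = Some (V, v', X)" "V \<in> Obj C" "v' \<in> carrier (Hom C V X)" by (auto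
      elim!: tarrE)
  then show "\<exists>v'. v = Some (W, v', X) \<and> v' \<in> carrier (Hom C W X) \<and> f \<cdot>\<^bsub>C\<^esub> v' = u'" using e assms
      by auto
qed (use assms in auto)

lemma tcomp_eq_Some':
  assumes "X \<in> Obj C" "Y \<in> Obj C" "f \<in> carrier (Hom C X Y)" "u' \<in> carrier (Hom C X W)" "W \<in> Obj C"
  shows "tcomp C v (Some (X, f, Y)) = Some (X, u', W) \<longleftrightarrow>
    (\<exists>v'. v = Some (Y, v', W) \<and> v' \<in> carrier (Hom C Y W) \<and> v' \<cdot>\<^bsub>C\<^esub> f = u')"
proof
  assume e: "tcomp C v (Some (X, f, Y)) = Some (X, u', W)"
  then have "tarr C (tcomp C v (Some (X, f, Y)))" using assms by simp
  then obtain V v' where "v = Some (Y, v', V)" "V \<in> Obj C" "v' \<in> carrier (Hom C Y V)" by (auto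
      elim!: tarrE)
  then show "\<exists>v'. v = Some (Y, v', W) \<and> v' \<in> carrier (Hom C Y W) \<and> v' \<cdot>\<^bsub>C\<^esub> f = u'" using e assms
      by auto
qed (use assms in auto)

lemma ex1_tag: "(\<exists>!v. \<exists>v'. v = Some (W, v', X) \<and> P v') \<longleftrightarrow> (\<exists>!v'. P v')"
  by (auto; metis)

lemma all_tag:
  "(\<forall>u. (\<exists>W u'. u = Some (W, u', X) \<and> W \<in> Ws \<and> u' \<in> H W \<and> E W u') \<longrightarrow> Q u) \<longleftrightarrow>
   (\<forall>W\<in>Ws. \<forall>u'\<in>H W. E W u' \<longrightarrow> Q (Some (W, u', X)))"
  "(\<forall>u. (\<exists>W u'. u = Some (X, u', W) \<and> W \<in> Ws \<and> u' \<in> H W \<and> E W u') \<longrightarrow> Q u) \<longleftrightarrow>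
   (\<forall>W\<in>Ws. \<forall>u'\<in>H W. E W u' \<longrightarrow> Q (Some (X, u', W)))"
  by blast+

lemma ker_tag:
  assumes "X \<in> Obj C" "Y \<in> Obj C" "f \<in> carrier (Hom C X Y)"
  shows "T.ker x (Some (X, f, Y)) \<longleftrightarrow> (\<exists>N n. x = Some (N, n, X) \<and> is_kernel C X Y f N n)"
proof -
  have *: "T.ker (Some (N, n, X)) (Some (X, f, Y)) \<longleftrightarrow> is_kernel C X Y f N n"
    if n: "N \<in> Obj C" "n \<in> carrier (Hom C N X)" for N n
  proof -
    have "(\<forall>u. T.isz (tcomp C (Some (X, f, Y)) u) \<longrightarrow> (\<exists>!v. tcomp C (Some (N, n, X)) v = u)) \<longleftrightarrow>
      (\<forall>W\<in>Obj C. \<forall>u\<in>carrier (Hom C W X). f \<cdot>\<^bsub>C\<^esub> u = \<zero>\<^bsub>Hom C W Y\<^esub> \<longrightarrow>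
        (\<exists>!v. tcomp C (Some (N, n, X)) v = Some (W, u, X)))"
      unfolding isz_comp_tag[OF assms] by (rule all_tag(1))
    also have "\<dots> \<longleftrightarrow> (\<forall>W\<in>Obj C. \<forall>u\<in>carrier (Hom C W X). f \<cdot>\<^bsub>C\<^esub> u = \<zero>\<^bsub>Hom C W Y\<^esub> \<longrightarrow>
        (\<exists>!v. v \<in> carrier (Hom C W N) \<and> n \<cdot>\<^bsub>C\<^esub> v = u))"
      by (intro ball_cong refl imp_cong) (simp only: tcomp_eq_Some[OF n(1) assms(1) n(2)] ex1_tag)
    finally show ?thesis
      unfolding T.ker_def is_kernel_def using n assms by (simp add: isz_tag)
  qed
  show ?thesis
  proof
    assume k: "T.ker x (Some (X, f, Y))"
    have "tarr C (tcomp C (Some (X, f, Y)) x)" using T.isz_arr[OF T.ker_isz[OF k]] .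
    then obtain N n where n: "x = Some (N, n, X)" "N \<in> Obj C" "n \<in> carrier (Hom C N X)" by (auto
        elim!: tarrE)
    then show "\<exists>N n. x = Some (N, n, X) \<and> is_kernel C X Y f N n" using k * by blast
  next
    assume "\<exists>N n. x = Some (N, n, X) \<and> is_kernel C X Y f N n"
    then obtain N n where n: "x = Some (N, n, X)" "is_kernel C X Y f N n" by blast
    then have "N \<in> Obj C" "n \<in> carrier (Hom C N X)" by (auto simp: is_kernel_def)
    then show "T.ker x (Some (X, f, Y))" using n * by blast
  qed
qed

lemma cok_tag:
  assumes "X \<in> Obj C" "Y \<in> Obj C" "f \<in> carrier (Hom C X Y)"
  shows "T.cok x (Some (X, f, Y)) \<longleftrightarrow> (\<exists>Q q. x = Some (Y, q, Q) \<and> is_cokernel C X Y f Q q)"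
proof -
  have *: "T.cok (Some (Y, n, N)) (Some (X, f, Y)) \<longleftrightarrow> is_cokernel C X Y f N n"
    if n: "N \<in> Obj C" "n \<in> carrier (Hom C Y N)" for N n
  proof -
    have "(\<forall>u. T.isz (tcomp C u (Some (X, f, Y))) \<longrightarrow> (\<exists>!v. tcomp C v (Some (Y, n, N)) = u)) \<longleftrightarrow>
      (\<forall>W\<in>Obj C. \<forall>u\<in>carrier (Hom C Y W). u \<cdot>\<^bsub>C\<^esub> f = \<zero>\<^bsub>Hom C X W\<^esub> \<longrightarrow>
        (\<exists>!v. tcomp C v (Some (Y, n, N)) = Some (Y, u, W)))"
      unfolding isz_comp_tag'[OF assms] by (rule all_tag(2))
    also have "\<dots> \<longleftrightarrow> (\<forall>W\<in>Obj C. \<forall>u\<in>carrier (Hom C Y W). u \<cdot>\<^bsub>C\<^esub> f = \<zero>\<^bsub>Hom C X W\<^esub> \<longrightarrow>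
        (\<exists>!v. v \<in> carrier (Hom C N W) \<and> v \<cdot>\<^bsub>C\<^esub> n = u))"
      by (intro ball_cong refl imp_cong) (simp only: tcomp_eq_Some'[OF assms(2) n] ex1_tag)
    finally show ?thesis
      unfolding T.cok_def is_cokernel_def using n assms by (simp add: isz_tag)
  qed
  show ?thesis
  proof
    assume k: "T.cok x (Some (X, f, Y))"
    have "tarr C (tcomp C x (Some (X, f, Y)))" using T.isz_arr[OF T.cok_isz[OF k]] .
    then obtain N n where n: "x = Some (Y, n, N)" "N \<in> Obj C" "n \<in> carrier (Hom C Y N)" by (auto
        elim!: tarrE)
    then show "\<exists>N n. x = Some (Y, n, N) \<and> is_cokernel C X Y f N n" using k * by blast
  next
    assume "\<exists>N n. x = Some (Y, n, N) \<and> is_cokernel C X Y f N n"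
    then obtain N n where n: "x = Some (Y, n, N)" "is_cokernel C X Y f N n" by blast
    then have "N \<in> Obj C" "n \<in> carrier (Hom C Y N)" by (auto simp: is_cokernel_def)
    then show "T.cok x (Some (X, f, Y))" using n * by blast
  qed
qed

lemma mono_tag: "T.mono (Some (X, f, Y)) \<Longrightarrow> X \<in> Obj C \<and> Y \<in> Obj C \<and> is_mono C X Y f"
proof -
  assume m: "T.mono (Some (X, f, Y))"
  then have a: "X \<in> Obj C" "Y \<in> Obj C" "f \<in> carrier (Hom C X Y)" using T.mono_arr by fastforce+
  have "u = v" if "W \<in> Obj C" "u \<in> carrier (Hom C W X)" "v \<in> carrier (Hom C W X)" "f \<cdot>\<^bsub>C\<^esub> u = f
      \<cdot>\<^bsub>C\<^esub> v" for W u v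
    using T.monoD[OF m, of "Some (W, u, X)" "Some (W, v, X)"] that a comp_closed[of W X Y v f] by
        simp
  then show ?thesis using a by (simp add: is_mono_def)
qed

lemma epi_tag: "T.epi (Some (X, f, Y)) \<Longrightarrow> X \<in> Obj C \<and> Y \<in> Obj C \<and> is_epi C X Y f"
proof -
  assume m: "T.epi (Some (X, f, Y))"
  then have a: "X \<in> Obj C" "Y \<in> Obj C" "f \<in> carrier (Hom C X Y)" using T.epi_arr by fastforce+
  have "u = v" if "W \<in> Obj C" "u \<in> carrier (Hom C Y W)" "v \<in> carrier (Hom C Y W)" "u \<cdot>\<^bsub>C\<^esub> f = v
      \<cdot>\<^bsub>C\<^esub> f" for W u v
    using T.epiD[OF m, of "Some (Y, u, W)" "Some (Y, v, W)"] that a comp_closed[of X Y W f v] by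
        simp
  then show ?thesis using a by (simp add: is_epi_def)
qed

end

context abelian_linear_category
begin

lemma tagged_abelian:
  "abelian_cat (Obj C) (tarr C) tsrc ttgt (tcomp C) (tadd C) (tneg C) (tzer C) (tidn C)"
proof
  fix X Y assume XY: "X \<in> Obj C" "Y \<in> Obj C"
  from biproducts[OF XY] obtain P i1 i2 p1 p2 where b: "is_biproduct C X Y P i1 i2 p1 p2" by blast
  then show "\<exists>i1 i2 p1 p2. tcomp C p1 i1 = tidn C X \<and> tcomp C p2 i2 = tidn C Y \<and> T.isz (tcomp C p1
      i2) \<and>
       T.isz (tcomp C p2 i1) \<and> tadd C (tcomp C i1 p1) (tcomp C i2 p2) = tidn C (tsrc p1)"
    using XY unfolding is_biproduct_def
    by (intro exI[of _ "Some (X, i1, P)"] exI[of _ "Some (Y, i2, P)"] exI[of _ "Some (P, p1, X)"]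
        exI[of _ "Some (P, p2, Y)"])
      (simp add: tidn_def isz_tag comp_closed)
next
  fix f
  assume "tarr C f"
  then obtain X g Y where f: "f = Some (X, g, Y)" "X \<in> Obj C" "Y \<in> Obj C" "g \<in> carrier (Hom C X
      Y)" by (rule tarrE)
  show "\<exists>k. T.ker k f" using kernels[OF f(2-4)] ker_tag[OF f(2-4)] f(1) by blast
  show "\<exists>k. T.cok k f" using cokernels[OF f(2-4)] cok_tag[OF f(2-4)] f(1) by blast
next
  fix f
  assume m: "T.mono f"
  obtain X g Y where f: "f = Some (X, g, Y)" by (rule tarrE[OF T.mono_arr[OF m]])
  have a: "X \<in> Obj C" "Y \<in> Obj C" "is_mono C X Y g" using mono_tag m f by auto
  obtain Z h where Z: "Z \<in> Obj C" "is_kernel C Y Z h X g" using mono_is_kernel[OF a] by blast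
  then have "h \<in> carrier (Hom C Y Z)" by (simp add: is_kernel_def)
  then show "\<exists>g. T.ker f g" using ker_tag[OF a(2) Z(1)] Z(2) f by blast
next
  fix f
  assume m: "T.epi f"
  obtain X g Y where f: "f = Some (X, g, Y)" by (rule tarrE[OF T.epi_arr[OF m]])
  have a: "X \<in> Obj C" "Y \<in> Obj C" "is_epi C X Y g" using epi_tag m f by auto
  obtain Z h where Z: "Z \<in> Obj C" "is_cokernel C Z X h Y g" using epi_is_cokernel[OF a] by blast
  then have "h \<in> carrier (Hom C Z X)" by (simp add: is_cokernel_def)
  then show "\<exists>g. T.cok f g" using cok_tag[OF Z(1) a(1)] Z(2) f by blast
qed

sublocale T: abelian_cat "Obj C" "tarr C" tsrc ttgt "tcomp C" "tadd C" "tneg C" "tzer C" "tidn C"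
  by (rule tagged_abelian)

end

section \<open>Exact sequences and extensions\<close>

context abelian_cat
begin

definition exact :: "'b \<Rightarrow> 'b \<Rightarrow> bool" where
  "exact f g \<longleftrightarrow> (\<exists>i q. cok q f \<and> ker i q \<and> ker i g)"

text \<open>The identity factors through the cokernel of a zero map, so that cokernel is mono and
  its kernel, the image, is zero. Exactness says that this zero is also the kernel of
  \<open>f\<close>.\<close>

lemma exact_zero_left:
  assumes z: "isz z" "tgt z = src f" and f: "arr f"
  shows "exact z f \<longleftrightarrow> mono f"
proof
  have O: "src f \<in> Ob" using f by simp
  assume "exact z f"
  then obtain i q where iq: "cok q z" "ker i q" "ker i f" by (auto simp: exact_def)
  have "isz (idn (src f) \<star> z)" using z isz_arr[OF z(1)] by (simp add: idn_comp)
  then obtain v where v: "v \<star> q = idn (src f)" using cok_lift[OF iq(1)] by blast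
  have mq: "mono q" by (rule mono_comp_right[of v]) (simp add: v mono_idn O)
  have i: "isz i" by (rule mono_isz[OF mq ker_isz[OF iq(2)]])
  show "mono f" unfolding mono_def
  proof (intro conjI allI impI f)
    fix u assume u: "isz (f \<star> u)"
    obtain w where w: "i \<star> w = u" using ker_lift[OF iq(3) u] by blast
    have "arr u" using isz_arr[OF u] by simp
    then show "isz u" using isz_comp_left[OF i, of w] w by simp
  qed
next
  have O: "src f \<in> Ob" using f by simp
  assume m: "mono f"
  obtain i where i: "ker i f" using ker_ex f by blast
  have iz: "isz i" by (rule mono_isz[OF m ker_isz[OF i]])
  have ti: "arr i" "tgt i = src f" using isz_arr[OF ker_isz[OF i]] by auto
  have "cok (idn (src f)) z"
  proof (rule cokI)
    show "epi (idn (src f))" by (rule epi_idn[OF O])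
    show "isz (idn (src f) \<star> z)" using z isz_arr[OF z(1)] by (simp add: idn_comp)
    fix u assume "isz (u \<star> z)"
    from isz_arr[OF this] show "\<exists>v. v \<star> idn (src f) = u" using z by (intro exI[of _ u]) (simp add:
        comp_idn)
  qed
  moreover have "ker i (idn (src f))"
  proof (rule kerI[OF ker_mono[OF i]])
    show "isz (idn (src f) \<star> i)" using iz ti by (simp add: idn_comp)
    fix u assume u: "isz (idn (src f) \<star> u)"
    have au: "arr u" "tgt u = src f" using isz_arr[OF u] O by auto
    have "isz u" using u au by (simp add: idn_comp)
    then have "isz (f \<star> u)" by (rule isz_comp_right) (use au f in simp)
    then show "\<exists>v. i \<star> v = u" by (rule ker_lift[OF i])
  qed
  ultimately show "exact z f" using i by (auto simp: exact_def)
qed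

lemma exact_zero_right:
  assumes z: "isz z" "src z = tgt g" and g: "arr g"
  shows "exact g z \<longleftrightarrow> epi g"
proof
  have O: "tgt g \<in> Ob" using g by simp
  have za: "arr z" using isz_arr[OF z(1)] .
  assume "exact g z"
  then obtain i q where iq: "cok q g" "ker i q" "ker i z" by (auto simp: exact_def)
  have "isz (z \<star> idn (tgt g))" using z za by (simp add: comp_idn)
  then obtain v where v: "i \<star> v = idn (tgt g)" using ker_lift[OF iq(3)] by blast
  have ei: "epi i" by (rule epi_comp_left[of _ v]) (simp add: v epi_idn O)
  have q: "isz q" by (rule epi_isz[OF ei ker_isz[OF iq(2)]])
  show "epi g" unfolding epi_def
  proof (intro conjI allI impI g)
    fix u assume u: "isz (u \<star> g)"
    obtain w where w: "w \<star> q = u" using cok_lift[OF iq(1) u] by blast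
    have "arr u" using isz_arr[OF u] by simp
    then show "isz u" using isz_comp_right[OF q, of w] w by simp
  qed
next
  have O: "tgt g \<in> Ob" using g by simp
  have za: "arr z" using isz_arr[OF z(1)] .
  assume m: "epi g"
  obtain q where q: "cok q g" using cok_ex g by blast
  have qz: "isz q" by (rule epi_isz[OF m cok_isz[OF q]])
  have tq: "arr q" "src q = tgt g" using isz_arr[OF cok_isz[OF q]] by auto
  have "ker (idn (tgt g)) w" if w: "isz w" "src w = tgt g" for w
  proof (rule kerI)
    have wa: "arr w" using isz_arr[OF w(1)] .
    show "mono (idn (tgt g))" by (rule mono_idn[OF O])
    show "isz (w \<star> idn (tgt g))" using w wa by (simp add: comp_idn)
    fix u assume "isz (w \<star> u)"
    from isz_arr[OF this] show "\<exists>v. idn (tgt g) \<star> v = u" using w by (intro exI[of _ u]) (simp add: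
        idn_comp)
  qed
  then show "exact g z" using q qz tq z unfolding exact_def by blast
qed

text \<open>Two kernels of \<open>q\<close> factor through each other. This makes exactness
  independent of the image chosen as its witness.\<close>

lemma ker_replace:
  assumes "ker i q" "ker f q" "ker i g" shows "ker f g"
proof (rule kerI[OF ker_mono[OF assms(2)]])
  obtain v where v: "i \<star> v = f" using ker_lift[OF assms(1) ker_isz[OF assms(2)]] by blast
  have a: "arr f" "arr i" "tgt i = src g" "arr g" "tgt i = src q" "tgt f = src q"
    using isz_arr[OF ker_isz[OF assms(2)]] isz_arr[OF ker_isz[OF assms(3)]] isz_arr[OF ker_isz[OF
        assms(1)]] by auto
  have "arr (i \<star> v)" using a v by simp
  then have "isz ((g \<star> i) \<star> v)" by (intro isz_comp_left[OF ker_isz[OF assms(3)]]) (use a in simp)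
  then show "isz (g \<star> f)" by (simp add: comp_assoc v)
  fix u assume u: "isz (g \<star> u)"
  obtain w where w: "i \<star> w = u" using ker_lift[OF assms(3) u] by blast
  have "arr u" using isz_arr[OF u] by simp
  then have "arr (i \<star> w)" using w by simp
  then have "isz ((q \<star> i) \<star> w)"
    using isz_arr[OF ker_isz[OF assms(1)]] by (intro isz_comp_left[OF ker_isz[OF assms(1)]]) simp
  then have "isz (q \<star> u)" by (simp add: comp_assoc w)
  then show "\<exists>v. f \<star> v = u" by (rule ker_lift[OF assms(2)])
qed

text \<open>A mono is the kernel of its cokernel, hence its own image.\<close>

lemma exact_mono: "mono f \<Longrightarrow> exact f g \<longleftrightarrow> ker f g"
proof
  assume f: "mono f" and "exact f g"
  then obtain i q where iq: "cok q f" "ker i q" "ker i g" by (auto simp: exact_def)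
  show "ker f g" by (rule ker_replace[OF iq(2) mono_cok_ker[OF f iq(1)] iq(3)])
next
  assume f: "mono f" and k: "ker f g"
  obtain q where "cok q f" using cok_ex[OF mono_arr[OF f]] by blast
  then show "exact f g" using k mono_cok_ker[OF f] unfolding exact_def by blast
qed

lemmas cok_replace = abelian_cat.ker_replace[OF dual, unfolded dual_defs]

lemma exact_epi: "epi g \<Longrightarrow> exact f g \<longleftrightarrow> cok g f"
proof
  assume g: "epi g" and "exact f g"
  then obtain i q where iq: "cok q f" "ker i q" "ker i g" by (auto simp: exact_def)
  show "cok g f"
    by (rule cok_replace[OF epi_ker_cok[OF cok_epi[OF iq(1)] iq(2)] epi_ker_cok[OF g iq(3)] iq(1)])
next
  assume g: "epi g" and c: "cok g f"
  obtain i where "ker i g" using ker_ex[OF epi_arr[OF g]] by blast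
  then show "exact f g" using c unfolding exact_def by blast
qed

end

section \<open>From lists of objects and morphisms to pairs and triples of tagged arrows\<close>

lemma exact_sequence_single: "exact_sequence C [X, Y] [f] \<longleftrightarrow> X \<in> Obj C \<and> Y \<in> Obj C \<and> f \<in> carrier
    (Hom C X Y)"
  by (auto simp: exact_sequence_def)

lemma exact_sequence_Cons: "exact_sequence C (X # Y # Z # Xs) (f # g # fs) \<longleftrightarrow>
    X \<in> Obj C \<and> f \<in> carrier (Hom C X Y) \<and> exact_at C X Y Z f g \<and> exact_sequence C (Y # Z # Xs) (g
        # fs)"
proof -
  have 1: "(\<forall>i. i + 1 < Suc n \<longrightarrow> P i) \<longleftrightarrow> (\<forall>i<n. P i)" for n and P :: "nat \<Rightarrow> bool" by auto
  show ?thesis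
    unfolding exact_sequence_def list.size 1 add_Suc_right add_0_right
    unfolding All_less_Suc2 by (auto simp: numeral_2_eq_2)
qed

context abelian_linear_category
begin

lemma exact_at_tag:
  assumes "X \<in> Obj C" "Y \<in> Obj C" "Z \<in> Obj C" "f \<in> carrier (Hom C X Y)" "g \<in> carrier (Hom C Y Z)"
  shows "exact_at C X Y Z f g \<longleftrightarrow> T.exact (Some (X, f, Y)) (Some (Y, g, Z))"
proof -
  have k: "T.ker x (Some (Y, q, Q)) \<longleftrightarrow> (\<exists>N n. x = Some (N, n, Y) \<and> is_kernel C Y Q q N n)"
    if "is_cokernel C X Y f Q q" for x q Q
    using that assms by (intro ker_tag) (auto simp: is_cokernel_def)
  show ?thesis
    unfolding exact_at_def is_image_def T.exact_def cok_tag[OF assms(1,2,4)] ker_tag[OF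
        assms(2,3,5)]
    using k by blast
qed

text \<open>The zero objects at the ends express that the first map is mono and the second epi.
  Exactness in the middle then amounts to the kernel and the cokernel condition.\<close>

lemma hall_pairs_iff:
  "(\<phi>, \<psi>) \<in> hall_pairs C X Z L \<longleftrightarrow> T.ses (Some (Z, \<phi>, L)) (Some (L, \<psi>, X))"
proof
  assume "(\<phi>, \<psi>) \<in> hall_pairs C X Z L"
  then obtain U where U: "is_zero_object C U"
    and e: "exact_sequence C [U, Z, L, X, U] [\<zero>\<^bsub>Hom C U Z\<^esub>, \<phi>, \<psi>, \<zero>\<^bsub>Hom C X U\<^esub>]" by (auto simp:
        hall_pairs_def)
  then have o: "U \<in> Obj C" "Z \<in> Obj C" "L \<in> Obj C" "X \<in> Obj C" "\<phi> \<in> carrier (Hom C Z L)" "\<psi> \<in>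
      carrier (Hom C L X)"
    and x: "exact_at C U Z L \<zero>\<^bsub>Hom C U Z\<^esub> \<phi>" "exact_at C Z L X \<phi> \<psi>" "exact_at C L X U \<psi> \<zero>\<^bsub>Hom C X
        U\<^esub>"
    by (auto simp: exact_sequence_Cons exact_sequence_single)
  have "T.mono (Some (Z, \<phi>, L))"
    using x(1) o zero_closed by (simp add: exact_at_tag T.exact_zero_left isz_tag)
  moreover have "T.epi (Some (L, \<psi>, X))"
    using x(3) o zero_closed by (simp add: exact_at_tag T.exact_zero_right isz_tag)
  moreover have "T.exact (Some (Z, \<phi>, L)) (Some (L, \<psi>, X))" using x(2) o by (simp add: exact_at_tag)
  ultimately show "T.ses (Some (Z, \<phi>, L)) (Some (L, \<psi>, X))"
    by (simp add: T.ses_def T.exact_mono T.exact_epi[symmetric])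
next
  assume s: "T.ses (Some (Z, \<phi>, L)) (Some (L, \<psi>, X))"
  then have o: "Z \<in> Obj C" "L \<in> Obj C" "X \<in> Obj C" "\<phi> \<in> carrier (Hom C Z L)" "\<psi> \<in> carrier (Hom C L
      X)"
    using T.ses_arr[OF s] by simp_all
  obtain U where U: "is_zero_object C U" using zero_object by blast
  then have u: "U \<in> Obj C" by (simp add: is_zero_object_def)
  have "exact_at C U Z L \<zero>\<^bsub>Hom C U Z\<^esub> \<phi>"
    using o u zero_closed T.ses_mono[OF s] by (simp add: exact_at_tag T.exact_zero_left isz_tag)
  moreover have "exact_at C L X U \<psi> \<zero>\<^bsub>Hom C X U\<^esub>"
    using o u zero_closed T.ses_epi[OF s] by (simp add: exact_at_tag T.exact_zero_right isz_tag)
  moreover have "exact_at C Z L X \<phi> \<psi>"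
    using o s T.ses_mono[OF s] by (simp add: exact_at_tag T.exact_mono T.ses_def)
  ultimately have "exact_sequence C [U, Z, L, X, U] [\<zero>\<^bsub>Hom C U Z\<^esub>, \<phi>, \<psi>, \<zero>\<^bsub>Hom C X U\<^esub>]"
    using o u zero_closed by (simp add: exact_sequence_Cons exact_sequence_single)
  then show "(\<phi>, \<psi>) \<in> hall_pairs C X Z L" using U by (auto simp: hall_pairs_def)
qed

lemma extensions_1_iff:
  "(Es, fs) \<in> extensions C 1 X Z \<longleftrightarrow> (\<exists>E f g. Es = [E] \<and> fs = [f, g] \<and> T.ses (Some (Z, f, E)) (Some
      (E, g, X)))"
proof
  assume e: "(Es, fs) \<in> extensions C 1 X Z"
  then obtain U where U: "length Es = 1" "is_zero_object C U"
    "exact_sequence C (U # Z # Es @ [X, U]) (\<zero>\<^bsub>Hom C U Z\<^esub> # fs @ [\<zero>\<^bsub>Hom C X U\<^esub>])" by (auto simp: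
        extensions_def)
  obtain E where E: "Es = [E]" using U(1) by (auto simp: length_Suc_conv)
  have "length fs = 2" using U(3) E by (simp add: exact_sequence_def)
  then obtain f g where fg: "fs = [f, g]" by (auto simp: numeral_2_eq_2 length_Suc_conv)
  have "(f, g) \<in> hall_pairs C X Z E" using U E fg by (auto simp: hall_pairs_def)
  then show "\<exists>E f g. Es = [E] \<and> fs = [f, g] \<and> T.ses (Some (Z, f, E)) (Some (E, g, X))"
    using E fg hall_pairs_iff by blast
next
  assume "\<exists>E f g. Es = [E] \<and> fs = [f, g] \<and> T.ses (Some (Z, f, E)) (Some (E, g, X))"
  then obtain E f g where e: "Es = [E]" "fs = [f, g]" "(f, g) \<in> hall_pairs C X Z E" using
      hall_pairs_iff by blast
  then show "(Es, fs) \<in> extensions C 1 X Z" by (auto simp: hall_pairs_def extensions_def)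
qed

lemma extensions_2_iff:
  "(Es, fs) \<in> extensions C 2 X Z \<longleftrightarrow> (\<exists>S T j \<sigma> p. Es = [S, T] \<and> fs = [j, \<sigma>, p] \<and>
     T.ker (Some (Z, j, S)) (Some (S, \<sigma>, T)) \<and> T.cok (Some (T, p, X)) (Some (S, \<sigma>, T)))"
proof
  assume e: "(Es, fs) \<in> extensions C 2 X Z"
  then obtain U where U: "length Es = 2" "is_zero_object C U"
    "exact_sequence C (U # Z # Es @ [X, U]) (\<zero>\<^bsub>Hom C U Z\<^esub> # fs @ [\<zero>\<^bsub>Hom C X U\<^esub>])" by (auto simp:
        extensions_def)
  obtain S T where E: "Es = [S, T]" using U(1) by (auto simp: numeral_2_eq_2 length_Suc_conv)
  have "length fs = Suc (Suc (Suc 0))" using U(3) E by (simp add: exact_sequence_def)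
  then obtain j \<sigma> p where fs: "fs = [j, \<sigma>, p]" by (auto simp: length_Suc_conv)
  have o: "U \<in> Obj C" "Z \<in> Obj C" "S \<in> Obj C" "T \<in> Obj C" "X \<in> Obj C" "j \<in> carrier (Hom C Z S)"
      "\<sigma> \<in> carrier (Hom C S T)" "p \<in> carrier (Hom C T X)"
    and x: "exact_at C U Z S \<zero>\<^bsub>Hom C U Z\<^esub> j" "exact_at C Z S T j \<sigma>" "exact_at C S T X \<sigma> p"
        "exact_at C T X U p \<zero>\<^bsub>Hom C X U\<^esub>"
    using U(3) unfolding E fs by (auto simp: exact_sequence_Cons exact_sequence_single)
  have "T.mono (Some (Z, j, S))"
    using x(1) o zero_closed by (simp add: exact_at_tag T.exact_zero_left isz_tag)
  moreover have "T.epi (Some (T, p, X))"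
    using x(4) o zero_closed by (simp add: exact_at_tag T.exact_zero_right isz_tag)
  moreover have "T.exact (Some (Z, j, S)) (Some (S, \<sigma>, T))" "T.exact (Some (S, \<sigma>, T)) (Some (T, p,
      X))"
    using x(2,3) o by (simp_all add: exact_at_tag)
  ultimately have "T.ker (Some (Z, j, S)) (Some (S, \<sigma>, T))" "T.cok (Some (T, p, X)) (Some (S, \<sigma>,
      T))"
    by (simp_all add: T.exact_mono T.exact_epi)
  then show "\<exists>S T j \<sigma> p. Es = [S, T] \<and> fs = [j, \<sigma>, p] \<and>
     T.ker (Some (Z, j, S)) (Some (S, \<sigma>, T)) \<and> T.cok (Some (T, p, X)) (Some (S, \<sigma>, T))" using E fs
         by blast
next
  assume "\<exists>S T j \<sigma> p. Es = [S, T] \<and> fs = [j, \<sigma>, p] \<and>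
     T.ker (Some (Z, j, S)) (Some (S, \<sigma>, T)) \<and> T.cok (Some (T, p, X)) (Some (S, \<sigma>, T))"
  then obtain S T j \<sigma> p where e: "Es = [S, T]" "fs = [j, \<sigma>, p]"
    and k: "T.ker (Some (Z, j, S)) (Some (S, \<sigma>, T))" "T.cok (Some (T, p, X)) (Some (S, \<sigma>, T))" by
        blast
  have o: "Z \<in> Obj C" "S \<in> Obj C" "T \<in> Obj C" "X \<in> Obj C" "j \<in> carrier (Hom C Z S)"
      "\<sigma> \<in> carrier (Hom C S T)" "p \<in> carrier (Hom C T X)"
    using T.isz_arr[OF T.ker_isz[OF k(1)]] T.isz_arr[OF T.cok_isz[OF k(2)]] by (auto simp:
        tarr_tcomp)
  obtain U where U: "is_zero_object C U" using zero_object by blast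
  then have u: "U \<in> Obj C" by (simp add: is_zero_object_def)
  have "exact_at C U Z S \<zero>\<^bsub>Hom C U Z\<^esub> j"
    using o u zero_closed T.ker_mono[OF k(1)] by (simp add: exact_at_tag T.exact_zero_left isz_tag)
  moreover have "exact_at C T X U p \<zero>\<^bsub>Hom C X U\<^esub>"
    using o u zero_closed T.cok_epi[OF k(2)] by (simp add: exact_at_tag T.exact_zero_right isz_tag)
  moreover have "exact_at C Z S T j \<sigma>"
    using o k(1) T.ker_mono[OF k(1)] by (simp add: exact_at_tag T.exact_mono)
  moreover have "exact_at C S T X \<sigma> p"
    using o k(2) T.cok_epi[OF k(2)] by (simp add: exact_at_tag T.exact_epi)
  ultimately have "exact_sequence C [U, Z, S, T, X, U] [\<zero>\<^bsub>Hom C U Z\<^esub>, j, \<sigma>, p, \<zero>\<^bsub>Hom C X U\<^esub>]"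
    using o u zero_closed by (simp add: exact_sequence_Cons exact_sequence_single)
  then show "(Es, fs) \<in> extensions C 2 X Z" using U e by (auto simp: extensions_def)
qed

text \<open>The outer two of the three components are identities, so the middle one is the only
  datum. Its source and target can be read off from the first equation.\<close>

lemma extension_morphisms_1_iff:
  "((Es, fs), (Es', fs')) \<in> extension_morphisms C 1 X Z \<longleftrightarrow>
    (\<exists>E i q E' i' q'. Es = [E] \<and> fs = [i, q] \<and> Es' = [E'] \<and> fs' = [i', q'] \<and>
      T.ses (Some (Z, i, E)) (Some (E, q, X)) \<and> T.ses (Some (Z, i', E')) (Some (E', q', X)) \<and>
      (\<exists>h. tcomp C h (Some (Z, i, E)) = Some (Z, i', E') \<and> tcomp C (Some (E', q', X)) h = Some (E,
          q, X)))"
  (is "?l \<longleftrightarrow> ?r")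
proof
  assume l: ?l
  then have x: "(Es, fs) \<in> extensions C 1 X Z" "(Es', fs') \<in> extensions C 1 X Z" by (auto simp:
      extension_morphisms_def)
  obtain E i q where e: "Es = [E]" "fs = [i, q]" "T.ses (Some (Z, i, E)) (Some (E, q, X))"
    using x(1) extensions_1_iff by blast
  obtain E' i' q' where e': "Es' = [E']" "fs' = [i', q']" "T.ses (Some (Z, i', E')) (Some (E', q',
      X))"
    using x(2) extensions_1_iff by blast
  have o: "Z \<in> Obj C" "E \<in> Obj C" "X \<in> Obj C" "i \<in> carrier (Hom C Z E)" "q \<in> carrier (Hom C E X)"
    "E' \<in> Obj C" "i' \<in> carrier (Hom C Z E')" "q' \<in> carrier (Hom C E' X)"
    using T.ses_arr[OF e(3)] T.ses_arr[OF e'(3)] by simp_all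
  obtain hs where hs: "length hs = 3" "hs ! 0 = ident C Z" "hs ! 2 = ident C X"
    and h: "\<forall>i<3. hs ! i \<in> carrier (Hom C ((Z # Es @ [X]) ! i) ((Z # Es' @ [X]) ! i))"
      "\<forall>i<2. hs ! (i + 1) \<cdot>\<^bsub>C\<^esub> fs ! i = fs' ! i \<cdot>\<^bsub>C\<^esub> hs ! i"
    using l by (auto simp: extension_morphisms_def numeral_2_eq_2 numeral_3_eq_3)
  let ?h = "hs ! 1"
  have 1: "?h \<in> carrier (Hom C E E')" using h(1) e e' by (auto dest!: spec[of _ 1])
  have "?h \<cdot>\<^bsub>C\<^esub> i = i' \<cdot>\<^bsub>C\<^esub> ident C Z" using h(2) hs e e' by (auto dest!: spec[of _ 0])
  then have 2: "?h \<cdot>\<^bsub>C\<^esub> i = i'" using ident_right o by simp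
  have "ident C X \<cdot>\<^bsub>C\<^esub> q = q' \<cdot>\<^bsub>C\<^esub> ?h" using h(2) hs e e' by (auto dest!: spec[of _ 1] simp:
      numeral_2_eq_2)
  then have 3: "q' \<cdot>\<^bsub>C\<^esub> ?h = q" using ident_left o by simp
  have "tcomp C (Some (E, ?h, E')) (Some (Z, i, E)) = Some (Z, i', E')"
    "tcomp C (Some (E', q', X)) (Some (E, ?h, E')) = Some (E, q, X)" using 1 2 3 o by simp_all
  then show ?r using e e' by blast
next
  assume ?r
  then obtain E i q E' i' q' h where e: "Es = [E]" "fs = [i, q]" "Es' = [E']" "fs' = [i', q']"
    and s: "T.ses (Some (Z, i, E)) (Some (E, q, X))" "T.ses (Some (Z, i', E')) (Some (E', q', X))"
    and h: "tcomp C h (Some (Z, i, E)) = Some (Z, i', E')" "tcomp C (Some (E', q', X)) h = Some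
        (E, q, X)" by blast
  have o: "Z \<in> Obj C" "E \<in> Obj C" "X \<in> Obj C" "i \<in> carrier (Hom C Z E)" "q \<in> carrier (Hom C E X)"
    "E' \<in> Obj C" "i' \<in> carrier (Hom C Z E')" "q' \<in> carrier (Hom C E' X)"
    using T.ses_arr[OF s(1)] T.ses_arr[OF s(2)] by simp_all
  obtain h' where h': "h = Some (E, h', E')" "h' \<in> carrier (Hom C E E')" "h' \<cdot>\<^bsub>C\<^esub> i = i'"
    using h(1) o by (auto simp: tcomp_eq_Some')
  have h2: "q' \<cdot>\<^bsub>C\<^esub> h' = q" using h(2) h' o by simp
  have "(Es, fs) \<in> extensions C 1 X Z" "(Es', fs') \<in> extensions C 1 X Z" using e s
      extensions_1_iff by blast+
  moreover have "\<exists>hs. length hs = 1 + 2 \<and> hs ! 0 = ident C Z \<and> hs ! (1 + 1) = ident C X \<and>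
        (\<forall>i<1 + 2. hs ! i \<in> carrier (Hom C ((Z # Es @ [X]) ! i) ((Z # Es' @ [X]) ! i))) \<and>
        (\<forall>i<1 + 1. hs ! (i + 1) \<cdot>\<^bsub>C\<^esub> fs ! i = fs' ! i \<cdot>\<^bsub>C\<^esub> hs ! i)"
    using e o h' h2 ident_closed ident_left ident_right
    by (intro exI[of _ "[ident C Z, h', ident C X]"]) (auto simp: less_Suc_eq numeral_2_eq_2)
  ultimately show ?l by (simp add: extension_morphisms_def)
qed

text \<open>Components 0 and 3 are the identities of the ends; \<open>h1\<close> and
  \<open>h2\<close> are components 1 and 2. The result has the shape of the hypotheses of
  \<open>compl_push\<close>.\<close>

lemma extension_morphisms_2D:
  assumes "((Es, fs), (Es', fs')) \<in> extension_morphisms C 2 X Z"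
  shows "\<exists>S T j \<sigma> p S' T' j' \<sigma>' p' h1 h2. Es = [S, T] \<and> fs = [j, \<sigma>, p] \<and> Es' = [S', T'] \<and> fs' =
      [j', \<sigma>', p'] \<and>
     T.ker (Some (Z, j, S)) (Some (S, \<sigma>, T)) \<and> T.cok (Some (T, p, X)) (Some (S, \<sigma>, T)) \<and>
     T.ker (Some (Z, j', S')) (Some (S', \<sigma>', T')) \<and> T.cok (Some (T', p', X)) (Some (S', \<sigma>', T')) \<and>
     tcomp C h1 (Some (Z, j, S)) = Some (Z, j', S') \<and>
     tcomp C h2 (Some (S, \<sigma>, T)) = tcomp C (Some (S', \<sigma>', T')) h1 \<and>
     tcomp C (Some (T', p', X)) h2 = Some (T, p, X)"
proof -
  have x: "(Es, fs) \<in> extensions C 2 X Z" "(Es', fs') \<in> extensions C 2 X Z" using assms by (auto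
      simp: extension_morphisms_def)
  obtain S T j \<sigma> p where e: "Es = [S, T]" "fs = [j, \<sigma>, p]"
     and k: "T.ker (Some (Z, j, S)) (Some (S, \<sigma>, T))" "T.cok (Some (T, p, X)) (Some (S, \<sigma>, T))"
    using x(1) extensions_2_iff by blast
  obtain S' T' j' \<sigma>' p' where e': "Es' = [S', T']" "fs' = [j', \<sigma>', p']"
     and k': "T.ker (Some (Z, j', S')) (Some (S', \<sigma>', T'))" "T.cok (Some (T', p', X)) (Some (S',
         \<sigma>', T'))"
    using x(2) extensions_2_iff by blast
  have o: "Z \<in> Obj C" "S \<in> Obj C" "T \<in> Obj C" "X \<in> Obj C" "j \<in> carrier (Hom C Z S)"
      "\<sigma> \<in> carrier (Hom C S T)" "p \<in> carrier (Hom C T X)"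
    using T.isz_arr[OF T.ker_isz[OF k(1)]] T.isz_arr[OF T.cok_isz[OF k(2)]] by (auto simp:
        tarr_tcomp)
  have o': "S' \<in> Obj C" "T' \<in> Obj C" "j' \<in> carrier (Hom C Z S')"
      "\<sigma>' \<in> carrier (Hom C S' T')" "p' \<in> carrier (Hom C T' X)"
    using T.isz_arr[OF T.ker_isz[OF k'(1)]] T.isz_arr[OF T.cok_isz[OF k'(2)]] by (auto simp:
        tarr_tcomp)
  obtain hs where hs: "hs ! 0 = ident C Z" "hs ! 3 = ident C X"
    and h: "\<forall>i<4. hs ! i \<in> carrier (Hom C ((Z # Es @ [X]) ! i) ((Z # Es' @ [X]) ! i))"
      "\<forall>i<3. hs ! (i + 1) \<cdot>\<^bsub>C\<^esub> fs ! i = fs' ! i \<cdot>\<^bsub>C\<^esub> hs ! i"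
    using assms by (auto simp: extension_morphisms_def eval_nat_numeral)
  have 1: "hs ! 1 \<in> carrier (Hom C S S')" "hs ! 2 \<in> carrier (Hom C T T')"
    using h(1) e e' by (auto dest: spec[of _ 1] spec[of _ 2])
  have "hs ! 1 \<cdot>\<^bsub>C\<^esub> j = j' \<cdot>\<^bsub>C\<^esub> ident C Z" using h(2) hs e e' by (auto dest!: spec[of _ 0])
  then have 2: "hs ! 1 \<cdot>\<^bsub>C\<^esub> j = j'" using ident_right o o' by simp
  have 3: "hs ! 2 \<cdot>\<^bsub>C\<^esub> \<sigma> = \<sigma>' \<cdot>\<^bsub>C\<^esub> hs ! 1" using h(2) e e' by (auto dest!: spec[of _ 1] simp:
      eval_nat_numeral)
  have "ident C X \<cdot>\<^bsub>C\<^esub> p = p' \<cdot>\<^bsub>C\<^esub> hs ! 2" using h(2) hs e e' by (auto dest!: spec[of _ 2] simp: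
      eval_nat_numeral)
  then have 4: "p' \<cdot>\<^bsub>C\<^esub> hs ! 2 = p" using ident_left o by simp
  have "tcomp C (Some (S, hs ! 1, S')) (Some (Z, j, S)) = Some (Z, j', S')"
    "tcomp C (Some (T, hs ! 2, T')) (Some (S, \<sigma>, T)) = tcomp C (Some (S', \<sigma>', T')) (Some (S, hs !
        1, S'))"
    "tcomp C (Some (T', p', X)) (Some (T, hs ! 2, T')) = Some (T, p, X)" using 1 2 3 4 o o' by
        simp_all
  then show ?thesis using e e' k k' by blast
qed

end

section \<open>Transfer to Hall numbers\<close>

text \<open>Orbits that meet coincide, and each is in bijection with the group by freeness. The laws
  are asked for on E only, which suits \<open>hall_action\<close>, a function restricted to the
  short exact sequences.\<close>

lemma card_orbits_free_action:
  fixes G (structure)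
  assumes "group G" and fin: "finite E"
    and closed: "\<And>g x. \<lbrakk>g \<in> carrier G; x \<in> E\<rbrakk> \<Longrightarrow> act g x \<in> E"
    and one: "\<And>x. x \<in> E \<Longrightarrow> act \<one> x = x"
    and mult: "\<And>g h x. \<lbrakk>g \<in> carrier G; h \<in> carrier G; x \<in> E\<rbrakk> \<Longrightarrow> act g (act h x) = act (g \<otimes> h) x"
    and free: "\<And>g h x. \<lbrakk>g \<in> carrier G; h \<in> carrier G; x \<in> E; act g x = act h x\<rbrakk> \<Longrightarrow> g = h"
  shows "order G * card (orbits G E act) = card E"
proof -
  interpret G: group G by fact
  have un: "\<Union>(orbits G E act) = E"
  proof (intro equalityI subsetI)
    fix x assume "x \<in> E"
    then have "x \<in> orbit G act x" using one by (auto simp: orbit_def intro!: exI[of _ \<one>])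
    then show "x \<in> \<Union>(orbits G E act)" using \<open>x \<in> E\<close> by (auto simp: orbits_def)
  qed (auto simp: orbits_def orbit_def closed)
  have sub: "orbit G act x \<subseteq> orbit G act y"
    if "x \<in> E" "y \<in> E" "g \<in> carrier G" "h \<in> carrier G" "act g x = act h y" for x y g h
  proof
    fix z assume "z \<in> orbit G act x"
    then obtain k where k: "k \<in> carrier G" "z = act k x" by (auto simp: orbit_def)
    have "z = act ((k \<otimes> inv g) \<otimes> g) x" using k that by (simp add: G.m_assoc)
    also have "\<dots> = act (k \<otimes> inv g) (act g x)" by (rule mult[symmetric]) (use k that in simp_all)
    also have "\<dots> = act (k \<otimes> inv g) (act h y)" using that by simp
    also have "\<dots> = act (k \<otimes> inv g \<otimes> h) y" by (rule mult) (use k that in simp_all)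
    finally show "z \<in> orbit G act y" using k that by (auto simp: orbit_def)
  qed
  have disj: "c \<inter> c' = {}" if cc: "c \<in> orbits G E act" "c' \<in> orbits G E act" "c \<noteq> c'" for c c'
  proof (rule ccontr)
    obtain x y where xy: "x \<in> E" "c = orbit G act x" "y \<in> E" "c' = orbit G act y" using cc by
        (auto simp: orbits_def)
    assume "c \<inter> c' \<noteq> {}"
    then obtain g h where gh: "g \<in> carrier G" "h \<in> carrier G" "act g x = act h y"
      unfolding xy orbit_def by blast
    have "c = c'" unfolding xy(2,4) using sub[OF xy(1,3) gh] sub[OF xy(3,1) gh(2,1)
        gh(3)[symmetric]] by blast
    then show False using cc(3) by simp
  qed
  have "finite (orbits G E act)" by (rule finite_UnionD) (simp add: un fin)
  moreover have "card c = order G" if c: "c \<in> orbits G E act" for c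
  proof -
    obtain x where x: "x \<in> E" "c = orbit G act x" using c by (auto simp: orbits_def)
    have "c = (\<lambda>g. act g x) ` carrier G" using x by (auto simp: orbit_def)
    moreover have "inj_on (\<lambda>g. act g x) (carrier G)" using free x(1) by (auto intro!: inj_onI)
    ultimately show ?thesis by (simp add: card_image order_def)
  qed
  ultimately show ?thesis using card_partition[of "orbits G E act" "order G"] un fin disj by simp
qed

text \<open>Serves Ext^1: the morphisms of extensions of length one already form an equivalence
  relation, so generating one adds nothing.\<close>

lemma quotient_zigzag:
  assumes "equiv A r" shows "A // (r \<union> r\<inverse>)\<^sup>* = A // r"
proof -
  have s: "sym r" "trans r" "refl_on A r" using assms by (auto elim: equivE)
  have "r \<union> r\<inverse> = r" using s(1) by (auto dest: symD)
  moreover have "r\<^sup>* `` {a} = r `` {a}" if "a \<in> A" for a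
  proof (intro equalityI subsetI)
    fix b assume "b \<in> r\<^sup>* `` {a}"
    then have "(a, b) \<in> r\<^sup>*" by simp
    then show "b \<in> r `` {a}"
    proof (induction rule: rtrancl_induct)
      case base then show ?case using refl_onD[OF s(3) that] by simp
    next
      case (step y z) then show ?case using transD[OF s(2)] by blast
    qed
  qed auto
  ultimately show ?thesis unfolding quotient_def by auto
qed

context abelian_linear_category
begin

lemma hom_tag: "\<lbrakk>X \<in> Obj C; Y \<in> Obj C\<rbrakk> \<Longrightarrow> T.hom X Y = (\<lambda>f. Some (X, f, Y)) ` carrier (Hom C X Y)"
  by (auto simp: T.hom_def image_iff elim!: tarrE)

lemma card_hom_tag: "\<lbrakk>X \<in> Obj C; Y \<in> Obj C\<rbrakk> \<Longrightarrow> card (T.hom X Y) = card (carrier (Hom C X Y))"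
  by (simp add: hom_tag card_image inj_on_def)

lemma ses_tagE:
  assumes "T.ses f g"
  obtains Z \<phi> L \<psi> X where "f = Some (Z, \<phi>, L)" "g = Some (L, \<psi>, X)"
proof -
  have a: "tarr C f" "tarr C g" "ttgt f = tsrc g" using T.ses_arr[OF assms] by blast+
  obtain Z \<phi> L where f: "f = Some (Z, \<phi>, L)" using a(1) by (rule tarrE)
  obtain L' \<psi> X where g: "g = Some (L', \<psi>, X)" using a(2) by (rule tarrE)
  show thesis using that[of Z \<phi> L \<psi> X] f g a(3) by simp
qed

lemma sess_tag: "T.sess X Z L = (\<lambda>(\<phi>, \<psi>). (Some (Z, \<phi>, L), Some (L, \<psi>, X))) ` hall_pairs C X Z L"
proof (intro equalityI subsetI)
  fix x assume "x \<in> T.sess X Z L"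
  then obtain f g where x: "x = (f, g)" "T.ses f g" "tsrc f = Z" "ttgt f = L" "ttgt g = X"
    by (auto simp: T.sess_def)
  obtain \<phi> \<psi> where "f = Some (Z, \<phi>, L)" "g = Some (L, \<psi>, X)"
    using ses_tagE[OF x(2)] x(3-5) by (metis tag_simps(1,3))
  then show "x \<in> (\<lambda>(\<phi>, \<psi>). (Some (Z, \<phi>, L), Some (L, \<psi>, X))) ` hall_pairs C X Z L"
    using x hall_pairs_iff by (intro image_eqI[of _ _ "(\<phi>, \<psi>)"]) auto
qed (auto simp: T.sess_def hall_pairs_iff)

lemma card_sess_tag: "card (T.sess X Z L) = card (hall_pairs C X Z L)"
  unfolding sess_tag by (rule card_image) (auto simp: inj_on_def)

lemma iso_tag: "T.iso X Y = (\<lambda>f. Some (X, f, Y)) ` {f \<in> carrier (Hom C X Y). X \<in> Obj C \<and> Y \<in> Obj C \<and>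
    (\<exists>g\<in>carrier (Hom C Y X). g \<cdot>\<^bsub>C\<^esub> f = ident C X \<and> f \<cdot>\<^bsub>C\<^esub> g = ident C Y)}"
proof (intro equalityI subsetI)
  fix x assume x: "x \<in> T.iso X Y"
  obtain f where f: "x = Some (X, f, Y)" "f \<in> carrier (Hom C X Y)" "X \<in> Obj C" "Y \<in> Obj C"
    using T.isoD(1-3)[OF x] by (metis tarrE tag_simps(1,3))
  obtain y where y: "y \<in> T.iso Y X" "tcomp C y x = tidn C X" "tcomp C x y = tidn C Y" using
      T.isoD(8)[OF x] by blast
  obtain g where g: "y = Some (Y, g, X)" "g \<in> carrier (Hom C Y X)"
    using T.isoD(1-3)[OF y(1)] by (metis tarrE tag_simps(1,3))
  show "x \<in> (\<lambda>f. Some (X, f, Y)) ` {f \<in> carrier (Hom C X Y). X \<in> Obj C \<and> Y \<in> Obj C \<and>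
    (\<exists>g\<in>carrier (Hom C Y X). g \<cdot>\<^bsub>C\<^esub> f = ident C X \<and> f \<cdot>\<^bsub>C\<^esub> g = ident C Y)}"
    using f g y by (auto simp: tidn_def)
next
  fix x assume "x \<in> (\<lambda>f. Some (X, f, Y)) ` {f \<in> carrier (Hom C X Y). X \<in> Obj C \<and> Y \<in> Obj C \<and>
    (\<exists>g\<in>carrier (Hom C Y X). g \<cdot>\<^bsub>C\<^esub> f = ident C X \<and> f \<cdot>\<^bsub>C\<^esub> g = ident C Y)}"
  then obtain f g where "x = Some (X, f, Y)" "f \<in> carrier (Hom C X Y)" "X \<in> Obj C" "Y \<in> Obj C"
    "g \<in> carrier (Hom C Y X)" "g \<cdot>\<^bsub>C\<^esub> f = ident C X" "f \<cdot>\<^bsub>C\<^esub> g = ident C Y" by blast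
  then show "x \<in> T.iso X Y"
    by (auto simp: T.iso_def T.hom_def tidn_def intro!: exI[of _ "Some (Y, g, X)"])
qed

lemma iso_nonempty_iff: "T.iso X Y \<noteq> {} \<longleftrightarrow> (X, Y) \<in> iso_rel C"
  unfolding iso_tag iso_rel_def by auto

lemma carrier_Aut: "carrier (Aut C X) = {f \<in> carrier (Hom C X X). \<exists>g\<in>carrier (Hom C X X). g \<cdot>\<^bsub>C\<^esub> f
    = ident C X \<and> f \<cdot>\<^bsub>C\<^esub> g = ident C X}"
  by (auto simp: Aut_def units_of_carrier Units_def)

lemma Aut_simps: "f \<otimes>\<^bsub>Aut C X\<^esub> g = f \<cdot>\<^bsub>C\<^esub> g" "\<one>\<^bsub>Aut C X\<^esub> = ident C X"
  by (simp_all add: Aut_def units_of_mult units_of_one)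

lemma Aut_group: "X \<in> Obj C \<Longrightarrow> group (Aut C X)"
  unfolding Aut_def
  by (intro monoid.units_group monoidI) (auto simp: comp_closed ident_closed ident_left
      ident_right comp_assoc)

lemma Aut_iso: "X \<in> Obj C \<Longrightarrow> f \<in> carrier (Aut C X) \<longleftrightarrow> Some (X, f, X) \<in> T.iso X X"
  unfolding iso_tag carrier_Aut by auto

lemma aut_card_eq: "X \<in> Obj C \<Longrightarrow> aut_card C X = card (T.iso X X)"
proof -
  assume X: "X \<in> Obj C"
  have "T.iso X X = (\<lambda>f. Some (X, f, X)) ` carrier (Aut C X)"
    unfolding iso_tag carrier_Aut using X by simp
  then show ?thesis by (simp add: aut_card_def order_def card_image inj_on_def)
qed

text \<open>The action is free because the first map of a short exact sequence is mono and the
  second epi. All orbits then have the size of the acting group.\<close>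

lemma hall_number_eq:
  assumes O: "X \<in> Obj C" "Z \<in> Obj C" and fin: "finite (hall_pairs C X Z L)"
  shows "aut_card C X * aut_card C Z * hall_number C X Z L = card (hall_pairs C X Z L)"
proof -
  interpret X: group "Aut C X" by (rule Aut_group[OF O(1)])
  interpret Z: group "Aut C Z" by (rule Aut_group[OF O(2)])
  let ?G = "Aut C X \<times>\<times> Aut C Z" and ?E = "hall_pairs C X Z L"
  have inv: "inv\<^bsub>Aut C Z\<^esub> g \<in> carrier (Hom C Z Z)" if "g \<in> carrier (Aut C Z)" for g
    using Z.inv_closed[OF that] carrier_Aut by auto
  have homX: "g \<in> carrier (Hom C X X)" if "g \<in> carrier (Aut C X)" for g using that carrier_Aut by
      auto
  have E: "\<phi> \<in> carrier (Hom C Z L)" "\<psi> \<in> carrier (Hom C L X)" "L \<in> Obj C" if "(\<phi>, \<psi>) \<in> ?E" for \<phi> \<psi>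
    using T.ses_arr[OF hall_pairs_iff[THEN iffD1, OF that]] by simp_all
  have act: "hall_action C X Z L (f, g) (\<phi>, \<psi>) = (\<phi> \<cdot>\<^bsub>C\<^esub> (inv\<^bsub>Aut C Z\<^esub> g), f \<cdot>\<^bsub>C\<^esub> \<psi>)" if "(\<phi>, \<psi>) \<in>
      ?E" for f g \<phi> \<psi>
    using that by (simp add: hall_action_def)
  have closed: "(\<phi> \<cdot>\<^bsub>C\<^esub> (inv\<^bsub>Aut C Z\<^esub> g), f \<cdot>\<^bsub>C\<^esub> \<psi>) \<in> ?E"
    if e: "(\<phi>, \<psi>) \<in> ?E" and f: "f \<in> carrier (Aut C X)" and g: "g \<in> carrier (Aut C Z)" for f g \<phi> \<psi>
  proof -
    have i: "Some (Z, inv\<^bsub>Aut C Z\<^esub> g, Z) \<in> T.iso Z Z" "Some (X, f, X) \<in> T.iso X X"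
      using Aut_iso O f Z.inv_closed[OF g] by blast+
    then have "T.ses (tcomp C (Some (Z, \<phi>, L)) (Some (Z, inv\<^bsub>Aut C Z\<^esub> g, Z))) (tcomp C (Some (X,
        f, X)) (Some (L, \<psi>, X)))"
      using T.ses_iso[OF hall_pairs_iff[THEN iffD1, OF e]] by simp
    then show ?thesis using E[OF e] inv[OF g] homX[OF f] O by (simp add: hall_pairs_iff)
  qed
  have "order ?G * card (orbits ?G ?E (hall_action C X Z L)) = card ?E"
  proof (rule card_orbits_free_action[OF DirProd_group[OF X.is_group Z.is_group] fin])
    fix x assume x: "x \<in> ?E"
    obtain \<phi> \<psi> where x': "x = (\<phi>, \<psi>)" by (cases x)
    note e = x[unfolded x']
    have "inv\<^bsub>Aut C Z\<^esub> (ident C Z) = ident C Z" using Z.inv_one by (simp add: Aut_simps)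
    then show "hall_action C X Z L \<one>\<^bsub>?G\<^esub> x = x"
      using e E[OF e] O ident_left ident_right by (simp add: x' act DirProd_def Aut_simps)
    fix k assume k: "k \<in> carrier ?G"
    obtain f g where k': "k = (f, g)" "f \<in> carrier (Aut C X)" "g \<in> carrier (Aut C Z)" using k by
        (auto simp: DirProd_def)
    show "hall_action C X Z L k x \<in> ?E" using closed[OF e k'(2,3)] by (simp add: k' x' act e)
    fix h assume h: "h \<in> carrier ?G"
    obtain f' g' where h': "h = (f', g')" "f' \<in> carrier (Aut C X)" "g' \<in> carrier (Aut C Z)" using
        h by (auto simp: DirProd_def)
    \<comment> \<open>Precomposition alone would be a right action; the inverse reverses the order
      of products and makes it a left action.\<close>
    have "inv\<^bsub>Aut C Z\<^esub> (g \<cdot>\<^bsub>C\<^esub> g') = inv\<^bsub>Aut C Z\<^esub> g' \<cdot>\<^bsub>C\<^esub> inv\<^bsub>Aut C Z\<^esub> g"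
      using Z.inv_mult_group[OF k'(3) h'(3)] by (simp add: Aut_simps)
    moreover have "\<phi> \<cdot>\<^bsub>C\<^esub> inv\<^bsub>Aut C Z\<^esub> g' \<cdot>\<^bsub>C\<^esub> inv\<^bsub>Aut C Z\<^esub> g = \<phi> \<cdot>\<^bsub>C\<^esub> (inv\<^bsub>Aut C Z\<^esub> g' \<cdot>\<^bsub>C\<^esub>
        inv\<^bsub>Aut C Z\<^esub> g)"
      by (rule comp_assoc[OF O(2) O(2) O(2) E(3)[OF e] inv[OF k'(3)] inv[OF h'(3)] E(1)[OF e]])
    moreover have "f \<cdot>\<^bsub>C\<^esub> f' \<cdot>\<^bsub>C\<^esub> \<psi> = f \<cdot>\<^bsub>C\<^esub> (f' \<cdot>\<^bsub>C\<^esub> \<psi>)"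
      by (rule comp_assoc[OF E(3)[OF e] O(1) O(1) O(1) E(2)[OF e] homX[OF h'(2)] homX[OF k'(2)]])
    ultimately show "hall_action C X Z L k (hall_action C X Z L h x) = hall_action C X Z L (k
        \<otimes>\<^bsub>?G\<^esub> h) x"
      using closed[OF e h'(2,3)] by (simp add: k' h' x' act e DirProd_def Aut_simps)
    assume "hall_action C X Z L k x = hall_action C X Z L h x"
    then have eq: "\<phi> \<cdot>\<^bsub>C\<^esub> (inv\<^bsub>Aut C Z\<^esub> g) = \<phi> \<cdot>\<^bsub>C\<^esub> (inv\<^bsub>Aut C Z\<^esub> g')" "f \<cdot>\<^bsub>C\<^esub> \<psi> = f' \<cdot>\<^bsub>C\<^esub> \<psi>"
      by (simp_all add: k' h' x' act e)
    note s = hall_pairs_iff[THEN iffD1, OF e]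
    have "is_mono C Z L \<phi>" "is_epi C L X \<psi>" using mono_tag[OF T.ses_mono[OF s]] epi_tag[OF
        T.ses_epi[OF s]] by simp_all
    then have ff: "inv\<^bsub>Aut C Z\<^esub> g = inv\<^bsub>Aut C Z\<^esub> g'" "f = f'"
      using eq O inv[OF k'(3)] inv[OF h'(3)] homX[OF k'(2)] homX[OF h'(2)] unfolding is_mono_def
          is_epi_def by blast+
    have "g = g'" by (rule inj_onD[OF Z.inv_inj ff(1) k'(3) h'(3)])
    then show "k = h" using ff(2) k'(1) h'(1) by blast
  qed
  moreover have "order ?G = aut_card C X * aut_card C Z"
    by (simp add: order_def aut_card_def DirProd_def card_cartesian_product)
  ultimately show ?thesis by (simp add: hall_number_def)
qed

text \<open>The map \<open>h0\<close> sends a pair of lists to its two tagged arrows. It is onto and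
  preserves and reflects the relation given by morphisms.\<close>

lemma Ext_1_bij:
  shows "\<exists>h. bij_betw h (Ext C 1 X Z) (T.exts X Z // T.ext_rel X Z)"
proof -
  let ?A = "extensions C 1 X Z" and ?r = "extension_morphisms C 1 X Z"
  define h0 :: "'c list \<times> 'd list \<Rightarrow> ('c, 'd) tagged \<times> ('c, 'd) tagged" where "h0 = (\<lambda>(Es, fs).
      (Some (Z, fs ! 0, Es ! 0), Some (Es ! 0, fs ! 1, X)))"
  have h0A: "h0 a \<in> T.exts X Z" if "a \<in> ?A" for a
  proof -
    obtain Es fs where a: "a = (Es, fs)" by (cases a)
    then show ?thesis using that unfolding a extensions_1_iff by (auto simp: h0_def T.exts_def)
  qed
  have surj: "\<exists>a\<in>?A. e = h0 a" if e: "e \<in> T.exts X Z" for e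
  proof -
    obtain i q where iq: "e = (i, q)" "T.ses i q" "tsrc i = Z" "ttgt q = X" using e by (auto simp:
        T.exts_def)
    obtain f E g where "i = Some (Z, f, E)" "q = Some (E, g, X)" using ses_tagE[OF iq(2)] iq(3,4)
        by (metis tag_simps(1,3))
    then show ?thesis using iq extensions_1_iff by (intro bexI[of _ "([E], [f, g])"]) (auto simp:
        h0_def)
  qed
  have rel: "(a, b) \<in> ?r \<longleftrightarrow> (h0 a, h0 b) \<in> T.ext_rel X Z" if ab: "a \<in> ?A" "b \<in> ?A" for a b
  proof -
    obtain Es fs where a: "a = (Es, fs)" by (cases a)
    obtain Es' fs' where b: "b = (Es', fs')" by (cases b)
    obtain E f g where 1: "Es = [E]" "fs = [f, g]" "T.ses (Some (Z, f, E)) (Some (E, g, X))"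
      using ab(1) unfolding a extensions_1_iff by blast
    obtain E' f' g' where 2: "Es' = [E']" "fs' = [f', g']" "T.ses (Some (Z, f', E')) (Some (E',
        g', X))"
      using ab(2) unfolding b extensions_1_iff by blast
    show ?thesis unfolding a b extension_morphisms_1_iff using 1 2 by (simp add: h0_def
        T.ext_rel_def T.exts_def)
  qed
  have rA: "?r \<subseteq> ?A \<times> ?A" by (auto simp: extension_morphisms_def)
  have eqT: "equiv (T.exts X Z) (T.ext_rel X Z)" by (rule T.equiv_ext_rel)
  have T: "refl_on (T.exts X Z) (T.ext_rel X Z)" "sym (T.ext_rel X Z)" "trans (T.ext_rel X Z)"
    using eqT by (auto elim: equivE)
  \<comment> \<open>The laws of an equivalence are pulled back along \<open>h0\<close> from the
    arrows, where symmetry came from the five lemma.\<close>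
  have eqr: "equiv ?A ?r"
  proof (rule equivI)
    show "?r \<subseteq> ?A \<times> ?A" by (rule rA)
    show "refl_on ?A ?r" using rel refl_onD[OF T(1)] h0A by (intro refl_onI) blast
    show "sym ?r"
    proof (rule symI)
      fix a b assume ab: "(a, b) \<in> ?r"
      then have m: "a \<in> ?A" "b \<in> ?A" using rA by auto
      show "(b, a) \<in> ?r" using ab symD[OF T(2)] unfolding rel[OF m] rel[OF m(2,1)] by blast
    qed
    show "trans ?r"
    proof (rule transI)
      fix a b c assume ab: "(a, b) \<in> ?r" "(b, c) \<in> ?r"
      then have m: "a \<in> ?A" "b \<in> ?A" "c \<in> ?A" using rA by auto
      show "(a, c) \<in> ?r" using ab transD[OF T(3)] unfolding rel[OF m(1,2)] rel[OF m(2,3)] rel[OF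
          m(1,3)] by blast
    qed
  qed
  have "Ext C 1 X Z = ?A // ?r" unfolding Ext_def by (rule quotient_zigzag[OF eqr])
  moreover have "\<exists>h. bij_betw h (?A // ?r) (T.exts X Z // T.ext_rel X Z)"
  proof (rule quotient_bij_of_relation[OF eqr eqT, where P = "\<lambda>a e. e = h0 a"])
    fix a a' b b' assume "a \<in> ?A" "a' \<in> ?A" "b = h0 a" "b' = h0 a'"
    then show "(a, a') \<in> ?r \<longleftrightarrow> (b, b') \<in> T.ext_rel X Z" using rel by blast
  qed (use h0A surj in auto)
  ultimately show ?thesis by simp
qed

text \<open>As Ext^2(X, Z) is a single class, the given sequence is joined to the trivial one by a
  zigzag of morphisms, along which the existence of a completion is invariant.\<close>

lemma completion_ex:
  assumes "hereditary C" and k: "T.ker j \<sigma>" "T.cok p \<sigma>"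
  shows "\<exists>s t. tcomp C t s = \<sigma> \<and> T.ses s (tcomp C p t)"
proof -
  have a: "tarr C (tcomp C \<sigma> j)" "tarr C (tcomp C p \<sigma>)" using T.isz_arr T.ker_isz[OF k(1)]
      T.cok_isz[OF k(2)] by blast+
  obtain Z j' S \<sigma>' T' p' X where t: "j = Some (Z, j', S)" "\<sigma> = Some (S, \<sigma>', T')" "p = Some (T',
      p', X)"
     and O: "Z \<in> Obj C" "X \<in> Obj C" using a unfolding tarr_tcomp by (auto elim!: tarrE)
  let ?A = "extensions C 2 X Z" and ?r = "extension_morphisms C 2 X Z"
  \<comment> \<open>Existence of a completion, phrased for pairs of lists because the zigzag runs
    through these.\<close>
  define good where "good = (\<lambda>(Es, fs). \<exists>S T j \<sigma> p s t. Es = [S, T] \<and> fs = [j, \<sigma>, p] \<and>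
      tcomp C t s = Some (S, \<sigma>, T) \<and> T.ses s (tcomp C (Some (T, p, X)) t))"
  have step: "good e \<longleftrightarrow> good e'" if ee: "(e, e') \<in> ?r" for e e'
  proof -
    obtain Es fs where e: "e = (Es, fs)" by (cases e)
    obtain Es' fs' where e': "e' = (Es', fs')" by (cases e')
    obtain S T j \<sigma> p S' T' j' \<sigma>' p' h1 h2 where 1: "Es = [S, T]" "fs = [j, \<sigma>, p]" "Es' = [S', T']"
        "fs' = [j', \<sigma>', p']"
     and k: "T.ker (Some (Z, j, S)) (Some (S, \<sigma>, T))" "T.cok (Some (T, p, X)) (Some (S, \<sigma>, T))"
     and k': "T.ker (Some (Z, j', S')) (Some (S', \<sigma>', T'))" "T.cok (Some (T', p', X)) (Some (S',
         \<sigma>', T'))"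
     and h: "tcomp C h1 (Some (Z, j, S)) = Some (Z, j', S')"
       "tcomp C h2 (Some (S, \<sigma>, T)) = tcomp C (Some (S', \<sigma>', T')) h1"
       "tcomp C (Some (T', p', X)) h2 = Some (T, p, X)"
      using extension_morphisms_2D[OF ee[unfolded e e']] by (elim exE conjE) (rule that)
    show ?thesis
    proof
      assume "good e"
      then obtain s t where st: "tcomp C t s = Some (S, \<sigma>, T)" "T.ses s (tcomp C (Some (T, p, X))
          t)"
        unfolding good_def e using 1 by auto
      show "good e'" using T.compl_push[OF k k' h st] unfolding good_def e' using 1 by auto
    next
      assume "good e'"
      then obtain s t where st: "tcomp C t s = Some (S', \<sigma>', T')" "T.ses s (tcomp C (Some (T', p',
          X)) t)"
        unfolding good_def e' using 1 by auto
      \<comment> \<open>The dual statement \<open>compl_pull\<close> speaks of the other short exact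
        sequence of a completion, so exactness is converted before its use and converted back after
        it.\<close>
      have "T.ses (tcomp C s (Some (Z, j', S'))) t" by (rule T.compl_of_left[OF k' st])
      from T.compl_pull[OF k'(2,1) k(2,1) h(3) h(2)[symmetric] h(1) st(1) this]
      obtain s t where "tcomp C t s = Some (S, \<sigma>, T)" "T.ses (tcomp C s (Some (Z, j, S))) t" by
          blast
      moreover from this have "T.ses s (tcomp C (Some (T, p, X)) t)" by (intro T.compl_of_right[OF
          k(2,1)])
      ultimately show "good e" unfolding good_def e using 1 by auto
    qed
  qed
  let ?ext = "([S, T'], [j', \<sigma>', p'])"
  have e: "?ext \<in> ?A" using extensions_2_iff k unfolding t by blast
  obtain s0 t0 where split: "T.ker (tidn C Z) (tzer C Z X)" "T.cok (tidn C X) (tzer C Z X)"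
    "tcomp C t0 s0 = tzer C Z X" "T.ses s0 (tcomp C (tidn C X) t0)" using T.compl_split[OF O(2,1)]
        by blast
  \<comment> \<open>The trivial two-fold extension of X by Z, completed by the biproduct.\<close>
  let ?trivial = "([Z, X], [ident C Z, \<zero>\<^bsub>Hom C Z X\<^esub>, ident C X])"
  have e0: "?trivial \<in> ?A" using extensions_2_iff split(1,2) unfolding tidn_def tzer_def by blast
  have g0: "good ?trivial" using split(3,4) unfolding good_def tidn_def tzer_def by auto
  have "is_singleton (Ext C 2 X Z)" using assms(1) O by (simp add: hereditary_def)
  moreover have "(?r \<union> ?r\<inverse>)\<^sup>* `` {?ext} \<in> Ext C 2 X Z" "(?r \<union> ?r\<inverse>)\<^sup>* `` {?trivial} \<in> Ext C 2 X Z"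
    unfolding Ext_def using e e0 by (auto intro: quotientI)
  ultimately have "(?r \<union> ?r\<inverse>)\<^sup>* `` {?ext} = (?r \<union> ?r\<inverse>)\<^sup>* `` {?trivial}" by (auto simp:
      is_singleton_def)
  then have "(?trivial, ?ext) \<in> (?r \<union> ?r\<inverse>)\<^sup>*" by blast
  moreover have "good b" if "(a, b) \<in> (?r \<union> ?r\<inverse>)\<^sup>*" "good a" for a b
    using that by (induction rule: rtrancl_induct) (use step in blast)+
  ultimately have "good ?ext" using g0 by blast
  then show ?thesis unfolding good_def t by auto
qed

lemma iso_rel_equiv: "equiv (Obj C) (iso_rel C)"
proof (rule equivI)
  show "iso_rel C \<subseteq> Obj C \<times> Obj C" by (auto simp: iso_rel_def)
  show "refl_on (Obj C) (iso_rel C)"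
    using T.idn_iso iso_nonempty_iff by (intro refl_onI) blast
  show "sym (iso_rel C)" by (rule symI) (auto simp: iso_rel_def)
  show "trans (iso_rel C)"
    using T.iso_comp unfolding iso_nonempty_iff[symmetric] by (intro transI) (metis
        all_not_in_conv iso_nonempty_iff)
qed

lemma finitary_tag:
  assumes "finitary C" "hereditary C"
  shows "finitary_cat (Obj C) (tarr C) tsrc ttgt (tcomp C) (tadd C) (tneg C) (tzer C) (tidn C)
      (iso_reps C)"
proof unfold_locales
  fix X Y assume XY: "X \<in> Obj C" "Y \<in> Obj C"
  show "finite (T.hom X Y)" using XY assms(1) by (simp add: hom_tag finitary_def)
  have "finite (Ext C 1 X Y)" using XY assms(1) by (simp add: finitary_def)
  then show "finite (T.exts X Y // T.ext_rel X Y)" using Ext_1_bij bij_betw_finite by blast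
next
  fix j \<sigma> p assume "T.ker j \<sigma>" "T.cok p \<sigma>"
  then show "\<exists>s t. tcomp C t s = \<sigma> \<and> T.ses s (tcomp C p t)" by (rule completion_ex[OF assms(2)])
next
  have some: "(SOME X. X \<in> c) \<in> c" if c: "c \<in> Obj C // iso_rel C" for c
    using in_quotient_imp_non_empty[OF iso_rel_equiv c] some_in_eq by blast
  show "iso_reps C \<subseteq> Obj C"
    unfolding iso_reps_def using some in_quotient_imp_subset[OF iso_rel_equiv] by blast
  show "\<exists>Y\<in>iso_reps C. T.iso X Y \<noteq> {}" if X: "X \<in> Obj C" for X
  proof -
    have c: "iso_rel C `` {X} \<in> Obj C // iso_rel C" using X by (rule quotientI)
    let ?Y = "SOME Y. Y \<in> iso_rel C `` {X}"
    have "?Y \<in> iso_reps C" unfolding iso_reps_def using c by blast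
    moreover have "(X, ?Y) \<in> iso_rel C" using some[OF c] by simp
    ultimately show ?thesis using iso_nonempty_iff by blast
  qed
  show "X = Y" if h: "X \<in> iso_reps C" "Y \<in> iso_reps C" "T.iso X Y \<noteq> {}" for X Y
  proof -
    obtain c d where cd: "c \<in> Obj C // iso_rel C" "X = (SOME X. X \<in> c)" "d \<in> Obj C // iso_rel C"
        "Y = (SOME X. X \<in> d)"
      using h(1,2) unfolding iso_reps_def by blast
    have "X \<in> c" "Y \<in> d" unfolding cd(2,4) using some cd by blast+
    then have "c = d" using quotient_eqI[OF iso_rel_equiv cd(1,3)] h(3) iso_nonempty_iff by blast
    then show ?thesis using cd by simp
  qed
qed

end

section \<open>The formula for Hall numbers, with sums over representatives\<close>

lemma infsum_finite_support:
  fixes f :: "'a \<Rightarrow> real"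
  assumes "finite F" "F \<subseteq> A" "\<And>x. x \<in> A - F \<Longrightarrow> f x = 0"
  shows "infsum f A = sum f F"
  using infsum_cong_neutral[of F A f f] assms by (auto simp: infsum_finite)

theorem corollary3p2:
  fixes K :: "('k, 'z) ring_scheme"
    and C :: "('o, 'k, 'm) linear_category"
    and q :: nat
    and M N M' N' :: 'o
  assumes "Ring.field K" and "finite (carrier K)" and "card (carrier K) = q"
    and "abelian_linear_category K C"
    and "finitary C"
    and "hereditary C"
    and "M \<in> Obj C" and "N \<in> Obj C" and "M' \<in> Obj C" and "N' \<in> Obj C"
  shows "finite {L \<in> iso_reps C. hall_number C M N L * hall_number C M' N' L \<noteq> 0}
    \<and> finite {(A, A', B, B') \<in> iso_reps C \<times> iso_reps C \<times> iso_reps C \<times> iso_reps C.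
          hall_number C A A' M * hall_number C B B' N *
          hall_number C A B M' * hall_number C A' B' N' \<noteq> 0}
    \<and> real (aut_card C M) * real (aut_card C N) * real (aut_card C M') * real (aut_card C N') *
        (\<Sum>\<^sub>\<infinity>L\<in>iso_reps C.
          real (hall_number C M N L) * real (hall_number C M' N' L) * (1 / real (aut_card C L)))
      = (\<Sum>\<^sub>\<infinity>(A, A', B, B')\<in>iso_reps C \<times> iso_reps C \<times> iso_reps C \<times> iso_reps C.
          real (card (Ext C 1 A B')) / real (card (carrier (Hom C A B'))) *
          real (hall_number C A A' M) * real (hall_number C B B' N) *
          real (hall_number C A B M') * real (hall_number C A' B' N') *
          real (aut_card C A) * real (aut_card C A') * real (aut_card C B) * real (aut_card C B'))"
proof -
  interpret abelian_linear_category K C by fact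
  interpret F: finitary_cat "Obj C" "tarr C" tsrc ttgt "tcomp C" "tadd C" "tneg C" "tzer C" "tidn
      C" "iso_reps C"
    by (rule finitary_tag) fact+
  note O = assms(7-10)
  let ?R = "iso_reps C" and ?g = "hall_number C"
  define a where "a X = real (aut_card C X)" for X
  have ai: "real (card (T.iso X X)) = a X" if "X \<in> Obj C" for X using aut_card_eq[OF that] by
      (simp add: a_def)
  have apos: "a X > 0" if "X \<in> Obj C" for X using F.card_iso_pos[OF that] ai[OF that] by simp
  have RO: "X \<in> Obj C" if "X \<in> ?R" for X using F.R_sub that by blast
  have fin: "finite (T.sess X Z L)" if "X \<in> Obj C" "Z \<in> Obj C" "L \<in> Obj C" for X Z L
    using F.finite_sess that by blast
  have finh: "finite (hall_pairs C X Z L)" if "X \<in> Obj C" "Z \<in> Obj C" "L \<in> Obj C" for X Z L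
    using fin[OF that] unfolding sess_tag by (rule finite_imageD) (auto simp: inj_on_def)
  have hall: "real (card (T.sess X Z L)) = a X * a Z * real (?g X Z L)"
    if "X \<in> Obj C" "Z \<in> Obj C" "L \<in> Obj C" for X Z L
    unfolding card_sess_tag hall_number_eq[OF that(1,2) finh[OF that], symmetric] by (simp add:
        a_def)
  \<comment> \<open>The automorphism factors are positive, so a Hall number vanishes exactly when no
    short exact sequence exists. This identifies the supports in the theorem with the index sets of
    \<open>green_count\<close>.\<close>
  have hall0: "?g X Z L = 0 \<longleftrightarrow> T.sess X Z L = {}" if "X \<in> Obj C" "Z \<in> Obj C" "L \<in> Obj C" for X Z L
  proof -
    have "?g X Z L = 0 \<longleftrightarrow> real (card (T.sess X Z L)) = 0"
      using hall[OF that] apos[OF that(1)] apos[OF that(2)] by simp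
    then show ?thesis using fin[OF that] by simp
  qed
  let ?FL = "{L \<in> ?R. ?g M N L * ?g M' N' L \<noteq> 0}"
  let ?FQ = "{(A, A', B, B') \<in> ?R \<times> ?R \<times> ?R \<times> ?R. ?g A A' M * ?g B B' N * ?g A B M' * ?g A' B' N'
      \<noteq> 0}"
  have FL: "?FL = {L \<in> ?R. T.crosses M N M' N' L \<noteq> {}}"
  proof (intro Collect_cong conj_cong refl)
    fix L assume "L \<in> ?R"
    then show "?g M N L * ?g M' N' L \<noteq> 0 \<longleftrightarrow> T.crosses M N M' N' L \<noteq> {}"
      using O RO by (simp add: T.crosses_def hall0 del: neq0_conv)
  qed
  have FQ: "?FQ = {Q \<in> ?R \<times> ?R \<times> ?R \<times> ?R. T.frames M N M' N' Q \<noteq> {}}"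
  proof (rule Set.set_eqI)
    fix Q :: "'o \<times> 'o \<times> 'o \<times> 'o"
    obtain A A' B B' where Q: "Q = (A, A', B, B')" by (metis prod.exhaust)
    show "Q \<in> ?FQ \<longleftrightarrow> Q \<in> {Q \<in> ?R \<times> ?R \<times> ?R \<times> ?R. T.frames M N M' N' Q \<noteq> {}}"
    proof (cases "A \<in> ?R \<and> A' \<in> ?R \<and> B \<in> ?R \<and> B' \<in> ?R")
      case True
      then show ?thesis using O RO unfolding Q by (simp add: T.frames_def hall0 del: neq0_conv)
    qed (auto simp: Q)
  qed
  note green = F.green_count[OF O, folded FL FQ]
  \<comment> \<open>The prefactor of the left side arises here: each of the two sequences of a cross
    contributes the automorphism numbers of its end terms.\<close>
  have L1: "real (card (T.crosses M N M' N' L)) / real (card (T.iso L L)) =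
      a M * a N * a M' * a N' * (real (?g M N L) * real (?g M' N' L) * (1 / a L))" if "L \<in> ?FL"
          for L
    using that hall O RO by (simp add: T.crosses_def card_cartesian_product ai)
  have Q1: "real (card (T.exts A B' // T.ext_rel A B')) / real (card (T.hom A B')) *
        real (card (T.frames M N M' N' (A, A', B, B'))) / (real (card (T.iso A A)) * real (card
            (T.iso A' A')) *
          real (card (T.iso B B)) * real (card (T.iso B' B'))) =
      real (card (Ext C 1 A B')) / real (card (carrier (Hom C A B'))) * real (?g A A' M) * real
          (?g B B' N) *
          real (?g A B M') * real (?g A' B' N') * a A * a A' * a B * a B'"
    if m: "A \<in> ?R" "A' \<in> ?R" "B \<in> ?R" "B' \<in> ?R" for A A' B B'
  proof -
    have mO: "A \<in> Obj C" "A' \<in> Obj C" "B \<in> Obj C" "B' \<in> Obj C" using m RO by auto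
    have e: "card (T.exts A B' // T.ext_rel A B') = card (Ext C 1 A B')"
      using Ext_1_bij[of A B'] bij_betw_same_card by metis
    \<comment> \<open>Every corner is an end term of two sides, so its automorphism number occurs
      squared; the denominator in \<open>Q1\<close> cancels one power.\<close>
    have f: "real (card (T.frames M N M' N' (A, A', B, B'))) =
      (a A * a A' * real (?g A A' M)) * (a B * a B' * real (?g B B' N)) *
      (a A * a B * real (?g A B M')) * (a A' * a B' * real (?g A' B' N'))"
      using hall mO O by (simp add: T.frames_def card_cartesian_product mult.assoc)
    show ?thesis
      unfolding e f card_hom_tag[OF mO(1,4)] ai[OF mO(1)] ai[OF mO(2)] ai[OF mO(3)] ai[OF mO(4)]
      using apos[OF mO(1)] apos[OF mO(2)] apos[OF mO(3)] apos[OF mO(4)] by (simp add: field_simps)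
  qed
  \<comment> \<open>All terms outside the finite support vanish, so the infinite sum over
    representatives is a finite one.\<close>
  have "a M * a N * a M' * a N' * (\<Sum>\<^sub>\<infinity>L\<in>?R. real (?g M N L) * real (?g M' N' L) * (1 / a L)) =
     a M * a N * a M' * a N' * (\<Sum>L\<in>?FL. real (?g M N L) * real (?g M' N' L) * (1 / a L))"
    using infsum_finite_support[OF green(1), of ?R "\<lambda>L. real (?g M N L) * real (?g M' N' L) * (1 /
        a L)"] by auto
  also have "\<dots> = (\<Sum>L\<in>?FL. real (card (T.crosses M N M' N' L)) / real (card (T.iso L L)))"
    unfolding sum_distrib_left using L1 by (intro sum.cong) simp_all
  also have "\<dots> = (\<Sum>(A, A', B, B')\<in>?FQ. real (card (T.exts A B' // T.ext_rel A B')) / real (card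
      (T.hom A B')) *
        real (card (T.frames M N M' N' (A, A', B, B'))) / (real (card (T.iso A A)) * real (card
            (T.iso A' A')) *
          real (card (T.iso B B)) * real (card (T.iso B' B'))))"
    by (rule green(3))
  also have "\<dots> = (\<Sum>(A, A', B, B')\<in>?FQ. real (card (Ext C 1 A B')) / real (card (carrier (Hom C A
      B'))) *
          real (?g A A' M) * real (?g B B' N) * real (?g A B M') * real (?g A' B' N') * a A * a A'
              * a B * a B')"
  proof (rule sum.cong[OF refl])
    fix Q assume "Q \<in> ?FQ"
    then obtain A A' B B' where "Q = (A, A', B, B')" "A \<in> ?R" "A' \<in> ?R" "B \<in> ?R" "B' \<in> ?R" by auto
    then show "(case Q of (A, A', B, B') \<Rightarrow> real (card (T.exts A B' // T.ext_rel A B')) / real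
        (card (T.hom A B')) *
        real (card (T.frames M N M' N' (A, A', B, B'))) / (real (card (T.iso A A)) * real (card
            (T.iso A' A')) *
          real (card (T.iso B B)) * real (card (T.iso B' B')))) =
      (case Q of (A, A', B, B') \<Rightarrow> real (card (Ext C 1 A B')) / real (card (carrier (Hom C A B'))) *
          real (?g A A' M) * real (?g B B' N) * real (?g A B M') * real (?g A' B' N') * a A * a A'
              * a B * a B')"
      using Q1 by simp
  qed
  also have "\<dots> = (\<Sum>\<^sub>\<infinity>(A, A', B, B')\<in>?R \<times> ?R \<times> ?R \<times> ?R. real (card (Ext C 1 A B')) / real (card
      (carrier (Hom C A B'))) *
          real (?g A A' M) * real (?g B B' N) * real (?g A B M') * real (?g A' B' N') * a A * a A'
              * a B * a B')"
    by (rule infsum_finite_support[OF green(2), symmetric]) auto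
  finally show ?thesis using green(1,2) unfolding a_def by blast
qed

end
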